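(* Let $G=(G,\tau_G)$ be a weakly almost periodic group. If $\tau\in\overline{\mathcal T}(G)$ and $u_1,\dots,u_n\in\mathcal I(\tau)$, then for any $\varepsilon>0$ and for any neighbourhood $U$ of $e_G$ in $\tau$, there is $t\in U$ for which $|u_k(t)|<\varepsilon$ for each $k=1,\dots,n$.
   Context: For a topological group $(G,\tau_G)$, $\mathcal W(G)$ is the C*-algebra of bounded continuous complex functions $u$ on $G$ for which the weak closure of $\{u\cdot s:s\in G\}$, $(u\cdot s)(t)=u(st)$, is weakly compact. $\varepsilon^{\mathcal W}:G\to\mathcal W(G)^*$ is evaluation, and $G^{\mathcal W}=\overline{\varepsilon^{\mathcal W}(G)}^{w^*}$ is the Gelfand spectrum of $\mathcal W(G)$, a compact semitopological semigroup. For $s\in G^{\mathcal W}$, $u\in\mathcal W(G)$, $(u\cdot s)(t)=\lim_iu(s_it)$ where $(s_i)$ is any net in $G$ with $s=\lim_i\varepsilon^{\mathcal W}(s_i)$. $\sigma(X,\mathcal F)$ denotes the initial topology. $\mathcal T(G)=\{\tau\subseteq\tau_G:\tau\text{ is a group topology with }\tau=\sigma(G,\mathcal W^\tau(G))\}$, where $\mathcal W^\tau(G)$ is the set of $\tau$-continuous elements of $\mathcal W(G)$. $G$ is weakly almost periodic if $\tau_G$ is Hausdorff and $\tau_G\in\mathcal T(G)$. For $\tau\in\mathcal T(G)$, $\eta_\tau:G\to G_\tau$ is the canonical map into the completion $G_\tau$ of $G/\overline{\{e_G\}}^\tau$ in the two-sided uniformity; $\eta^{\mathcal W}_\tau:G^{\mathcal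 W}\to G_\tau^{\mathcal W}$ is the unique continuous homomorphism extending it, and $e^{\mathcal W}_\tau$ is the identity of $G_\tau^{\mathcal W}$. $\mathrm{ZE}(G^{\mathcal W})$ is the set of central idempotents of $G^{\mathcal W}$. For $e\in\mathrm{ZE}(G^{\mathcal W})$, $T(e)=\sigma(G,\{\eta_e\})$ where $\eta_e(s)=e\,\varepsilon^{\mathcal W}(s)$. For $\tau\in\mathcal T(G)$, $E(\tau)\in\mathrm{ZE}(G^{\mathcal W})$ is the minimal idempotent of the closed semigroup $(\eta^{\mathcal W}_\tau)^{-1}(\{e^{\mathcal W}_\tau\})$. $\overline{\mathcal T}(G)=T(\mathrm{ZE}(G^{\mathcal W}))$. For $\tau\in\overline{\mathcal T}(G)$, $\mathcal I(\tau)=\{u\in\mathcal W(G):u\cdot E(\tau)=0\}$. *)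

theory Defs
  imports "HOL-Analysis.Analysis" "HOL-Algebra.Coset"
begin

section \<open>Topologies\<close>

text \<open>The initial topology \<open>\<sigma>(X, \<F>)\<close> of a family of maps from \<open>X\<close> into the space \<open>Y\<close>.\<close>

definition initial_topology :: "'a set \<Rightarrow> 'b topology \<Rightarrow> ('a \<Rightarrow> 'b) set \<Rightarrow> 'a topology" where
  "initial_topology X Y \<F> =
     topology_generated_by (insert X {X \<inter> f -` V | f V. f \<in> \<F> \<and> openin Y V})"

definition quotient_topology :: "'a topology \<Rightarrow> ('a \<Rightarrow> 'b) \<Rightarrow> 'b topology" where
  "quotient_topology \<tau> q =
     topology (\<lambda>V. V \<subseteq> q ` topspace \<tau> \<and> openin \<tau> {x \<in> topspace \<tau>. q x \<in> V})"

lemma openin_quotient_topology: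
  "openin (quotient_topology \<tau> q) V \<longleftrightarrow>
     V \<subseteq> q ` topspace \<tau> \<and> openin \<tau> {x \<in> topspace \<tau>. q x \<in> V}"
proof -
  have "istopology (\<lambda>V. V \<subseteq> q ` topspace \<tau> \<and> openin \<tau> {x \<in> topspace \<tau>. q x \<in> V})"
    unfolding istopology_def
  proof (intro conjI allI impI)
    fix S T
    assume S: "S \<subseteq> q ` topspace \<tau> \<and> openin \<tau> {x \<in> topspace \<tau>. q x \<in> S}"
      and T: "T \<subseteq> q ` topspace \<tau> \<and> openin \<tau> {x \<in> topspace \<tau>. q x \<in> T}"
    show "S \<inter> T \<subseteq> q ` topspace \<tau>" using S by blast
    have "{x \<in> topspace \<tau>. q x \<in> S \<inter> T}
        = {x \<in> topspace \<tau>. q x \<in> S} \<inter> {x \<in> topspace \<tau>. q x \<in> T}" by auto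
    then show "openin \<tau> {x \<in> topspace \<tau>. q x \<in> S \<inter> T}"
      using S T by (simp add: openin_Int)
  next
    fix \<K>
    assume K: "\<forall>K\<in>\<K>. K \<subseteq> q ` topspace \<tau> \<and> openin \<tau> {x \<in> topspace \<tau>. q x \<in> K}"
    show "\<Union>\<K> \<subseteq> q ` topspace \<tau>" using K by blast
    have "{x \<in> topspace \<tau>. q x \<in> \<Union>\<K>} = \<Union>((\<lambda>K. {x \<in> topspace \<tau>. q x \<in> K}) ` \<K>)"
      by auto
    moreover have "openin \<tau> (\<Union>((\<lambda>K. {x \<in> topspace \<tau>. q x \<in> K}) ` \<K>))"
      by (rule openin_Union) (use K in auto)
    ultimately show "openin \<tau> {x \<in> topspace \<tau>. q x \<in> \<Union>\<K>}"
      by simp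
  qed
  then show ?thesis
    unfolding quotient_topology_def by (simp add: topology_inverse')
qed

section \<open>Topological groups\<close>

definition topological_group :: "('a, 'm) monoid_scheme \<Rightarrow> 'a topology \<Rightarrow> bool" where
  "topological_group G \<tau> \<longleftrightarrow>
     group G \<and> topspace \<tau> = carrier G \<and>
     continuous_map (prod_topology \<tau> \<tau>) \<tau> (\<lambda>(x, y). x \<otimes>\<^bsub>G\<^esub> y) \<and>
     continuous_map \<tau> \<tau> (\<lambda>x. inv\<^bsub>G\<^esub> x)"

section \<open>Weakly almost periodic functions\<close>

text \<open>Functions on a set \<open>X\<close> and functionals on a space \<open>V\<close> of such functions are represented by
  elements of \<open>extensional X\<close> and \<open>extensional V\<close>, respectively.\<close>

definition bounded_cont :: "'a topology \<Rightarrow> ('a \<Rightarrow> complex) set" where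
  "bounded_cont \<tau> = {u \<in> extensional (topspace \<tau>).
     continuous_map \<tau> euclidean u \<and> bounded (u ` topspace \<tau>)}"

definition sup_norm :: "'a set \<Rightarrow> ('a \<Rightarrow> complex) \<Rightarrow> real" where
  "sup_norm X u = (SUP x\<in>X. cmod (u x))"

definition dual_space ::
    "'a set \<Rightarrow> ('a \<Rightarrow> complex) set \<Rightarrow> (('a \<Rightarrow> complex) \<Rightarrow> complex) set" where
  "dual_space X V = {\<phi> \<in> extensional V.
     (\<forall>u\<in>V. \<forall>v\<in>V. \<phi> (\<lambda>x\<in>X. u x + v x) = \<phi> u + \<phi> v) \<and>
     (\<forall>c. \<forall>u\<in>V. \<phi> (\<lambda>x\<in>X. c * u x) = c * \<phi> u) \<and>
     (\<exists>K. \<forall>u\<in>V. cmod (\<phi> u) \<le> K * sup_norm X u)}"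

definition weak_topology :: "'a set \<Rightarrow> ('a \<Rightarrow> complex) set \<Rightarrow> ('a \<Rightarrow> complex) topology" where
  "weak_topology X V = initial_topology V euclidean (dual_space X V)"

definition weak_star_topology ::
    "'a set \<Rightarrow> ('a \<Rightarrow> complex) set \<Rightarrow> (('a \<Rightarrow> complex) \<Rightarrow> complex) topology" where
  "weak_star_topology X V =
     initial_topology (dual_space X V) euclidean ((\<lambda>u \<phi>. \<phi> u) ` V)"

definition translate :: "('a, 'm) monoid_scheme \<Rightarrow> ('a \<Rightarrow> complex) \<Rightarrow> 'a \<Rightarrow> ('a \<Rightarrow> complex)" where
  "translate G u s = (\<lambda>t\<in>carrier G. u (s \<otimes>\<^bsub>G\<^esub> t))"

definition WAP :: "('a, 'm) monoid_scheme \<Rightarrow> 'a topology \<Rightarrow> ('a \<Rightarrow> complex) set" where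
  "WAP G \<tau> = {u \<in> bounded_cont \<tau>.
     compactin (weak_topology (carrier G) (bounded_cont \<tau>))
       (weak_topology (carrier G) (bounded_cont \<tau>) closure_of (translate G u ` carrier G))}"

section \<open>The weakly almost periodic compactification\<close>

definition wap_eval ::
    "('a, 'm) monoid_scheme \<Rightarrow> 'a topology \<Rightarrow> 'a \<Rightarrow> (('a \<Rightarrow> complex) \<Rightarrow> complex)" where
  "wap_eval G \<tau> s = (\<lambda>u\<in>WAP G \<tau>. u s)"

definition wap_points ::
    "('a, 'm) monoid_scheme \<Rightarrow> 'a topology \<Rightarrow> (('a \<Rightarrow> complex) \<Rightarrow> complex) set" where
  "wap_points G \<tau> =
     weak_star_topology (carrier G) (WAP G \<tau>) closure_of (wap_eval G \<tau> ` carrier G)"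

definition wap_topology ::
    "('a, 'm) monoid_scheme \<Rightarrow> 'a topology \<Rightarrow> (('a \<Rightarrow> complex) \<Rightarrow> complex) topology" where
  "wap_topology G \<tau> =
     subtopology (weak_star_topology (carrier G) (WAP G \<tau>)) (wap_points G \<tau>)"

text \<open>\<open>u \<cdot> s\<close> for a point \<open>s\<close> of the compactification. The nets in \<open>G\<close> converging to \<open>s\<close> are
  rendered as the proper filters on \<open>carrier G\<close> whose image converges to \<open>s\<close>.\<close>

definition wap_act :: "('a, 'm) monoid_scheme \<Rightarrow> 'a topology \<Rightarrow>
    ('a \<Rightarrow> complex) \<Rightarrow> (('a \<Rightarrow> complex) \<Rightarrow> complex) \<Rightarrow> ('a \<Rightarrow> complex)" where
  "wap_act G \<tau> u s = (\<lambda>t\<in>carrier G. THE c. \<forall>F.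
     F \<noteq> bot \<longrightarrow> F \<le> principal (carrier G) \<longrightarrow> limitin (wap_topology G \<tau>) (wap_eval G \<tau>) s F \<longrightarrow>
     ((\<lambda>x. u (x \<otimes>\<^bsub>G\<^esub> t)) \<longlongrightarrow> c) F)"

text \<open>The product of the compactification is given by \<open>\<langle>u, s s'\<rangle> = \<langle>u \<cdot> s, s'\<rangle>\<close>, which on
  \<open>G\<close> reads \<open>u (s s') = (u \<cdot> s) (s')\<close>.\<close>

definition wap_compactification :: "('a, 'm) monoid_scheme \<Rightarrow> 'a topology \<Rightarrow>
    (('a \<Rightarrow> complex) \<Rightarrow> complex) monoid" where
  "wap_compactification G \<tau> =
     \<lparr>carrier = wap_points G \<tau>,
      monoid.mult = (\<lambda>s s'. \<lambda>u\<in>WAP G \<tau>. s' (wap_act G \<tau> u s)),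
      one = wap_eval G \<tau> \<one>\<^bsub>G\<^esub>\<rparr>"

section \<open>Weakly almost periodic groups\<close>

definition wap_group_topologies :: "('a, 'm) monoid_scheme \<Rightarrow> 'a topology \<Rightarrow> 'a topology set" where
  "wap_group_topologies G \<tau>G = {\<tau>.
     (\<forall>V. openin \<tau> V \<longrightarrow> openin \<tau>G V) \<and> topological_group G \<tau> \<and>
     \<tau> = initial_topology (carrier G) euclidean {u \<in> WAP G \<tau>G. continuous_map \<tau> euclidean u}}"

definition weakly_almost_periodic_group :: "('a, 'm) monoid_scheme \<Rightarrow> 'a topology \<Rightarrow> bool" where
  "weakly_almost_periodic_group G \<tau>G \<longleftrightarrow>
     topological_group G \<tau>G \<and> Hausdorff_space \<tau>G \<and> \<tau>G \<in> wap_group_topologies G \<tau>G"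

section \<open>Completion in the two-sided uniformity\<close>

definition two_sided_uniformity ::
    "('a, 'm) monoid_scheme \<Rightarrow> 'a topology \<Rightarrow> ('a \<times> 'a) filter" where
  "two_sided_uniformity H \<sigma> = (INF V \<in> {V. openin \<sigma> V \<and> \<one>\<^bsub>H\<^esub> \<in> V}.
     principal {(x, y) \<in> carrier H \<times> carrier H.
       inv\<^bsub>H\<^esub> x \<otimes>\<^bsub>H\<^esub> y \<in> V \<and> y \<otimes>\<^bsub>H\<^esub> inv\<^bsub>H\<^esub> x \<in> V})"

definition cauchy_filter_on :: "('a, 'm) monoid_scheme \<Rightarrow> 'a topology \<Rightarrow> 'a filter \<Rightarrow> bool" where
  "cauchy_filter_on H \<sigma> F \<longleftrightarrow>
     F \<noteq> bot \<and> F \<le> principal (carrier H) \<and> F \<times>\<^sub>F F \<le> two_sided_uniformity H \<sigma>"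

text \<open>The completion consists of the Cauchy filters that are minimal with respect to inclusion of
  filters as families of sets. The order of the type of filters is the reverse of this inclusion,
  so these are the maximal ones for \<open>\<le>\<close>.\<close>

definition completion_points :: "('a, 'm) monoid_scheme \<Rightarrow> 'a topology \<Rightarrow> 'a filter set" where
  "completion_points H \<sigma> = {F. cauchy_filter_on H \<sigma> F \<and>
     (\<forall>F'. cauchy_filter_on H \<sigma> F' \<longrightarrow> F \<le> F' \<longrightarrow> F' = F)}"

text \<open>The product of two points is the minimal Cauchy filter contained in the Cauchy filter
  generated by the products of their members.\<close>

definition completion_group :: "('a, 'm) monoid_scheme \<Rightarrow> 'a topology \<Rightarrow> 'a filter monoid" where
  "completion_group H \<sigma> =
     \<lparr>carrier = completion_points H \<sigma>,
      monoid.mult = (\<lambda>F F'. THE M. M \<in> completion_points H \<sigma> \<and>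
        filtermap (\<lambda>(x, y). x \<otimes>\<^bsub>H\<^esub> y) (F \<times>\<^sub>F F') \<le> M),
      one = nhdsin \<sigma> \<one>\<^bsub>H\<^esub>\<rparr>"

text \<open>The topology of the extended uniformity, which is generated by the entourages
  \<open>{(F, F'). E \<in> F \<times> F'}\<close> for entourages \<open>E\<close> of \<open>H\<close>.\<close>

definition completion_topology ::
    "('a, 'm) monoid_scheme \<Rightarrow> 'a topology \<Rightarrow> 'a filter topology" where
  "completion_topology H \<sigma> = topology (\<lambda>V. V \<subseteq> completion_points H \<sigma> \<and>
     (\<forall>F\<in>V. \<exists>E. eventually E (two_sided_uniformity H \<sigma>) \<and>
        (\<forall>F'\<in>completion_points H \<sigma>. eventually E (F \<times>\<^sub>F F') \<longrightarrow> F' \<in> V)))"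

lemma openin_completion_topology:
  "openin (completion_topology H \<sigma>) V \<longleftrightarrow> V \<subseteq> completion_points H \<sigma> \<and>
     (\<forall>F\<in>V. \<exists>E. eventually E (two_sided_uniformity H \<sigma>) \<and>
        (\<forall>F'\<in>completion_points H \<sigma>. eventually E (F \<times>\<^sub>F F') \<longrightarrow> F' \<in> V))"
proof -
  let ?U = "two_sided_uniformity H \<sigma>" and ?C = "completion_points H \<sigma>"
  have "istopology (\<lambda>V. V \<subseteq> ?C \<and> (\<forall>F\<in>V. \<exists>E. eventually E ?U \<and>
        (\<forall>F'\<in>?C. eventually E (F \<times>\<^sub>F F') \<longrightarrow> F' \<in> V)))" (is "istopology ?P")
    unfolding istopology_def
  proof (intro conjI allI impI ballI)
    fix S T F
    assume S: "?P S" and T: "?P T" and F: "F \<in> S \<inter> T"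
    from S F obtain D where D: "eventually D ?U"
      "\<forall>F'\<in>?C. eventually D (F \<times>\<^sub>F F') \<longrightarrow> F' \<in> S" by auto
    from T F obtain E where E: "eventually E ?U"
      "\<forall>F'\<in>?C. eventually E (F \<times>\<^sub>F F') \<longrightarrow> F' \<in> T" by auto
    have "eventually (\<lambda>p. D p \<and> E p) ?U"
      using D(1) E(1) by (rule eventually_conj)
    moreover have "F' \<in> S \<inter> T"
      if "F' \<in> ?C" "eventually (\<lambda>p. D p \<and> E p) (F \<times>\<^sub>F F')" for F'
      using that D(2) E(2) by (simp add: eventually_conj_iff)
    ultimately
    show "\<exists>E. eventually E ?U \<and> (\<forall>F'\<in>?C. eventually E (F \<times>\<^sub>F F') \<longrightarrow> F' \<in> S \<inter> T)"
      by blast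
  next
    fix \<K> F
    assume K: "\<forall>K\<in>\<K>. ?P K" and F: "F \<in> \<Union>\<K>"
    from F obtain K where "K \<in> \<K>" "F \<in> K" by (rule UnionE)
    have "?P K" using K \<open>K \<in> \<K>\<close> by (rule bspec)
    then obtain E where "eventually E ?U" "\<forall>F'\<in>?C. eventually E (F \<times>\<^sub>F F') \<longrightarrow> F' \<in> K"
      using \<open>F \<in> K\<close> by auto
    with \<open>K \<in> \<K>\<close>
    show "\<exists>E. eventually E ?U \<and> (\<forall>F'\<in>?C. eventually E (F \<times>\<^sub>F F') \<longrightarrow> F' \<in> \<Union>\<K>)"
      by blast
  qed auto
  then show ?thesis
    unfolding completion_topology_def by (simp add: topology_inverse')
qed

definition closure_one :: "('a, 'm) monoid_scheme \<Rightarrow> 'a topology \<Rightarrow> 'a set" where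
  "closure_one G \<tau> = \<tau> closure_of {\<one>\<^bsub>G\<^esub>}"

definition hausdorff_quotient_topology ::
    "('a, 'm) monoid_scheme \<Rightarrow> 'a topology \<Rightarrow> 'a set topology" where
  "hausdorff_quotient_topology G \<tau> = quotient_topology \<tau> (\<lambda>x. closure_one G \<tau> #>\<^bsub>G\<^esub> x)"

text \<open>The completion \<open>G\<^sub>\<tau>\<close> of \<open>G / cl\<^sub>\<tau> {e}\<close>, its topology, and the canonical map from \<open>G\<close>,
  which takes the coset of \<open>x\<close> to its neighbourhood filter.\<close>

definition group_completion :: "('a, 'm) monoid_scheme \<Rightarrow> 'a topology \<Rightarrow> 'a set filter monoid" where
  "group_completion G \<tau> =
     completion_group (G Mod closure_one G \<tau>) (hausdorff_quotient_topology G \<tau>)"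

definition group_completion_topology ::
    "('a, 'm) monoid_scheme \<Rightarrow> 'a topology \<Rightarrow> 'a set filter topology" where
  "group_completion_topology G \<tau> =
     completion_topology (G Mod closure_one G \<tau>) (hausdorff_quotient_topology G \<tau>)"

definition completion_map :: "('a, 'm) monoid_scheme \<Rightarrow> 'a topology \<Rightarrow> 'a \<Rightarrow> 'a set filter" where
  "completion_map G \<tau> x = nhdsin (hausdorff_quotient_topology G \<tau>) (closure_one G \<tau> #>\<^bsub>G\<^esub> x)"

section \<open>Central idempotents and topologies\<close>

definition central_idempotents :: "('s, 'm) monoid_scheme \<Rightarrow> 's set" where
  "central_idempotents S = {e \<in> carrier S. e \<otimes>\<^bsub>S\<^esub> e = e \<and>
     (\<forall>s\<in>carrier S. e \<otimes>\<^bsub>S\<^esub> s = s \<otimes>\<^bsub>S\<^esub> e)}"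

definition minimal_idempotent_in :: "('s, 'm) monoid_scheme \<Rightarrow> 's set \<Rightarrow> 's \<Rightarrow> bool" where
  "minimal_idempotent_in S K e \<longleftrightarrow> e \<in> K \<and> e \<otimes>\<^bsub>S\<^esub> e = e \<and>
     (\<forall>f\<in>K. f \<otimes>\<^bsub>S\<^esub> f = f \<longrightarrow> e \<otimes>\<^bsub>S\<^esub> f = f \<longrightarrow> f \<otimes>\<^bsub>S\<^esub> e = f \<longrightarrow> f = e)"

definition idempotent_topology :: "('a, 'm) monoid_scheme \<Rightarrow> 'a topology \<Rightarrow>
    (('a \<Rightarrow> complex) \<Rightarrow> complex) \<Rightarrow> 'a topology" where
  "idempotent_topology G \<tau>G e = initial_topology (carrier G) (wap_topology G \<tau>G)
     {\<lambda>s. e \<otimes>\<^bsub>wap_compactification G \<tau>G\<^esub> wap_eval G \<tau>G s}"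

text \<open>The continuous homomorphism \<open>G\<^sup>W \<rightarrow> G\<^sub>\<tau>\<^sup>W\<close> that extends the canonical map \<open>G \<rightarrow> G\<^sub>\<tau>\<close>. It is
  unique since \<open>G\<close> has dense image in \<open>G\<^sup>W\<close>.\<close>

definition completion_map_ext :: "('a, 'm) monoid_scheme \<Rightarrow> 'a topology \<Rightarrow> 'a topology \<Rightarrow>
    (('a \<Rightarrow> complex) \<Rightarrow> complex) \<Rightarrow> (('a set filter \<Rightarrow> complex) \<Rightarrow> complex)" where
  "completion_map_ext G \<tau>G \<tau> = (THE h.
     h \<in> extensional (wap_points G \<tau>G) \<and>
     h \<in> hom (wap_compactification G \<tau>G)
            (wap_compactification (group_completion G \<tau>) (group_completion_topology G \<tau>)) \<and>
     continuous_map (wap_topology G \<tau>G)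
       (wap_topology (group_completion G \<tau>) (group_completion_topology G \<tau>)) h \<and>
     (\<forall>s\<in>carrier G. h (wap_eval G \<tau>G s) =
        wap_eval (group_completion G \<tau>) (group_completion_topology G \<tau>) (completion_map G \<tau> s)))"

text \<open>\<open>E(\<tau>)\<close>. If a semigroup has a minimal idempotent that commutes with its idempotents, it has no
  other minimal idempotent.\<close>

definition topology_idempotent :: "('a, 'm) monoid_scheme \<Rightarrow> 'a topology \<Rightarrow> 'a topology \<Rightarrow>
    (('a \<Rightarrow> complex) \<Rightarrow> complex)" where
  "topology_idempotent G \<tau>G \<tau> = (THE e. minimal_idempotent_in (wap_compactification G \<tau>G)
     {s \<in> wap_points G \<tau>G. completion_map_ext G \<tau>G \<tau> s =
        \<one>\<^bsub>wap_compactification (group_completion G \<tau>) (group_completion_topology G \<tau>)\<^esub>} e)"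

definition central_topologies :: "('a, 'm) monoid_scheme \<Rightarrow> 'a topology \<Rightarrow> 'a topology set" where
  "central_topologies G \<tau>G =
     idempotent_topology G \<tau>G ` central_idempotents (wap_compactification G \<tau>G)"

definition topology_ideal ::
    "('a, 'm) monoid_scheme \<Rightarrow> 'a topology \<Rightarrow> 'a topology \<Rightarrow> ('a \<Rightarrow> complex) set" where
  "topology_ideal G \<tau>G \<tau> =
     {u \<in> WAP G \<tau>G. wap_act G \<tau>G u (topology_idempotent G \<tau>G \<tau>) = (\<lambda>t\<in>carrier G. 0)}"

end

theory Submission
  imports Defs "HOL-Probability.Discrete_Topology"
begin

text \<open>
  Write \<open>\<tau> = T(e)\<close> for a central idempotent \<open>e\<close> of the compactification. The heart of the matter is the identity
  \<open>E(T(e)) = e\<close> (\<open>topology_idempotent_eq\<close>). Given it, take a filter on \<open>G\<close> whose image converges to \<open>e\<close>. Along this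
  filter \<open>(u \<cdot> e)(x) \<longrightarrow> e (u \<cdot> e) = (e e)(u) = e u = (u \<cdot> e)(1)\<close> for all weakly almost periodic \<open>u\<close>, and the functions
  \<open>u \<cdot> e\<close> generate \<open>\<tau>\<close>. So the filter converges to the identity for \<open>\<tau>\<close> (\<open>filter_to_e\<close>), and it contains every
  \<open>\<tau>\<close>-neighbourhood of the identity. At the same time \<open>u\<^sub>k (x) \<longrightarrow> e (u\<^sub>k) = (u\<^sub>k \<cdot> e)(1) = 0\<close>, since
  \<open>u\<^sub>k \<cdot> E(\<tau>) = 0\<close>. So the points with the required properties form a set of the filter, and this set is not empty.

  For \<open>E(T(e)) = e\<close> let \<open>h\<close> be the homomorphism into the compactification of the completion \<open>G\<^sub>\<tau>\<close>; it is the transpose of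
  the pullback \<open>v \<mapsto> v \<circ> \<eta>\<close>. Every \<open>v \<circ> \<eta>\<close> is \<open>\<tau>\<close>-continuous, so the same filter shows \<open>h e = 1\<close>
  (\<open>e_in_identity_fibre\<close>). Conversely, each \<open>u \<cdot> e\<close> has the form \<open>v \<circ> \<eta>\<close> with \<open>v\<close> weakly almost periodic on the completion
  (\<open>lift_WAP\<close>). Hence \<open>h s = 1\<close> forces \<open>(e s)(u) = s (u \<cdot> e) = (u \<cdot> e)(1) = e u\<close>, that is \<open>e s = e\<close>
  (\<open>identity_fibre_absorbed\<close>). Thus \<open>e\<close> is a zero element of the fibre of \<open>h\<close> over the identity, and so it is the only
  minimal idempotent there.

  Three facts support this. The topology \<open>\<tau>\<close> is a group topology, and the functions \<open>u \<cdot> e\<close> are uniformly continuous for it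
  (\<open>WAP_initial_topology_topological_group\<close>). Both follow from norm continuity of the orbit maps of weakly almost periodic
  functions: by the double limit property a weakly compact orbit has relatively open pieces of small norm diameter
  (\<open>WAP_small_oscillation\<close>), and a group of isometries carries such a piece to the starting point of the orbit.
  Secondly, bounded operators between spaces of bounded functions are weakly continuous even if they are defined on a
  subspace only (\<open>bounded_operator_weakly_continuous\<close>); this rests on the Hahn-Banach theorem. It lets weakly compact
  orbits be transported along \<open>u \<mapsto> u \<cdot> e\<close> and along the extension of functions to the completion. Thirdly, the minimal Cauchy filters
  of a topological group form a semigroup with separately continuous multiplication
  (\<open>completion_semitopological\<close>), so that the theory of weakly almost periodic functions on semitopological semigroups
  applies to the completion as well as to \<open>G\<close>.
\<close>

section \<open>Initial topologies\<close>

lemma topspace_initial_topology [simp]: "topspace (initial_topology X Y \<F>) = X"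
  unfolding initial_topology_def topology_generated_by_topspace by auto

lemma continuous_map_initial_topology_member:
  assumes "f \<in> \<F>" and "f \<in> X \<rightarrow> topspace Y"
  shows "continuous_map (initial_topology X Y \<F>) Y f"
  unfolding continuous_map_alt
proof (intro conjI allI impI)
  fix V assume "openin Y V"
  then show "openin (initial_topology X Y \<F>) (f -` V \<inter> topspace (initial_topology X Y \<F>))"
    unfolding topspace_initial_topology unfolding initial_topology_def
    by (intro topology_generated_by_Basis) (use assms(1) in \<open>auto simp: Int_commute\<close>)
qed (use assms in auto)

lemma continuous_map_into_initial_topology:
  assumes "g \<in> topspace T \<rightarrow> X" and "\<And>f. f \<in> \<F> \<Longrightarrow> continuous_map T Y (\<lambda>x. f (g x))"
  shows "continuous_map T (initial_topology X Y \<F>) g"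
  unfolding initial_topology_def
proof (rule continuous_on_generated_topo)
  fix U assume "U \<in> insert X {X \<inter> f -` V |f V. f \<in> \<F> \<and> openin Y V}"
  then consider "U = X" | f V where "U = X \<inter> f -` V" "f \<in> \<F>" "openin Y V" by blast
  then show "openin T (g -` U \<inter> topspace T)"
  proof cases
    case 1
    then have "g -` U \<inter> topspace T = topspace T" using assms(1) by auto
    then show ?thesis by simp
  next
    case 2
    then have "g -` U \<inter> topspace T = {x \<in> topspace T. f (g x) \<in> V}" using assms(1) by auto
    then show ?thesis using assms(2)[OF 2(2)] 2(3) by (simp add: continuous_map_def)
  qed
qed (use assms(1) in auto)

text \<open>For maps into a metric space, the sets cut out by finitely many maps and one radius form a
  neighbourhood base. Membership in closures is thereby reduced to finite approximation.\<close>

lemma openin_initial_topology_metricD: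
  fixes \<F> :: "('a \<Rightarrow> 'b::metric_space) set"
  assumes "openin (initial_topology X euclidean \<F>) U" and "a \<in> U"
  shows "\<exists>D \<delta>. finite D \<and> D \<subseteq> \<F> \<and> \<delta> > 0 \<and> {x \<in> X. \<forall>f\<in>D. dist (f x) (f a) < \<delta>} \<subseteq> U"
proof -
  have "generate_topology_on (insert X {X \<inter> f -` V |f V. f \<in> \<F> \<and> openin euclidean V}) U"
    using assms(1) unfolding initial_topology_def by (rule openin_topology_generated_by)
  then show ?thesis using assms(2)
  proof (induction arbitrary: a rule: generate_topology_on.induct)
    case Empty
    then show ?case by simp
  next
    case (Int A B)
    have a: "a \<in> A" "a \<in> B" using Int.prems by auto
    obtain D1 d1 D2 d2 where *: "finite D1" "D1 \<subseteq> \<F>" "d1 > 0"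
        "{x \<in> X. \<forall>f\<in>D1. dist (f x) (f a) < d1} \<subseteq> A"
        "finite D2" "D2 \<subseteq> \<F>" "d2 > 0" "{x \<in> X. \<forall>f\<in>D2. dist (f x) (f a) < d2} \<subseteq> B"
      using Int.IH(1)[OF a(1)] Int.IH(2)[OF a(2)] by (elim exE conjE) (rule that)
    show ?case
    proof (intro exI[of _ "D1 \<union> D2"] exI[of _ "min d1 d2"] conjI)
      show "{x \<in> X. \<forall>f\<in>D1 \<union> D2. dist (f x) (f a) < min d1 d2} \<subseteq> A \<inter> B"
      proof (rule subsetI)
        fix x assume "x \<in> {x \<in> X. \<forall>f\<in>D1 \<union> D2. dist (f x) (f a) < min d1 d2}"
        then have "x \<in> {x \<in> X. \<forall>f\<in>D1. dist (f x) (f a) < d1}"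
          "x \<in> {x \<in> X. \<forall>f\<in>D2. dist (f x) (f a) < d2}" by auto
        then show "x \<in> A \<inter> B" using * by blast
      qed
    qed (use * in auto)
  next
    case (UN K)
    then obtain k where "k \<in> K" "a \<in> k" by auto
    then show ?case using UN.IH[of k a] by (meson Union_upper order_trans)
  next
    case (Basis s)
    then consider "s = X" | f V where "s = X \<inter> f -` V" "f \<in> \<F>" "open V" by auto
    then show ?case
    proof cases
      case 1
      then show ?thesis by (intro exI[of _ "{}"] exI[of _ 1]) auto
    next
      case 2
      then obtain d where "d > 0" "\<And>y. dist y (f a) < d \<Longrightarrow> y \<in> V"
        using Basis.prems unfolding open_dist by auto
      then show ?thesis using 2 by (intro exI[of _ "{f}"] exI[of _ d]) auto
    qed
  qed
qed

lemma openin_initial_topology_metric_basic: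
  fixes \<F> :: "('a \<Rightarrow> 'b::metric_space) set"
  assumes "finite D" and "D \<subseteq> \<F>"
  shows "openin (initial_topology X euclidean \<F>) {x \<in> X. \<forall>f\<in>D. dist (f x) (f a) < \<delta>}"
  using assms
proof (induction D)
  case empty
  then show ?case using openin_topspace[of "initial_topology X euclidean \<F>"] by simp
next
  case (insert g D)
  have "continuous_map (initial_topology X euclidean \<F>) euclidean g"
    by (rule continuous_map_initial_topology_member) (use insert in auto)
  then have "openin (initial_topology X euclidean \<F>) {x \<in> X. g x \<in> ball (g a) \<delta>}"
    unfolding continuous_map_def by auto
  moreover have "{x \<in> X. \<forall>f\<in>insert g D. dist (f x) (f a) < \<delta>} =
      {x \<in> X. g x \<in> ball (g a) \<delta>} \<inter> {x \<in> X. \<forall>f\<in>D. dist (f x) (f a) < \<delta>}"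
    by (auto simp: dist_commute)
  ultimately show ?case using insert by (auto intro: openin_Int)
qed

lemma in_closure_of_initial_topology_metric:
  fixes \<F> :: "('a \<Rightarrow> 'b::metric_space) set"
  assumes "S \<subseteq> X"
  shows "a \<in> initial_topology X euclidean \<F> closure_of S \<longleftrightarrow>
    a \<in> X \<and> (\<forall>D \<delta>. finite D \<longrightarrow> D \<subseteq> \<F> \<longrightarrow> \<delta> > 0 \<longrightarrow> (\<exists>x\<in>S. \<forall>f\<in>D. dist (f x) (f a) < \<delta>))"
  (is "?l \<longleftrightarrow> ?r")
proof
  assume l: ?l
  then have "a \<in> X" by (simp add: in_closure_of)
  moreover have "\<exists>x\<in>S. \<forall>f\<in>D. dist (f x) (f a) < \<delta>" if "finite D" "D \<subseteq> \<F>" "\<delta> > 0" for D \<delta>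
  proof -
    let ?U = "{x \<in> X. \<forall>f\<in>D. dist (f x) (f a) < \<delta>}"
    have "openin (initial_topology X euclidean \<F>) ?U"
      by (rule openin_initial_topology_metric_basic[OF that(1,2)])
    moreover have "a \<in> ?U" using \<open>a \<in> X\<close> that(3) by simp
    ultimately have "\<exists>x. x \<in> S \<and> x \<in> ?U" using l unfolding in_closure_of by (elim conjE allE[of _ ?U]) simp
    then show ?thesis by blast
  qed
  ultimately show ?r by blast
next
  assume r: ?r
  show ?l unfolding in_closure_of
  proof (intro conjI allI impI)
    fix T assume "a \<in> T \<and> openin (initial_topology X euclidean \<F>) T"
    then have T: "openin (initial_topology X euclidean \<F>) T" "a \<in> T" by auto
    obtain D \<delta> where D: "finite D" "D \<subseteq> \<F>" "\<delta> > 0" "{x \<in> X. \<forall>f\<in>D. dist (f x) (f a) < \<delta>} \<subseteq> T"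
      using openin_initial_topology_metricD[OF T] by blast
    obtain x where "x \<in> S" "\<forall>f\<in>D. dist (f x) (f a) < \<delta>" using r D(1-3) by blast
    then show "\<exists>y. y \<in> S \<and> y \<in> T"
      using D(4) assms by blast
  qed (use r in simp)
qed

lemma Hausdorff_space_initial_topology:
  assumes "\<And>f. f \<in> \<F> \<Longrightarrow> f \<in> X \<rightarrow> topspace Y" and "Hausdorff_space Y"
    and "\<And>x y. \<lbrakk>x \<in> X; y \<in> X; \<And>f. f \<in> \<F> \<Longrightarrow> f x = f y\<rbrakk> \<Longrightarrow> x = y"
  shows "Hausdorff_space (initial_topology X Y \<F>)"
  unfolding Hausdorff_space_def topspace_initial_topology
proof (intro allI impI)
  fix x y assume xy: "x \<in> X \<and> y \<in> X \<and> x \<noteq> y"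
  then obtain f where f: "f \<in> \<F>" "f x \<noteq> f y" using assms(3) by blast
  have "f x \<in> topspace Y" "f y \<in> topspace Y" using assms(1) f xy by auto
  then obtain U V where UV: "openin Y U" "openin Y V" "f x \<in> U" "f y \<in> V" "disjnt U V"
    using assms(2) f(2) unfolding Hausdorff_space_def by meson
  have "continuous_map (initial_topology X Y \<F>) Y f"
    by (rule continuous_map_initial_topology_member) (use f assms in auto)
  then have "openin (initial_topology X Y \<F>) {z \<in> X. f z \<in> U}"
    "openin (initial_topology X Y \<F>) {z \<in> X. f z \<in> V}"
    using UV unfolding continuous_map_def by auto
  moreover have "disjnt {z \<in> X. f z \<in> U} {z \<in> X. f z \<in> V}"
    using UV by (auto simp: disjnt_iff)
  ultimately show "\<exists>U V. openin (initial_topology X Y \<F>) U \<and> openin (initial_topology X Y \<F>) V \<and>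
      x \<in> U \<and> y \<in> V \<and> disjnt U V"
    using UV xy by (metis (mono_tags, lifting) mem_Collect_eq)
qed

text \<open>The joint range of finitely many bounded complex functions is totally bounded. The proof splits \<open>Y\<close> according to
  the values of one function and treats each part by induction.\<close>

lemma bounded_family_finite_net:
  fixes g :: "'i \<Rightarrow> 'y \<Rightarrow> complex"
  assumes "finite I" and "\<And>i. i \<in> I \<Longrightarrow> bounded (g i ` Y)" and "\<delta> > 0"
  shows "\<exists>Z. finite Z \<and> Z \<subseteq> Y \<and> (\<forall>y\<in>Y. \<exists>z\<in>Z. \<forall>i\<in>I. cmod (g i y - g i z) < \<delta>)"
  using assms(1,2)
proof (induction arbitrary: Y)
  case empty
  show ?case
  proof (cases "Y = {}")
    case False
    then obtain y where "y \<in> Y" by auto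
    then show ?thesis by (intro exI[of _ "{y}"]) auto
  qed auto
next
  case (insert j I)
  have "bounded (g j ` Y)" using insert.prems by blast
  then have cpt: "compact (closure (g j ` Y))" by (rule compact_closure[THEN iffD2])
  have cover: "closure (g j ` Y) \<subseteq> (\<Union>x\<in>closure (g j ` Y). ball x (\<delta>/2))" using \<open>\<delta> > 0\<close> by auto
  obtain K where K: "finite K" "closure (g j ` Y) \<subseteq> (\<Union>x\<in>K. ball x (\<delta>/2))"
    by (rule compactE_image[OF cpt _ cover]) auto
  define P where "P c = {y \<in> Y. g j y \<in> ball c (\<delta>/2)}" for c
  have "\<forall>c\<in>K. \<exists>Z. finite Z \<and> Z \<subseteq> P c \<and> (\<forall>y\<in>P c. \<exists>z\<in>Z. \<forall>i\<in>I. cmod (g i y - g i z) < \<delta>)"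
  proof
    fix c assume "c \<in> K"
    have "bounded (g i ` P c)" if "i \<in> I" for i
      by (rule bounded_subset[of "g i ` Y"]) (use insert.prems that in \<open>auto simp: P_def\<close>)
    then show "\<exists>Z. finite Z \<and> Z \<subseteq> P c \<and> (\<forall>y\<in>P c. \<exists>z\<in>Z. \<forall>i\<in>I. cmod (g i y - g i z) < \<delta>)"
      by (rule insert.IH)
  qed
  then obtain Z where Z: "\<And>c. c \<in> K \<Longrightarrow> finite (Z c)" "\<And>c. c \<in> K \<Longrightarrow> Z c \<subseteq> P c"
    "\<And>c y. c \<in> K \<Longrightarrow> y \<in> P c \<Longrightarrow> \<exists>z\<in>Z c. \<forall>i\<in>I. cmod (g i y - g i z) < \<delta>"
    by metis
  show ?case
  proof (intro exI[of _ "\<Union>c\<in>K. Z c"] conjI ballI)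
    show "finite (\<Union>c\<in>K. Z c)" using K Z by auto
    show "(\<Union>c\<in>K. Z c) \<subseteq> Y" using Z(2) by (auto simp: P_def)
    fix y assume y: "y \<in> Y"
    then have "g j y \<in> closure (g j ` Y)" using closure_subset[of "g j ` Y"] by auto
    then obtain c where c: "c \<in> K" "g j y \<in> ball c (\<delta>/2)" using K by auto
    then have "y \<in> P c" using y by (auto simp: P_def)
    then obtain z where z: "z \<in> Z c" "\<forall>i\<in>I. cmod (g i y - g i z) < \<delta>" using Z(3) c by blast
    then have "g j z \<in> ball c (\<delta>/2)" using Z(2)[OF c(1)] by (auto simp: P_def)
    then have "dist (g j y) (g j z) < \<delta>"
      using c(2) by (metis dist_commute dist_triangle_half_r mem_ball)
    then show "\<exists>z\<in>\<Union>c\<in>K. Z c. \<forall>i\<in>insert j I. cmod (g i y - g i z) < \<delta>"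
      using z c by (auto simp: dist_norm)
  qed
qed

lemma compactin_sequence_cluster_point:
  fixes a :: "nat \<Rightarrow> 'a"
  assumes "compactin X K" and "\<And>i. a i \<in> K"
  shows "\<exists>k\<in>K. \<forall>n. k \<in> X closure_of {a i |i. i \<ge> n}"
proof (rule ccontr)
  assume "\<not> ?thesis"
  then have neg: "\<exists>n. k \<notin> X closure_of {a i |i. i \<ge> n}" if "k \<in> K" for k using that by blast
  have "\<forall>k\<in>K. \<exists>U n. openin X U \<and> k \<in> U \<and> (\<forall>i\<ge>n. a i \<notin> U)"
  proof
    fix k assume k: "k \<in> K"
    obtain n where n: "k \<notin> X closure_of {a i |i. i \<ge> n}" using neg[OF k] by blast
    have "k \<in> topspace X" using k compactin_subset_topspace[OF assms(1)] by blast
    then obtain U where "openin X U" "k \<in> U" "\<not> (\<exists>y. y \<in> {a i |i. i \<ge> n} \<and> y \<in> U)"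
      using n unfolding in_closure_of by blast
    then show "\<exists>U n. openin X U \<and> k \<in> U \<and> (\<forall>i\<ge>n. a i \<notin> U)"
      by (intro exI[of _ U] exI[of _ n]) auto
  qed
  then obtain U n where U: "\<And>k. k \<in> K \<Longrightarrow> openin X (U k)" "\<And>k. k \<in> K \<Longrightarrow> k \<in> U k"
    "\<And>k i. k \<in> K \<Longrightarrow> i \<ge> n k \<Longrightarrow> a i \<notin> U k" by metis
  have "\<exists>\<F>. finite \<F> \<and> \<F> \<subseteq> U ` K \<and> K \<subseteq> \<Union>\<F>"
    using assms(1)[unfolded compactin_def] U(1,2)
    by (elim conjE allE[of _ "U ` K"]) auto
  then obtain J where J: "finite J" "J \<subseteq> K" "K \<subseteq> \<Union>(U ` J)"
    by (metis finite_subset_image)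
  define m where "m = Max (insert 0 (n ` J))"
  have "n k \<le> m" if "k \<in> J" for k
    unfolding m_def using J(1) that by simp
  then have "a m \<notin> \<Union>(U ` J)" using U(3) J(2) by blast
  then show False using J(3) assms(2) by blast
qed

section \<open>Extension of bounded functionals\<close>

definition sublinear :: "('v::real_vector \<Rightarrow> real) \<Rightarrow> bool" where
  "sublinear p \<longleftrightarrow> (\<forall>x y. p (x + y) \<le> p x + p y) \<and> (\<forall>t\<ge>0. \<forall>x. p (t *\<^sub>R x) = t * p x)"

lemma sublinearD:
  assumes "sublinear p"
  shows "p (x + y) \<le> p x + p y" "t \<ge> 0 \<Longrightarrow> p (t *\<^sub>R x) = t * p x"
  using assms by (auto simp: sublinear_def)

lemma sublinear_zero: "sublinear p \<Longrightarrow> p 0 = 0"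
  using sublinearD(2)[of p 0 0] by simp

lemma sublinear_ge_neg: "sublinear p \<Longrightarrow> - p (- x) \<le> p x"
  using sublinearD(1)[of p x "- x"] sublinear_zero[of p] by simp

text \<open>The three infima of the Hahn-Banach argument (along a chain, along a ray, and over a subspace)
  are sublinear for the same reason.\<close>

lemma sublinear_INF:
  fixes F :: "'i \<Rightarrow> 'v::real_vector \<Rightarrow> real"
  assumes ne: "I \<noteq> {}"
    and bdd: "\<And>x. bdd_below ((\<lambda>i. F i x) ` I)"
    and add: "\<And>i j x y. \<lbrakk>i \<in> I; j \<in> I\<rbrakk> \<Longrightarrow> \<exists>k\<in>I. F k (x + y) \<le> F i x + F j y"
    and scale: "\<And>i s x. \<lbrakk>i \<in> I; s > 0\<rbrakk> \<Longrightarrow> \<exists>k\<in>I. F k (s *\<^sub>R x) \<le> s * F i x"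
  shows "sublinear (\<lambda>x. INF i\<in>I. F i x)"
proof -
  define r where "r x = (INF i\<in>I. F i x)" for x
  have low: "r x \<le> F i x" if "i \<in> I" for i x
    unfolding r_def by (rule cINF_lower[OF bdd that])
  have glb: "c \<le> r x" if "\<And>i. i \<in> I \<Longrightarrow> c \<le> F i x" for c x
    unfolding r_def by (rule cINF_greatest[OF ne that])
  have "r (x + y) \<le> r x + r y" for x y
  proof -
    have "r (x + y) - F j y \<le> r x" if j: "j \<in> I" for j
    proof (rule glb)
      fix i assume "i \<in> I"
      from add[OF this j, of x y] obtain k where "k \<in> I" "F k (x + y) \<le> F i x + F j y" by blast
      then show "r (x + y) - F j y \<le> F i x" using low[of k "x + y"] by linarith
    qed
    then have "r (x + y) - r x \<le> r y" by (intro glb) (simp add: algebra_simps)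
    then show ?thesis by simp
  qed
  moreover
  have le: "r (s *\<^sub>R x) \<le> s * r x" if s: "s > 0" for s x
  proof -
    have "r (s *\<^sub>R x) / s \<le> r x"
    proof (rule glb)
      fix i assume "i \<in> I"
      from scale[OF this s, of x] obtain k where "k \<in> I" "F k (s *\<^sub>R x) \<le> s * F i x" by blast
      then show "r (s *\<^sub>R x) / s \<le> F i x" using low[of k "s *\<^sub>R x"] s by (simp add: field_simps)
    qed
    then show ?thesis using s by (simp add: field_simps)
  qed
  have eq: "r (s *\<^sub>R x) = s * r x" if s: "s > 0" for s x
    using le[OF s, of x] le[of "1/s" "s *\<^sub>R x"] s by (simp add: field_simps)
  have "r 0 = 0" using eq[of 2 0] by simp
  then have "r (t *\<^sub>R x) = t * r x" if "t \<ge> 0" for t x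
    using eq[of t x] that by (cases "t = 0") auto
  ultimately show ?thesis unfolding sublinear_def r_def by blast
qed

text \<open>Zorn's lemma applies because the infimum of a chain of sublinear functionals below \<open>p\<close> is finite: each of its
  members is at least \<open>- p (- x)\<close> at \<open>x\<close>.\<close>

lemma minimal_sublinear_below:
  assumes p: "sublinear p"
  shows "\<exists>q. sublinear q \<and> q \<le> p \<and> (\<forall>r. sublinear r \<longrightarrow> r \<le> q \<longrightarrow> r = q)"
proof -
  let ?Q = "{q. sublinear q \<and> q \<le> p}"
  let ?P = "\<lambda>q r. r \<le> (q :: 'a \<Rightarrow> real)"
  have po: "partial_order_on ?Q (relation_of ?P ?Q)"
    by (rule partial_order_on_relation_ofI) auto
  have "\<exists>m\<in>?Q. \<forall>a\<in>?Q. ?P m a \<longrightarrow> a = m"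
  proof (rule predicate_Zorn[OF po])
    fix C assume C: "C \<in> Chains (relation_of ?P ?Q)"
    show "\<exists>u\<in>?Q. \<forall>a\<in>C. ?P a u"
    proof (cases "C = {}")
      case True
      then show ?thesis using p by auto
    next
      case False
      have CQ: "C \<subseteq> ?Q" using C unfolding Chains_def relation_of_def by blast
      have tot: "a \<le> b \<or> b \<le> a" if "a \<in> C" "b \<in> C" for a b
        using C that unfolding Chains_def relation_of_def by blast
      have bdd: "bdd_below ((\<lambda>q. q x) ` C)" for x
      proof (rule bdd_belowI2[of _ "- p (- x)"])
        fix q assume "q \<in> C"
        then have "sublinear q" "q (- x) \<le> p (- x)" using CQ by (auto simp: le_fun_def)
        then show "- p (- x) \<le> q x" using sublinear_ge_neg[of q x] by linarith
      qed
      have "sublinear (\<lambda>x. INF q\<in>C. q x)"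
      proof (rule sublinear_INF[OF False bdd])
        fix q r x y assume qr: "q \<in> C" "r \<in> C"
        then have sub: "sublinear q" "sublinear r" using CQ by auto
        show "\<exists>k\<in>C. k (x + y) \<le> q x + r y"
          using tot[OF qr] sublinearD(1)[OF sub(1), of x y] sublinearD(1)[OF sub(2), of x y] qr
          unfolding le_fun_def by (smt (verit))
      next
        fix q s x assume "q \<in> C" "(s::real) > 0"
        then have "q (s *\<^sub>R x) = s * q x" using CQ by (intro sublinearD) auto
        then show "\<exists>k\<in>C. k (s *\<^sub>R x) \<le> s * q x" using \<open>q \<in> C\<close> by (intro bexI[of _ q]) auto
      qed
      moreover have "(\<lambda>x. INF q\<in>C. q x) \<le> q" if "q \<in> C" for q
        unfolding le_fun_def by (intro allI cINF_lower bdd that)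
      ultimately show ?thesis using False CQ
        by (intro bexI[of _ "\<lambda>x. INF q\<in>C. q x"]) (auto intro: order_trans)
    qed
  qed
  then obtain m where m: "sublinear m" "m \<le> p" "\<And>a. sublinear a \<Longrightarrow> a \<le> p \<Longrightarrow> a \<le> m \<Longrightarrow> a = m" by blast
  then show ?thesis by (intro exI[of _ m]) (auto intro: order_trans)
qed

text \<open>Replacing a sublinear functional \<open>q\<close> by its infimum along the direction \<open>y\<close> gives a sublinear
  functional below \<open>q\<close>; for minimal \<open>q\<close> the two agree, which is additivity in the direction \<open>y\<close>.\<close>

lemma minimal_sublinear_linear:
  assumes q: "sublinear q" and min: "\<And>r. sublinear r \<Longrightarrow> r \<le> q \<Longrightarrow> r = q"
  shows "linear q"
proof -
  have add: "q (x + y) = q x + q y" for x y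
  proof -
    let ?F = "\<lambda>t x. q (x + t *\<^sub>R y) - t * q y"
    have bdd: "bdd_below ((\<lambda>t. ?F t x) ` {0..})" for x
    proof (rule bdd_belowI2[of _ "- q (- x)"])
      fix t :: real assume "t \<in> {0..}"
      then have "t * q y = q (t *\<^sub>R y)" using sublinearD(2)[OF q] by simp
      also have "\<dots> \<le> q (x + t *\<^sub>R y) + q (- x)"
        using sublinearD(1)[OF q, of "x + t *\<^sub>R y" "- x"] by simp
      finally show "- q (- x) \<le> ?F t x" by simp
    qed
    have "sublinear (\<lambda>x. INF t\<in>{0..}. ?F t x)"
    proof (rule sublinear_INF[OF _ bdd])
      fix s t :: real and a b assume "s \<in> {0..}" "t \<in> {0..}"
      then show "\<exists>k\<in>{0..}. ?F k (a + b) \<le> ?F s a + ?F t b"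
        using sublinearD(1)[OF q, of "a + s *\<^sub>R y" "b + t *\<^sub>R y"]
        by (intro bexI[of _ "s + t"]) (auto simp: algebra_simps)
    next
      fix t s :: real and a assume "t \<in> {0..}" "s > 0"
      then show "\<exists>k\<in>{0..}. ?F k (s *\<^sub>R a) \<le> s * ?F t a"
        using sublinearD(2)[OF q, of s "a + t *\<^sub>R y"]
        by (intro bexI[of _ "s * t"]) (simp_all add: scaleR_add_right right_diff_distrib)
    qed auto
    moreover have "(\<lambda>x. INF t\<in>{0..}. ?F t x) \<le> q"
    proof (unfold le_fun_def, rule allI)
      fix x show "(INF t\<in>{0..}. ?F t x) \<le> q x"
        using cINF_lower[OF bdd, of 0 x] by simp
    qed
    ultimately have "(\<lambda>x. INF t\<in>{0..}. ?F t x) = q" by (rule min)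
    then have "(INF t\<in>{0..}. ?F t x) = q x" by (rule fun_cong)
    moreover have "(INF t\<in>{0..}. ?F t x) \<le> ?F 1 x" by (rule cINF_lower[OF bdd]) simp
    ultimately show ?thesis using sublinearD(1)[OF q, of x y] by simp
  qed
  have neg: "q (- x) = - q x" for x using add[of x "- x"] sublinear_zero[OF q] by simp
  show ?thesis
  proof (rule linearI)
    fix c x show "q (c *\<^sub>R x) = c *\<^sub>R q x"
    proof (cases "c \<ge> 0")
      case True
      then show ?thesis using sublinearD(2)[OF q] by simp
    next
      case False
      then have "q (- ((- c) *\<^sub>R x)) = - ((- c) * q x)" using neg sublinearD(2)[OF q, of "- c" x] by simp
      then show ?thesis by simp
    qed
  qed (rule add)
qed

text \<open>The functional \<open>p x = inf {\<psi> a + C \<parallel>x - a\<parallel> | a \<in> A}\<close> is sublinear and lies below \<open>\<psi>\<close> on \<open>A\<close> and below the multiple \<open>C\<close> of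
  the norm. A linear functional below \<open>p\<close> agrees with \<open>\<psi>\<close> on \<open>A\<close>, as one sees from \<open>a\<close> and \<open>- a\<close>.\<close>

lemma real_functional_extension:
  fixes A :: "'v::real_normed_vector set"
  assumes A: "subspace A" and C: "C \<ge> 0"
    and add: "\<And>a b. a \<in> A \<Longrightarrow> b \<in> A \<Longrightarrow> \<psi> (a + b) = \<psi> a + \<psi> b"
    and scale: "\<And>c a. a \<in> A \<Longrightarrow> \<psi> (c *\<^sub>R a) = c * \<psi> a"
    and bound: "\<And>a. a \<in> A \<Longrightarrow> \<bar>\<psi> a\<bar> \<le> C * norm a"
  shows "\<exists>q. linear q \<and> (\<forall>a\<in>A. q a = \<psi> a) \<and> (\<forall>x. \<bar>q x\<bar> \<le> C * norm x)"
proof -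
  let ?F = "\<lambda>a x. \<psi> a + C * norm (x - a)"
  have bdd: "bdd_below ((\<lambda>a. ?F a x) ` A)" for x
  proof (rule bdd_belowI2[of _ "- C * norm x"])
    fix a assume "a \<in> A"
    then have "- (C * norm a) \<le> \<psi> a" using bound by fastforce
    moreover have "C * norm a \<le> C * (norm x + norm (x - a))"
      using C by (intro mult_left_mono) (metis add.commute diff_add_cancel norm_minus_commute norm_triangle_ineq)
    ultimately show "- C * norm x \<le> ?F a x" by (simp add: algebra_simps)
  qed
  have "sublinear (\<lambda>x. INF a\<in>A. ?F a x)"
  proof (rule sublinear_INF[OF _ bdd])
    show "A \<noteq> {}" using subspace_0[OF A] by auto
  next
    fix a b x y assume ab: "a \<in> A" "b \<in> A"
    have "norm (x + y - (a + b)) \<le> norm (x - a) + norm (y - b)" by (metis add_diff_add norm_triangle_ineq)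
    then have "C * norm (x + y - (a + b)) \<le> C * norm (x - a) + C * norm (y - b)"
      using mult_left_mono[OF _ C] by (metis distrib_left)
    then show "\<exists>k\<in>A. ?F k (x + y) \<le> ?F a x + ?F b y"
      using add[OF ab] subspace_add[OF A ab] by (intro bexI[of _ "a + b"]) auto
  next
    fix a and s :: real and x assume a: "a \<in> A" "s > 0"
    have "norm (s *\<^sub>R x - s *\<^sub>R a) = s * norm (x - a)"
      using a(2) by (metis norm_scaleR abs_of_pos scaleR_diff_right)
    then show "\<exists>k\<in>A. ?F k (s *\<^sub>R x) \<le> s * ?F a x"
      using scale[OF a(1)] subspace_scale[OF A a(1)]
      by (intro bexI[of _ "s *\<^sub>R a"]) (auto simp: algebra_simps)
  qed
  from minimal_sublinear_below[OF this] obtain q where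
    q: "sublinear q" "\<And>x. q x \<le> (INF a\<in>A. ?F a x)" "\<And>r. sublinear r \<Longrightarrow> r \<le> q \<Longrightarrow> r = q"
    unfolding le_fun_def by metis
  have lin: "linear q" using minimal_sublinear_linear q(1,3) by blast
  have le: "q x \<le> ?F a x" if "a \<in> A" for a x
    using q(2)[of x] cINF_lower[OF bdd that, of x] by linarith
  have 0: "\<psi> 0 = 0" using scale[of 0 0] subspace_0[OF A] by simp
  have "q x \<le> C * norm x" for x using le[OF subspace_0[OF A], of x] 0 by simp
  moreover have "- q x \<le> C * norm x" for x
    using calculation[of "- x"] linear_neg[OF lin, of x] by simp
  ultimately have "\<bar>q x\<bar> \<le> C * norm x" for x by (simp add: abs_le_iff)
  moreover have "q a = \<psi> a" if "a \<in> A" for a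
  proof -
    have "q a \<le> \<psi> a" using le[OF that, of a] by simp
    moreover have "- a \<in> A" "\<psi> (- a) = - \<psi> a"
      using subspace_neg[OF A that] scale[OF that, of "- 1"] by auto
    then have "- q a \<le> - \<psi> a" using le[of "- a" "- a"] linear_neg[OF lin, of a] by simp
    ultimately show ?thesis by simp
  qed
  ultimately show ?thesis using lin by blast
qed

definition function_space :: "'a set \<Rightarrow> ('a \<Rightarrow> complex) set \<Rightarrow> bool" where
  "function_space X A \<longleftrightarrow> X \<noteq> {} \<and> A \<noteq> {} \<and> A \<subseteq> extensional X \<and> (\<forall>u\<in>A. bounded (u ` X)) \<and>
     (\<forall>u\<in>A. \<forall>v\<in>A. (\<lambda>x\<in>X. u x + v x) \<in> A) \<and> (\<forall>c. \<forall>u\<in>A. (\<lambda>x\<in>X. c * u x) \<in> A)"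

lemma function_spaceD:
  assumes "function_space X A"
  shows "X \<noteq> {}" "A \<noteq> {}" "u \<in> A \<Longrightarrow> u \<in> extensional X" "u \<in> A \<Longrightarrow> bounded (u ` X)"
    "u \<in> A \<Longrightarrow> v \<in> A \<Longrightarrow> (\<lambda>x\<in>X. u x + v x) \<in> A" "u \<in> A \<Longrightarrow> (\<lambda>x\<in>X. c * u x) \<in> A"
  using assms unfolding function_space_def by blast+

lemma cmod_le_sup_norm:
  assumes "bounded (u ` X)" and "x \<in> X"
  shows "cmod (u x) \<le> sup_norm X u"
  unfolding sup_norm_def
  by (rule cSUP_upper[OF assms(2)]) (use assms(1) in \<open>auto simp: bounded_iff bdd_above_def\<close>)

lemma sup_norm_le:
  assumes "X \<noteq> {}" and "\<And>x. x \<in> X \<Longrightarrow> cmod (u x) \<le> c"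
  shows "sup_norm X u \<le> c"
  unfolding sup_norm_def by (rule cSUP_least) (use assms in auto)

lemma sup_norm_nonneg: "X \<noteq> {} \<Longrightarrow> bounded (u ` X) \<Longrightarrow> 0 \<le> sup_norm X u"
  using cmod_le_sup_norm[of u X] by (metis all_not_in_conv norm_ge_zero order_trans)

text \<open>Bounded functions on \<open>X\<close>, extended by zero, as elements of a normed space.\<close>

definition bcont_of :: "'a set \<Rightarrow> ('a \<Rightarrow> complex) \<Rightarrow> ('a discrete \<Rightarrow>\<^sub>C complex)" where
  "bcont_of X u = Bcontfun (\<lambda>d. if of_discrete d \<in> X then u (of_discrete d) else 0)"

lemma continuous_on_discrete: "continuous_on S (f :: 'a discrete \<Rightarrow> 'b::topological_space)"
  by (rule continuous_on_subset[of UNIV])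
     (auto simp: continuous_on_open_vimage open_discrete)

lemma apply_bcont_of:
  assumes "bounded (u ` X)"
  shows "apply_bcontfun (bcont_of X u) d = (if of_discrete d \<in> X then u (of_discrete d) else 0)"
proof -
  have "range (\<lambda>d::'a discrete. if of_discrete d \<in> X then u (of_discrete d) else 0) \<subseteq> insert 0 (u ` X)" by auto
  then have "bounded (range (\<lambda>d::'a discrete. if of_discrete d \<in> X then u (of_discrete d) else 0))"
    using assms bounded_subset bounded_insert by metis
  then have "(\<lambda>d::'a discrete. if of_discrete d \<in> X then u (of_discrete d) else 0) \<in> bcontfun"
    unfolding bcontfun_def using continuous_on_discrete by blast
  then show ?thesis unfolding bcont_of_def by (simp add: Bcontfun_inverse)
qed

lemma norm_bcont_of_le:
  assumes "bounded (u ` X)" and "X \<noteq> {}"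
  shows "norm (bcont_of X u) \<le> sup_norm X u"
  by (rule norm_bound)
     (use cmod_le_sup_norm[OF assms(1)] sup_norm_nonneg[OF assms(2,1)] in \<open>auto simp: apply_bcont_of[OF assms(1)]\<close>)

lemma sup_norm_le_norm_bcont_of:
  assumes "bounded (u ` X)" and "X \<noteq> {}"
  shows "sup_norm X u \<le> norm (bcont_of X u)"
proof (rule sup_norm_le[OF assms(2)])
  fix x assume "x \<in> X"
  then have "u x = apply_bcontfun (bcont_of X u) (discrete x)"
    by (simp add: apply_bcont_of[OF assms(1)] discrete_inverse)
  then show "cmod (u x) \<le> norm (bcont_of X u)" by (simp add: norm_bounded)
qed

lemma bcont_of_add:
  assumes "bounded (u ` X)" and "bounded (v ` X)"
  shows "bcont_of X (\<lambda>x\<in>X. u x + v x) = bcont_of X u + bcont_of X v"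
proof -
  have "bounded ((\<lambda>x\<in>X. u x + v x) ` X)"
    using bounded_plus_comp[OF assms] by (simp cong: image_cong)
  then show ?thesis by (intro bcontfun_eqI) (auto simp: apply_bcont_of assms)
qed

lemma bounded_scale_restrict:
  assumes "bounded (u ` X)"
  shows "bounded ((\<lambda>x\<in>X. c * u x :: complex) ` X)"
proof -
  have "bounded ((\<lambda>z. c * z) ` u ` X)"
    by (rule bounded_linear_image[OF assms bounded_linear_mult_right])
  then show ?thesis by (simp add: image_image cong: image_cong)
qed

lemma bcont_of_scaleR:
  assumes "bounded (u ` X)"
  shows "bcont_of X (\<lambda>x\<in>X. complex_of_real c * u x) = c *\<^sub>R bcont_of X u"
proof (rule bcontfun_eqI)
  fix d :: "'a discrete"
  show "apply_bcontfun (bcont_of X (\<lambda>x\<in>X. complex_of_real c * u x)) d =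
      apply_bcontfun (c *\<^sub>R bcont_of X u) d"
    unfolding apply_bcont_of[OF bounded_scale_restrict[OF assms]]
    by (simp add: apply_bcont_of[OF assms] scaleR_conv_of_real)
qed

lemma bcont_of_inject:
  assumes "bounded (u ` X)" "bounded (v ` X)" "u \<in> extensional X" "v \<in> extensional X"
    and "bcont_of X u = bcont_of X v"
  shows "u = v"
proof (rule extensionalityI[OF assms(3,4)])
  fix x assume "x \<in> X"
  then show "u x = v x"
    using arg_cong[OF assms(5), of "\<lambda>f. apply_bcontfun f (discrete x)"]
    by (simp add: apply_bcont_of assms(1,2) discrete_inverse)
qed

text \<open>The Hahn-Banach theorem for spaces of bounded complex functions. With \<open>q\<close> an extension of the real part,
  \<open>\<phi> u = q u - \<i> q (\<i> u)\<close> restores complex linearity; the bound grows by a factor of at most 2.\<close>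

lemma functional_extension:
  assumes V: "function_space X V" and A: "function_space X A" and "A \<subseteq> V"
    and add: "\<And>u v. \<lbrakk>u \<in> A; v \<in> A\<rbrakk> \<Longrightarrow> \<psi> (\<lambda>x\<in>X. u x + v x) = \<psi> u + \<psi> v"
    and scale: "\<And>c u. u \<in> A \<Longrightarrow> \<psi> (\<lambda>x\<in>X. c * u x) = c * \<psi> u"
    and bound: "\<And>u. u \<in> A \<Longrightarrow> cmod (\<psi> u) \<le> C * sup_norm X u"
  shows "\<exists>\<phi>\<in>dual_space X V. \<forall>u\<in>A. \<phi> u = \<psi> u"
proof -
  note Ab = function_spaceD[OF A] and Vb = function_spaceD[OF V]
  let ?J = "bcont_of X"
  define \<psi>' where "\<psi>' f = Re (\<psi> (inv_into A ?J f))" for f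
  have inj: "inj_on ?J A" by (rule inj_onI) (rule bcont_of_inject[OF Ab(4) Ab(4) Ab(3) Ab(3)])
  have \<psi>': "\<psi>' (?J u) = Re (\<psi> u)" if "u \<in> A" for u
    unfolding \<psi>'_def by (simp add: inv_into_f_f[OF inj that])
  have sub: "subspace (?J ` A)"
    unfolding subspace_def
  proof (intro conjI ballI allI)
    obtain u where u: "u \<in> A" using Ab(2) by blast
    have "0 = ?J (\<lambda>x\<in>X. complex_of_real 0 * u x)"
      unfolding bcont_of_scaleR[OF Ab(4)[OF u]] by (simp only: scaleR_zero_left)
    then show "0 \<in> ?J ` A" using Ab(6)[OF u] by (rule image_eqI)
  next
    fix f g assume "f \<in> ?J ` A" "g \<in> ?J ` A"
    then obtain u v where uv: "u \<in> A" "v \<in> A" "f = ?J u" "g = ?J v" by blast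
    have "f + g = ?J (\<lambda>x\<in>X. u x + v x)" unfolding uv by (rule bcont_of_add[symmetric]) (intro Ab(4) uv)+
    then show "f + g \<in> ?J ` A" using Ab(5)[OF uv(1,2)] by (rule image_eqI)
  next
    fix c f assume "f \<in> ?J ` A"
    then obtain u where u: "u \<in> A" "f = ?J u" by blast
    have "c *\<^sub>R f = ?J (\<lambda>x\<in>X. complex_of_real c * u x)" unfolding u by (rule bcont_of_scaleR[symmetric]) (intro Ab(4) u)
    then show "c *\<^sub>R f \<in> ?J ` A" using Ab(6)[OF u(1)] by (rule image_eqI)
  qed
  have "\<exists>q. linear q \<and> (\<forall>a\<in>?J ` A. q a = \<psi>' a) \<and> (\<forall>x. \<bar>q x\<bar> \<le> max C 0 * norm x)"
  proof (rule real_functional_extension[OF sub])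
    fix a b assume "a \<in> ?J ` A" "b \<in> ?J ` A"
    then obtain u v where uv: "u \<in> A" "v \<in> A" "a = ?J u" "b = ?J v" by blast
    then have "a + b = ?J (\<lambda>x\<in>X. u x + v x)" using bcont_of_add[OF Ab(4)[OF uv(1)] Ab(4)[OF uv(2)]] by simp
    then show "\<psi>' (a + b) = \<psi>' a + \<psi>' b" using uv \<psi>' Ab(5) add by simp
  next
    fix c a assume "a \<in> ?J ` A"
    then obtain u where u: "u \<in> A" "a = ?J u" by blast
    then have "c *\<^sub>R a = ?J (\<lambda>x\<in>X. complex_of_real c * u x)" using bcont_of_scaleR[OF Ab(4)[OF u(1)]] by simp
    then show "\<psi>' (c *\<^sub>R a) = c * \<psi>' a" using u \<psi>' Ab(6) scale by simp
  next
    fix a assume "a \<in> ?J ` A"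
    then obtain u where u: "u \<in> A" "a = ?J u" by blast
    have "\<bar>\<psi>' a\<bar> \<le> cmod (\<psi> u)" using u \<psi>' abs_Re_le_cmod by simp
    also have "\<dots> \<le> C * sup_norm X u" by (rule bound[OF u(1)])
    also have "\<dots> \<le> max C 0 * sup_norm X u"
      using sup_norm_nonneg[OF Ab(1) Ab(4)[OF u(1)]] by (intro mult_right_mono) auto
    also have "\<dots> \<le> max C 0 * norm a"
      unfolding u(2) by (intro mult_left_mono sup_norm_le_norm_bcont_of Ab(4)[OF u(1)] Ab(1)) auto
    finally show "\<bar>\<psi>' a\<bar> \<le> max C 0 * norm a" .
  qed auto
  then obtain q where q: "linear q" "\<And>u. u \<in> A \<Longrightarrow> q (?J u) = Re (\<psi> u)"
    "\<And>x. \<bar>q x\<bar> \<le> max C 0 * norm x" using \<psi>' by (metis imageI)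
  define Q where "Q u = q (?J u)" for u
  have Qadd: "Q (\<lambda>x\<in>X. u x + v x) = Q u + Q v" if "u \<in> V" "v \<in> V" for u v
    unfolding Q_def bcont_of_add[OF Vb(4)[OF that(1)] Vb(4)[OF that(2)]] by (rule linear_add[OF q(1)])
  have Qscale: "Q (\<lambda>x\<in>X. complex_of_real c * u x) = c * Q u" if "u \<in> V" for u c
    unfolding Q_def bcont_of_scaleR[OF Vb(4)[OF that]] using linear_scale[OF q(1)] by simp
  have Qbound: "\<bar>Q u\<bar> \<le> max C 0 * sup_norm X u" if "u \<in> V" for u
    unfolding Q_def using q(3)[of "?J u"] norm_bcont_of_le[OF Vb(4)[OF that] Vb(1)]
    by (meson max.cobounded2 mult_left_mono order_trans)
  define I where "I u = (\<lambda>x\<in>X. \<i> * u x)" for u :: "'a \<Rightarrow> complex"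
  have IV: "I u \<in> V" if "u \<in> V" for u unfolding I_def using Vb(6)[OF that] .
  have Iadd: "I (\<lambda>x\<in>X. u x + v x) = (\<lambda>x\<in>X. I u x + I v x)" for u v
    unfolding I_def by (auto simp: algebra_simps)
  define \<phi> where "\<phi> = (\<lambda>u\<in>V. Complex (Q u) (- Q (I u)))"
  have decomp: "Q (\<lambda>x\<in>X. c * u x) = Re c * Q u + Im c * Q (I u)" if "u \<in> V" for u c
  proof -
    have "(\<lambda>x\<in>X. c * u x) = (\<lambda>x\<in>X. (\<lambda>x\<in>X. complex_of_real (Re c) * u x) x + (\<lambda>x\<in>X. complex_of_real (Im c) * I u x) x)"
      unfolding I_def by (rule restrict_ext) (simp add: complex_eq_iff)
    then show ?thesis
      using Qadd[OF Vb(6)[OF that, of "complex_of_real (Re c)"] Vb(6)[OF IV[OF that], of "complex_of_real (Im c)"]]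
        Qscale[OF that, of "Re c"] Qscale[OF IV[OF that], of "Im c"] by metis
  qed
  have decompI: "Q (I (\<lambda>x\<in>X. c * u x)) = Re c * Q (I u) - Im c * Q u" if "u \<in> V" for u c
  proof -
    have "I (\<lambda>x\<in>X. c * u x) = (\<lambda>x\<in>X. (\<i> * c) * u x)" unfolding I_def by auto
    then show ?thesis using decomp[OF that, of "\<i> * c"] by simp
  qed
  have "\<phi> \<in> dual_space X V"
    unfolding dual_space_def
  proof (intro CollectI conjI ballI allI)
    show "\<phi> \<in> extensional V" unfolding \<phi>_def by simp
  next
    fix u v assume uv: "u \<in> V" "v \<in> V"
    then show "\<phi> (\<lambda>x\<in>X. u x + v x) = \<phi> u + \<phi> v"
      unfolding \<phi>_def using Vb(5)[OF uv] Qadd[OF uv] Qadd[OF IV[OF uv(1)] IV[OF uv(2)]]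
      by (simp add: Iadd complex_eq_iff)
  next
    fix c u assume u: "u \<in> V"
    then show "\<phi> (\<lambda>x\<in>X. c * u x) = c * \<phi> u"
      unfolding \<phi>_def using Vb(6)[OF u, of c] decomp[OF u] decompI[OF u]
      by (simp add: complex_eq_iff)
  next
    have "cmod (\<phi> u) \<le> (2 * max C 0) * sup_norm X u" if u: "u \<in> V" for u
    proof -
      have "sup_norm X (I u) \<le> sup_norm X u"
        using cmod_le_sup_norm[OF Vb(4)[OF u]] by (intro sup_norm_le[OF Vb(1)]) (auto simp: I_def norm_mult)
      then have "max C 0 * sup_norm X (I u) \<le> max C 0 * sup_norm X u"
        by (intro mult_left_mono) auto
      moreover have "cmod (\<phi> u) \<le> \<bar>Q u\<bar> + \<bar>Q (I u)\<bar>"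
        unfolding \<phi>_def using cmod_le[of "Complex (Q u) (- Q (I u))"] u by simp
      ultimately show ?thesis using Qbound[OF u] Qbound[OF IV[OF u]] by linarith
    qed
    then show "\<exists>K. \<forall>u\<in>V. cmod (\<phi> u) \<le> K * sup_norm X u" by blast
  qed
  moreover have "\<phi> u = \<psi> u" if u: "u \<in> A" for u
  proof -
    have "Q (I u) = Re (\<psi> (I u))" unfolding Q_def I_def by (rule q(2)[OF Ab(6)[OF u]])
    also have "\<dots> = - Im (\<psi> u)" unfolding I_def using scale[OF u] by simp
    finally show ?thesis using u \<open>A \<subseteq> V\<close> q(2)[OF u]
      unfolding \<phi>_def Q_def by (auto simp: complex_eq_iff subset_eq)
  qed
  ultimately show ?thesis by blast
qed

section \<open>Weak topologies on spaces of bounded functions\<close>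

lemma dual_spaceD:
  assumes "\<phi> \<in> dual_space X V"
  shows "\<phi> \<in> extensional V"
    "\<lbrakk>u \<in> V; v \<in> V\<rbrakk> \<Longrightarrow> \<phi> (\<lambda>x\<in>X. u x + v x) = \<phi> u + \<phi> v"
    "u \<in> V \<Longrightarrow> \<phi> (\<lambda>x\<in>X. c * u x) = c * \<phi> u"
  using assms unfolding dual_space_def by auto

lemma dual_space_bound:
  assumes "\<phi> \<in> dual_space X V" and "function_space X V"
  shows "\<exists>K\<ge>0. \<forall>u\<in>V. cmod (\<phi> u) \<le> K * sup_norm X u"
proof -
  obtain K where K: "\<forall>u\<in>V. cmod (\<phi> u) \<le> K * sup_norm X u"
    using assms(1) unfolding dual_space_def by blast
  have "cmod (\<phi> u) \<le> max K 0 * sup_norm X u" if u: "u \<in> V" for u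
  proof -
    have "K * sup_norm X u \<le> max K 0 * sup_norm X u"
      using sup_norm_nonneg[of X u] function_spaceD(1,4)[OF assms(2)] u by (intro mult_right_mono) auto
    then show ?thesis using K u by force
  qed
  then show ?thesis by (intro exI[of _ "max K 0"]) auto
qed

lemma evaluation_in_dual_space:
  assumes V: "function_space X V" and x: "x \<in> X"
  shows "(\<lambda>u\<in>V. u x) \<in> dual_space X V"
  unfolding dual_space_def
proof (intro CollectI conjI ballI allI)
  show "\<exists>K. \<forall>u\<in>V. cmod ((\<lambda>u\<in>V. u x) u) \<le> K * sup_norm X u"
    using cmod_le_sup_norm[OF function_spaceD(4)[OF V] x] by (intro exI[of _ 1]) auto
qed (use function_spaceD(5,6)[OF V] x in auto)

lemma function_space_bounded_cont:
  assumes "topspace T \<noteq> {}"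
  shows "function_space (topspace T) (bounded_cont T)"
  unfolding function_space_def
proof (intro conjI ballI allI)
  have "(\<lambda>x\<in>topspace T. 0) \<in> bounded_cont T"
    unfolding bounded_cont_def by (auto intro: continuous_map_eq[of _ _ "\<lambda>_. 0"] bounded_subset[of "{0}"])
  then show "bounded_cont T \<noteq> {}" by blast
next
  fix u v assume uv: "u \<in> bounded_cont T" "v \<in> bounded_cont T"
  have "continuous_map T euclidean (\<lambda>x. u x + v x)"
    using uv unfolding bounded_cont_def by (auto intro: continuous_map_add)
  then have "continuous_map T euclidean (\<lambda>x\<in>topspace T. u x + v x)" by (rule continuous_map_eq) simp
  moreover have "bounded ((\<lambda>x\<in>topspace T. u x + v x) ` topspace T)"
    using bounded_plus_comp[of u "topspace T" v] uv by (simp add: bounded_cont_def cong: image_cong)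
  ultimately show "(\<lambda>x\<in>topspace T. u x + v x) \<in> bounded_cont T" by (simp add: bounded_cont_def)
next
  fix c u assume u: "u \<in> bounded_cont T"
  have "continuous_map T euclidean (\<lambda>x. c * u x)"
    using u unfolding bounded_cont_def
    by (auto intro!: continuous_map_compose[of T euclidean u euclidean "\<lambda>z. c * z", unfolded o_def] continuous_intros)
  then have "continuous_map T euclidean (\<lambda>x\<in>topspace T. c * u x)" by (rule continuous_map_eq) simp
  then show "(\<lambda>x\<in>topspace T. c * u x) \<in> bounded_cont T"
    using bounded_scale_restrict[of u "topspace T" c] u by (simp add: bounded_cont_def)
qed (use assms in \<open>auto simp: bounded_cont_def\<close>)

lemma topspace_weak_topology [simp]: "topspace (weak_topology X V) = V"
  by (simp add: weak_topology_def)

lemma continuous_map_weak_functional: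
  "\<phi> \<in> dual_space X V \<Longrightarrow> continuous_map (weak_topology X V) euclidean \<phi>"
  unfolding weak_topology_def by (rule continuous_map_initial_topology_member) auto

lemma continuous_map_weak_evaluation:
  assumes "function_space X V" and "x \<in> X"
  shows "continuous_map (weak_topology X V) euclidean (\<lambda>u. u x)"
  by (rule continuous_map_eq[OF continuous_map_weak_functional[OF evaluation_in_dual_space[OF assms]]]) simp

lemma Hausdorff_weak_topology:
  assumes V: "function_space X V"
  shows "Hausdorff_space (weak_topology X V)"
  unfolding weak_topology_def
proof (rule Hausdorff_space_initial_topology)
  fix u v assume uv: "u \<in> V" "v \<in> V" "\<And>\<phi>. \<phi> \<in> dual_space X V \<Longrightarrow> \<phi> u = \<phi> v"
  show "u = v"
  proof (rule extensionalityI)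
    fix x assume "x \<in> X"
    then show "u x = v x" using uv(3)[OF evaluation_in_dual_space[OF V]] uv(1,2) by simp
  qed (use uv function_spaceD(3)[OF V] in blast)+
qed auto

text \<open>A weakly compact set is compact for the coarser topology of pointwise convergence, which is Hausdorff.\<close>

lemma weakly_compact_pointwise_closed:
  assumes V: "function_space X V" and K: "compactin (weak_topology X V) K"
    and f: "f \<in> extensional X"
    and approx: "\<And>D \<delta>. \<lbrakk>finite D; D \<subseteq> X; \<delta> > 0\<rbrakk> \<Longrightarrow> \<exists>k\<in>K. \<forall>x\<in>D. cmod (k x - f x) < \<delta>"
  shows "f \<in> K"
proof -
  let ?P = "initial_topology (extensional X) euclidean ((\<lambda>x u. u x) ` X) :: ('a \<Rightarrow> complex) topology"
  have KV: "K \<subseteq> V" using compactin_subset_topspace[OF K] by simp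
  have VX: "V \<subseteq> extensional X" using function_spaceD(3)[OF V] by blast
  have haus: "Hausdorff_space ?P"
  proof (rule Hausdorff_space_initial_topology)
    fix u v :: "'a \<Rightarrow> complex"
    assume "u \<in> extensional X" "v \<in> extensional X" "\<And>g. g \<in> (\<lambda>x u. u x) ` X \<Longrightarrow> g u = g v"
    then show "u = v" by (intro extensionalityI) auto
  qed auto
  have cont: "continuous_map (weak_topology X V) ?P (\<lambda>u. u)"
    by (rule continuous_map_into_initial_topology)
       (use VX continuous_map_weak_evaluation[OF V] in auto)
  have "compactin ?P K" using image_compactin[OF K cont] by simp
  then have "closedin ?P K" by (rule compactin_imp_closedin[OF haus])
  then have cl: "?P closure_of K = K" by (simp add: closure_of_closedin)
  have "f \<in> ?P closure_of K"
    unfolding in_closure_of_initial_topology_metric[OF order_trans[OF KV VX]]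
  proof (intro conjI allI impI f)
    fix D :: "(('a \<Rightarrow> complex) \<Rightarrow> complex) set" and \<delta> :: real
    assume D: "finite D" "D \<subseteq> (\<lambda>x u. u x) ` X" "\<delta> > 0"
    then obtain E where E: "finite E" "E \<subseteq> X" "D = (\<lambda>x u. u x) ` E" using finite_subset_image by metis
    show "\<exists>x\<in>K. \<forall>g\<in>D. dist (g x) (g f) < \<delta>"
      using approx[OF E(1,2) D(3)] unfolding E(3) dist_norm by auto
  qed
  then show ?thesis using cl by simp
qed

definition bounded_operator :: "'a set \<Rightarrow> ('a \<Rightarrow> complex) set \<Rightarrow> 'b set \<Rightarrow> ('b \<Rightarrow> complex) set \<Rightarrow>
    (('a \<Rightarrow> complex) \<Rightarrow> ('b \<Rightarrow> complex)) \<Rightarrow> bool" where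
  "bounded_operator X A Y W L \<longleftrightarrow> L \<in> A \<rightarrow> W \<and>
     (\<forall>u\<in>A. \<forall>v\<in>A. L (\<lambda>x\<in>X. u x + v x) = (\<lambda>y\<in>Y. L u y + L v y)) \<and>
     (\<forall>c. \<forall>u\<in>A. L (\<lambda>x\<in>X. c * u x) = (\<lambda>y\<in>Y. c * L u y)) \<and>
     (\<exists>C\<ge>0. \<forall>u\<in>A. sup_norm Y (L u) \<le> C * sup_norm X u)"

text \<open>The composition of a functional with the operator is defined on \<open>A\<close> only. By the Hahn-Banach theorem it is the
  restriction of a functional on \<open>V\<close>.\<close>

lemma bounded_operator_weakly_continuous:
  assumes V: "function_space X V" and A: "function_space X A" "A \<subseteq> V"
    and W: "function_space Y W" and L: "bounded_operator X A Y W L"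
  shows "continuous_map (subtopology (weak_topology X V) A) (weak_topology Y W) L"
proof -
  from L have LW: "L u \<in> W" if "u \<in> A" for u using that unfolding bounded_operator_def by auto
  from L obtain C where C: "C \<ge> 0" "\<And>u. u \<in> A \<Longrightarrow> sup_norm Y (L u) \<le> C * sup_norm X u"
    unfolding bounded_operator_def by blast
  show ?thesis
    unfolding weak_topology_def[of Y]
  proof (rule continuous_map_into_initial_topology)
    show "L \<in> topspace (subtopology (weak_topology X V) A) \<rightarrow> W" using LW by auto
    fix \<phi> assume \<phi>: "\<phi> \<in> dual_space Y W"
    obtain K where K: "K \<ge> 0" "\<forall>u\<in>W. cmod (\<phi> u) \<le> K * sup_norm Y u" using dual_space_bound[OF \<phi> W] by blast
    have "\<exists>\<psi>\<in>dual_space X V. \<forall>u\<in>A. \<psi> u = \<phi> (L u)"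
    proof (rule functional_extension[OF V A])
      fix u v assume uv: "u \<in> A" "v \<in> A"
      then have "L (\<lambda>x\<in>X. u x + v x) = (\<lambda>y\<in>Y. L u y + L v y)" using L unfolding bounded_operator_def by blast
      then show "\<phi> (L (\<lambda>x\<in>X. u x + v x)) = \<phi> (L u) + \<phi> (L v)"
        using dual_spaceD(2)[OF \<phi> LW[OF uv(1)] LW[OF uv(2)]] by simp
    next
      fix c u assume u: "u \<in> A"
      then have "L (\<lambda>x\<in>X. c * u x) = (\<lambda>y\<in>Y. c * L u y)" using L unfolding bounded_operator_def by blast
      then show "\<phi> (L (\<lambda>x\<in>X. c * u x)) = c * \<phi> (L u)" using dual_spaceD(3)[OF \<phi> LW[OF u]] by simp
    next
      fix u assume u: "u \<in> A"
      have "cmod (\<phi> (L u)) \<le> K * sup_norm Y (L u)" using K LW[OF u] by blast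
      also have "\<dots> \<le> K * (C * sup_norm X u)" by (intro mult_left_mono C u K)
      finally show "cmod (\<phi> (L u)) \<le> (K * C) * sup_norm X u" by simp
    qed
    then obtain \<psi> where \<psi>: "\<psi> \<in> dual_space X V" "\<And>u. u \<in> A \<Longrightarrow> \<psi> u = \<phi> (L u)" by blast
    have "continuous_map (subtopology (weak_topology X V) A) euclidean \<psi>"
      by (rule continuous_map_from_subtopology[OF continuous_map_weak_functional[OF \<psi>(1)]])
    then show "continuous_map (subtopology (weak_topology X V) A) euclidean (\<lambda>u. \<phi> (L u))"
      by (rule continuous_map_eq) (use \<psi>(2) in auto)
  qed
qed

corollary bounded_operator_weakly_compact_image:
  assumes "function_space X V" "function_space X A" "A \<subseteq> V" "function_space Y W"
    and "bounded_operator X A Y W L" and "compactin (weak_topology X V) K" and "K \<subseteq> A"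
  shows "compactin (weak_topology Y W) (L ` K)"
  by (rule image_compactin[OF _ bounded_operator_weakly_continuous[OF assms(1-5)]])
     (use assms(6,7) in \<open>simp add: compactin_subtopology\<close>)

section \<open>Weakly almost periodic functions on semitopological semigroups\<close>

locale semitopological_semigroup =
  fixes S :: "('a, 'm) monoid_scheme" (structure) and T :: "'a topology"
  assumes topspace_eq: "topspace T = carrier S"
    and carrier_nonempty: "carrier S \<noteq> {}"
    and mult_closed: "\<lbrakk>x \<in> carrier S; y \<in> carrier S\<rbrakk> \<Longrightarrow> x \<otimes> y \<in> carrier S"
    and mult_assoc: "\<lbrakk>x \<in> carrier S; y \<in> carrier S; z \<in> carrier S\<rbrakk> \<Longrightarrow> x \<otimes> y \<otimes> z = x \<otimes> (y \<otimes> z)"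
    and continuous_left: "a \<in> carrier S \<Longrightarrow> continuous_map T T (\<lambda>x. a \<otimes> x)"
    and continuous_right: "a \<in> carrier S \<Longrightarrow> continuous_map T T (\<lambda>x. x \<otimes> a)"
begin

abbreviation "weak \<equiv> weak_topology (carrier S) (bounded_cont T)"

definition right_translate :: "('a \<Rightarrow> complex) \<Rightarrow> 'a \<Rightarrow> ('a \<Rightarrow> complex)" where
  "right_translate u t = (\<lambda>x\<in>carrier S. u (x \<otimes> t))"

lemma bc_space: "function_space (carrier S) (bounded_cont T)"
  using function_space_bounded_cont[of T] topspace_eq carrier_nonempty by simp

lemma compose_bounded_cont:
  assumes u: "u \<in> bounded_cont T" and f: "continuous_map T T f"
  shows "(\<lambda>x\<in>carrier S. u (f x)) \<in> bounded_cont T"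
proof -
  have "continuous_map T euclidean (u \<circ> f)"
    using continuous_map_compose[OF f, of euclidean u] u by (simp add: bounded_cont_def)
  then have c: "continuous_map T euclidean (\<lambda>x\<in>carrier S. u (f x))"
    by (rule continuous_map_eq) (simp add: topspace_eq)
  have fc: "f x \<in> topspace T" if "x \<in> carrier S" for x
    using continuous_map_image_subset_topspace[OF f] that by (auto simp: topspace_eq)
  have "(\<lambda>x\<in>carrier S. u (f x)) ` carrier S \<subseteq> u ` topspace T"
  proof (rule image_subsetI)
    fix x assume x: "x \<in> carrier S"
    then show "(\<lambda>x\<in>carrier S. u (f x)) x \<in> u ` topspace T" using fc[OF x] by simp
  qed
  moreover have "bounded (u ` topspace T)" using u by (simp add: bounded_cont_def)
  ultimately have "bounded ((\<lambda>x\<in>carrier S. u (f x)) ` carrier S)" using bounded_subset by blast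
  with c show ?thesis by (simp add: bounded_cont_def topspace_eq)
qed

lemma compose_bounded_operator:
  assumes f: "continuous_map T T f"
  shows "bounded_operator (carrier S) (bounded_cont T) (carrier S) (bounded_cont T) (\<lambda>u. \<lambda>x\<in>carrier S. u (f x))"
proof -
  have fc: "f x \<in> carrier S" if "x \<in> carrier S" for x
    using continuous_map_image_subset_topspace[OF f] that by (auto simp: topspace_eq)
  have "sup_norm (carrier S) (\<lambda>x\<in>carrier S. u (f x)) \<le> 1 * sup_norm (carrier S) u" if "u \<in> bounded_cont T" for u
    using cmod_le_sup_norm[OF function_spaceD(4)[OF bc_space that]] fc carrier_nonempty
    by (intro sup_norm_le) auto
  then show ?thesis unfolding bounded_operator_def
    by (intro conjI exI[of _ 1]) (use compose_bounded_cont[OF _ f] fc in \<open>auto intro!: restrict_ext\<close>)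
qed

lemma translate_bounded_cont:
  "\<lbrakk>u \<in> bounded_cont T; s \<in> carrier S\<rbrakk> \<Longrightarrow> translate S u s \<in> bounded_cont T"
  unfolding translate_def by (rule compose_bounded_cont[OF _ continuous_left])

lemma right_translate_bounded_cont:
  "\<lbrakk>u \<in> bounded_cont T; s \<in> carrier S\<rbrakk> \<Longrightarrow> right_translate u s \<in> bounded_cont T"
  unfolding right_translate_def by (rule compose_bounded_cont[OF _ continuous_right])

lemma WAP_bounded_cont: "u \<in> WAP S T \<Longrightarrow> u \<in> bounded_cont T"
  by (simp add: WAP_def)

definition orbit_closure :: "('a \<Rightarrow> complex) \<Rightarrow> ('a \<Rightarrow> complex) set" where
  "orbit_closure u = weak closure_of (translate S u ` carrier S)"

lemma orbit_closure_compact: "u \<in> WAP S T \<Longrightarrow> compactin weak (orbit_closure u)"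
  by (simp add: WAP_def orbit_closure_def)

lemma translate_in_orbit_closure:
  assumes "u \<in> WAP S T" and "s \<in> carrier S"
  shows "translate S u s \<in> orbit_closure u"
proof -
  have "translate S u ` carrier S \<subseteq> topspace weak"
    using translate_bounded_cont[OF WAP_bounded_cont[OF assms(1)]] by auto
  then show ?thesis unfolding orbit_closure_def using closure_of_subset assms(2) by blast
qed

lemma orbit_closure_bounded_cont: "orbit_closure u \<subseteq> bounded_cont T"
  unfolding orbit_closure_def using closure_of_subset_topspace[of weak] by simp

text \<open>Weakly compact sets are weakly closed, so they contain the closure of every orbit that they contain.\<close>

lemma WAP_if_orbit_in_compact:
  assumes u: "u \<in> bounded_cont T" and K: "compactin weak K"
    and sub: "\<And>s. s \<in> carrier S \<Longrightarrow> translate S u s \<in> K"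
  shows "u \<in> WAP S T"
proof -
  have "closedin weak K" by (rule compactin_imp_closedin[OF Hausdorff_weak_topology[OF bc_space] K])
  then have "weak closure_of (translate S u ` carrier S) \<subseteq> K"
    using sub by (intro closure_of_minimal) auto
  then have "compactin weak (weak closure_of (translate S u ` carrier S))"
    using closed_compactin[OF K] closedin_closure_of by blast
  then show ?thesis using u by (simp add: WAP_def)
qed

lemma orbit_closure_translate:
  assumes "u \<in> WAP S T" and w: "w \<in> orbit_closure u" and r: "r \<in> carrier S"
  shows "translate S w r \<in> orbit_closure u"
proof -
  let ?L = "\<lambda>w. translate S w r"
  have "bounded_operator (carrier S) (bounded_cont T) (carrier S) (bounded_cont T) ?L"
    unfolding translate_def by (rule compose_bounded_operator[OF continuous_left[OF r]])
  then have cont: "continuous_map weak weak ?L"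
    using bounded_operator_weakly_continuous[OF bc_space bc_space order_refl bc_space]
      subtopology_topspace[of weak] by simp
  have "?L ` (translate S u ` carrier S) \<subseteq> translate S u ` carrier S"
  proof (intro subsetI, elim imageE)
    fix z v s assume z: "z = ?L v" "v = translate S u s" "s \<in> carrier S"
    then have "z = translate S u (s \<otimes> r)"
      unfolding translate_def using r by (auto intro!: restrict_ext simp: mult_closed mult_assoc)
    then show "z \<in> translate S u ` carrier S" using mult_closed[OF z(3) r] by blast
  qed
  then have "weak closure_of (?L ` (translate S u ` carrier S)) \<subseteq> orbit_closure u"
    unfolding orbit_closure_def by (rule closure_of_mono)
  moreover have "?L w \<in> weak closure_of (?L ` (translate S u ` carrier S))"
    using continuous_map_image_closure_subset[OF cont] w unfolding orbit_closure_def by blast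
  ultimately show ?thesis by blast
qed

lemma orbit_closure_WAP:
  assumes "u \<in> WAP S T" and w: "w \<in> orbit_closure u"
  shows "w \<in> WAP S T"
  by (rule WAP_if_orbit_in_compact[OF _ orbit_closure_compact[OF assms(1)] orbit_closure_translate[OF assms]])
     (use w orbit_closure_bounded_cont in blast)

lemma translate_WAP: "\<lbrakk>u \<in> WAP S T; s \<in> carrier S\<rbrakk> \<Longrightarrow> translate S u s \<in> WAP S T"
  by (rule orbit_closure_WAP[OF _ translate_in_orbit_closure])

text \<open>Right translations commute with the left translations that define orbits.\<close>

lemma right_translate_WAP:
  assumes u: "u \<in> WAP S T" and t: "t \<in> carrier S"
  shows "right_translate u t \<in> WAP S T"
proof (rule WAP_if_orbit_in_compact)
  have op: "bounded_operator (carrier S) (bounded_cont T) (carrier S) (bounded_cont T) (\<lambda>u. right_translate u t)"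
    unfolding right_translate_def by (rule compose_bounded_operator[OF continuous_right[OF t]])
  show "compactin weak ((\<lambda>u. right_translate u t) ` orbit_closure u)"
    by (rule bounded_operator_weakly_compact_image[OF bc_space bc_space order_refl bc_space op
          orbit_closure_compact[OF u] orbit_closure_bounded_cont])
  fix s assume s: "s \<in> carrier S"
  have "translate S (right_translate u t) s = right_translate (translate S u s) t"
    unfolding translate_def right_translate_def using s t
    by (auto intro!: restrict_ext simp: mult_closed mult_assoc)
  then show "translate S (right_translate u t) s \<in> (\<lambda>u. right_translate u t) ` orbit_closure u"
    using translate_in_orbit_closure[OF u s] by blast
qed (rule right_translate_bounded_cont[OF WAP_bounded_cont[OF u] t])

text \<open>Addition is jointly continuous for the weak topology, so the sum of two weakly compact sets is weakly
  compact.\<close>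

lemma WAP_add:
  assumes u: "u \<in> WAP S T" and v: "v \<in> WAP S T"
  shows "(\<lambda>x\<in>carrier S. u x + v x) \<in> WAP S T"
proof (rule WAP_if_orbit_in_compact)
  let ?add = "\<lambda>p :: ('a \<Rightarrow> complex) \<times> ('a \<Rightarrow> complex). \<lambda>x\<in>carrier S. fst p x + snd p x"
  have "continuous_map (prod_topology weak weak) weak ?add"
    unfolding weak_topology_def[of "carrier S" "bounded_cont T"]
  proof (rule continuous_map_into_initial_topology, goal_cases)
    case 1
    then show ?case using function_spaceD(5)[OF bc_space] by auto
  next
    case (2 \<phi>)
    let ?w = "initial_topology (bounded_cont T) euclidean (dual_space (carrier S) (bounded_cont T))"
    have "continuous_map ?w euclidean \<phi>"
      using continuous_map_weak_functional[OF 2] unfolding weak_topology_def .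
    then have "continuous_map (prod_topology ?w ?w) euclidean (\<phi> \<circ> fst)"
       "continuous_map (prod_topology ?w ?w) euclidean (\<phi> \<circ> snd)"
      using continuous_map_compose[OF continuous_map_fst] continuous_map_compose[OF continuous_map_snd] by blast+
    then have "continuous_map (prod_topology ?w ?w) euclidean (\<lambda>p. \<phi> (fst p) + \<phi> (snd p))"
      by (auto intro: continuous_map_add simp: o_def)
    then show ?case
      by (rule continuous_map_eq) (auto simp: dual_spaceD(2)[OF 2])
  qed
  moreover have "compactin (prod_topology weak weak) (orbit_closure u \<times> orbit_closure v)"
    using orbit_closure_compact u v by (simp add: compactin_Times)
  ultimately show "compactin weak (?add ` (orbit_closure u \<times> orbit_closure v))"
    using image_compactin by blast
  fix s assume s: "s \<in> carrier S"
  have "translate S (\<lambda>x\<in>carrier S. u x + v x) s = ?add (translate S u s, translate S v s)"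
    unfolding translate_def using s by (auto intro!: restrict_ext simp: mult_closed)
  then show "translate S (\<lambda>x\<in>carrier S. u x + v x) s \<in> ?add ` (orbit_closure u \<times> orbit_closure v)"
    using translate_in_orbit_closure[OF u s] translate_in_orbit_closure[OF v s] by blast
qed (rule function_spaceD(5)[OF bc_space WAP_bounded_cont[OF u] WAP_bounded_cont[OF v]])

lemma WAP_scale:
  assumes u: "u \<in> WAP S T"
  shows "(\<lambda>x\<in>carrier S. c * u x) \<in> WAP S T"
proof (rule WAP_if_orbit_in_compact)
  let ?M = "\<lambda>u :: 'a \<Rightarrow> complex. \<lambda>x\<in>carrier S. c * u x"
  have "sup_norm (carrier S) (?M u) \<le> cmod c * sup_norm (carrier S) u" if "u \<in> bounded_cont T" for u
    using cmod_le_sup_norm[OF function_spaceD(4)[OF bc_space that]] carrier_nonempty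
    by (intro sup_norm_le) (auto simp: norm_mult mult_left_mono)
  then have op: "bounded_operator (carrier S) (bounded_cont T) (carrier S) (bounded_cont T) ?M"
    unfolding bounded_operator_def
    by (intro conjI exI[of _ "cmod c"])
       (use function_spaceD(6)[OF bc_space] in \<open>auto intro!: restrict_ext simp: algebra_simps\<close>)
  show "compactin weak (?M ` orbit_closure u)"
    by (rule bounded_operator_weakly_compact_image[OF bc_space bc_space order_refl bc_space op
          orbit_closure_compact[OF u] orbit_closure_bounded_cont])
  fix s assume s: "s \<in> carrier S"
  have "translate S (?M u) s = ?M (translate S u s)"
    unfolding translate_def using s by (auto intro!: restrict_ext simp: mult_closed)
  then show "translate S (?M u) s \<in> ?M ` orbit_closure u"
    using translate_in_orbit_closure[OF u s] by blast
qed (rule function_spaceD(6)[OF bc_space WAP_bounded_cont[OF u]])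

lemma WAP_space: "function_space (carrier S) (WAP S T)"
  unfolding function_space_def
proof (intro conjI ballI allI WAP_add WAP_scale)
  have "(\<lambda>x\<in>carrier S. 0) \<in> WAP S T"
  proof (rule WAP_if_orbit_in_compact)
    obtain v where v: "v \<in> bounded_cont T" using function_spaceD(2)[OF bc_space] by blast
    show 0: "(\<lambda>x\<in>carrier S. 0) \<in> bounded_cont T"
      using function_spaceD(6)[OF bc_space v, of 0] by simp
    show "compactin weak {\<lambda>x\<in>carrier S. 0}" using 0 by simp
    show "translate S (\<lambda>x\<in>carrier S. 0) s \<in> {\<lambda>x\<in>carrier S. 0}" if "s \<in> carrier S" for s
      unfolding translate_def using that by (auto intro!: restrict_ext simp: mult_closed)
  qed
  then show "WAP S T \<noteq> {}" by blast
  show "WAP S T \<subseteq> extensional (carrier S)" using WAP_bounded_cont function_spaceD(3)[OF bc_space] by blast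
  show "bounded (u ` carrier S)" if "u \<in> WAP S T" for u
    using WAP_bounded_cont[OF that] function_spaceD(4)[OF bc_space] by blast
qed (rule carrier_nonempty)

subsection \<open>The compactification\<close>

lemma wap_eval_dual: "x \<in> carrier S \<Longrightarrow> wap_eval S T x \<in> dual_space (carrier S) (WAP S T)"
  unfolding wap_eval_def by (rule evaluation_in_dual_space[OF WAP_space])

lemma wap_points_dual: "s \<in> wap_points S T \<Longrightarrow> s \<in> dual_space (carrier S) (WAP S T)"
  unfolding wap_points_def weak_star_topology_def
  using closure_of_subset_topspace by fastforce

lemma wap_points_extensional: "s \<in> wap_points S T \<Longrightarrow> s \<in> extensional (WAP S T)"
  using wap_points_dual dual_spaceD(1) by blast

lemma wap_points_approx:
  assumes s: "s \<in> wap_points S T" and D: "finite D" "D \<subseteq> WAP S T" "\<delta> > 0"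
  shows "\<exists>x\<in>carrier S. \<forall>u\<in>D. cmod (u x - s u) < \<delta>"
proof -
  have sub: "wap_eval S T ` carrier S \<subseteq> dual_space (carrier S) (WAP S T)" using wap_eval_dual by blast
  have fin: "finite ((\<lambda>u \<phi>. \<phi> u) ` D)" "(\<lambda>u \<phi>. \<phi> u) ` D \<subseteq> (\<lambda>u \<phi>. \<phi> u) ` WAP S T" using D by auto
  obtain y where "y \<in> wap_eval S T ` carrier S" "\<forall>f\<in>(\<lambda>u \<phi>. \<phi> u) ` D. dist (f y) (f s) < \<delta>"
    using s[unfolded wap_points_def weak_star_topology_def in_closure_of_initial_topology_metric[OF sub]]
      fin D(3) by blast
  then obtain x where "x \<in> carrier S" "\<forall>u\<in>D. dist (wap_eval S T x u) (s u) < \<delta>" by auto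
  then have "\<forall>u\<in>D. cmod (u x - s u) < \<delta>" using D(2) by (auto simp: wap_eval_def dist_norm subset_eq)
  then show ?thesis using \<open>x \<in> carrier S\<close> by blast
qed

text \<open>A functional that is approximated by evaluations on finite sets of functions inherits linearity and boundedness from
  them: two functions and their sum can be approximated at the same time.\<close>

lemma wap_pointsI:
  assumes ext: "s \<in> extensional (WAP S T)"
    and approx: "\<And>D \<delta>. \<lbrakk>finite D; D \<subseteq> WAP S T; \<delta> > 0\<rbrakk> \<Longrightarrow> \<exists>x\<in>carrier S. \<forall>u\<in>D. cmod (u x - s u) < \<delta>"
  shows "s \<in> wap_points S T"
proof -
  have dual: "s \<in> dual_space (carrier S) (WAP S T)"
    unfolding dual_space_def
  proof (intro CollectI conjI ballI allI ext)
    fix u v assume uv: "u \<in> WAP S T" "v \<in> WAP S T"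
    let ?w = "\<lambda>x\<in>carrier S. u x + v x"
    have "cmod (s ?w - (s u + s v)) \<le> e" if "e > 0" for e
    proof -
      obtain x where x: "x \<in> carrier S" "\<forall>w\<in>{u, v, ?w}. cmod (w x - s w) < e / 3"
        using approx[of "{u, v, ?w}" "e / 3"] uv WAP_add[OF uv] \<open>e > 0\<close> by auto
      have "s ?w - (s u + s v) = (u x - s u) + (v x - s v) - (?w x - s ?w)" using x(1) by simp
      also have "cmod \<dots> \<le> cmod (u x - s u) + cmod (v x - s v) + cmod (?w x - s ?w)"
        by (meson add_right_mono norm_triangle_ineq norm_triangle_ineq4 order_trans)
      also have "\<dots> \<le> e" using x(2) by auto
      finally show ?thesis .
    qed
    then have "cmod (s ?w - (s u + s v)) \<le> 0" by (rule field_le_epsilon[of _ 0, simplified])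
    then show "s ?w = s u + s v" by simp
  next
    fix c u assume u: "u \<in> WAP S T"
    let ?w = "\<lambda>x\<in>carrier S. c * u x"
    have "cmod (s ?w - c * s u) \<le> e" if "e > 0" for e
    proof -
      define d where "d = e / (1 + cmod c)"
      have d: "d > 0" "d + cmod c * d = e"
        unfolding d_def using \<open>e > 0\<close> by (auto simp: add_pos_nonneg field_simps add_nonneg_eq_0_iff)
      obtain x where x: "x \<in> carrier S" "\<forall>w\<in>{u, ?w}. cmod (w x - s w) < d"
        using approx[of "{u, ?w}" d] u WAP_scale[OF u] d by auto
      have "s ?w - c * s u = c * (u x - s u) - (?w x - s ?w)" using x(1) by (simp add: algebra_simps)
      also have "cmod \<dots> \<le> cmod c * cmod (u x - s u) + cmod (?w x - s ?w)"
        by (metis norm_mult norm_triangle_ineq4)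
      also have "\<dots> \<le> cmod c * d + d" using x(2) by (intro add_mono mult_left_mono) auto
      finally show ?thesis using d by simp
    qed
    then have "cmod (s ?w - c * s u) \<le> 0" by (rule field_le_epsilon[of _ 0, simplified])
    then show "s ?w = c * s u" by simp
  next
    have "cmod (s u) \<le> 1 * sup_norm (carrier S) u" if u: "u \<in> WAP S T" for u
    proof (rule field_le_epsilon)
      fix e :: real assume "e > 0"
      then obtain x where x: "x \<in> carrier S" "cmod (u x - s u) < e" using approx[of "{u}" e] u by auto
      have "cmod (s u) \<le> cmod (u x) + cmod (u x - s u)" by (metis norm_minus_commute norm_triangle_sub)
      then show "cmod (s u) \<le> 1 * sup_norm (carrier S) u + e"
        using x cmod_le_sup_norm[OF function_spaceD(4)[OF WAP_space u] x(1)] by simp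
    qed
    then show "\<exists>K. \<forall>u\<in>WAP S T. cmod (s u) \<le> K * sup_norm (carrier S) u" by blast
  qed
  have sub: "wap_eval S T ` carrier S \<subseteq> dual_space (carrier S) (WAP S T)" using wap_eval_dual by blast
  show ?thesis
    unfolding wap_points_def weak_star_topology_def in_closure_of_initial_topology_metric[OF sub]
  proof (intro conjI allI impI dual)
    fix D :: "((('a \<Rightarrow> complex) \<Rightarrow> complex) \<Rightarrow> complex) set" and \<delta> :: real
    assume D: "finite D" "D \<subseteq> (\<lambda>u \<phi>. \<phi> u) ` WAP S T" "\<delta> > 0"
    then obtain E where E: "finite E" "E \<subseteq> WAP S T" "D = (\<lambda>u \<phi>. \<phi> u) ` E" using finite_subset_image by metis
    obtain x where x: "x \<in> carrier S" "\<forall>u\<in>E. cmod (u x - s u) < \<delta>" using approx[OF E(1,2) D(3)] by blast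
    then have "\<forall>f\<in>D. dist (f (wap_eval S T x)) (f s) < \<delta>"
      using E(2) unfolding E(3) wap_eval_def dist_norm by auto
    then show "\<exists>y\<in>wap_eval S T ` carrier S. \<forall>f\<in>D. dist (f y) (f s) < \<delta>" using x(1) by blast
  qed
qed

lemma wap_points_bound:
  assumes s: "s \<in> wap_points S T" and u: "u \<in> WAP S T"
  shows "cmod (s u) \<le> sup_norm (carrier S) u"
proof (rule field_le_epsilon)
  fix e :: real assume "e > 0"
  then obtain x where x: "x \<in> carrier S" "cmod (u x - s u) < e" using wap_points_approx[OF s, of "{u}" e] u by auto
  have "cmod (s u) \<le> cmod (u x) + cmod (u x - s u)" by (metis norm_minus_commute norm_triangle_sub)
  then show "cmod (s u) \<le> sup_norm (carrier S) u + e"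
    using x cmod_le_sup_norm[OF function_spaceD(4)[OF WAP_space u] x(1)] by simp
qed

lemma wap_eval_points: "x \<in> carrier S \<Longrightarrow> wap_eval S T x \<in> wap_points S T"
  by (rule wap_pointsI) (auto simp: wap_eval_def intro!: bexI[of _ x])

lemma topspace_wap_topology [simp]: "topspace (wap_topology S T) = wap_points S T"
  unfolding wap_topology_def weak_star_topology_def using wap_points_dual by auto

lemma continuous_map_wap_topology_eval:
  assumes "u \<in> WAP S T"
  shows "continuous_map (wap_topology S T) euclidean (\<lambda>s. s u)"
  unfolding wap_topology_def weak_star_topology_def
  by (intro continuous_map_from_subtopology continuous_map_initial_topology_member) (use assms in auto)

lemma continuous_map_into_wap_topology:
  assumes "g \<in> topspace Z \<rightarrow> wap_points S T"
    and "\<And>u. u \<in> WAP S T \<Longrightarrow> continuous_map Z euclidean (\<lambda>z. g z u)"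
  shows "continuous_map Z (wap_topology S T) g"
  unfolding wap_topology_def weak_star_topology_def
  using assms wap_points_dual
  by (intro continuous_map_into_subtopology continuous_map_into_initial_topology) (auto simp: Pi_iff)

lemma Hausdorff_wap_topology: "Hausdorff_space (wap_topology S T)"
  unfolding wap_topology_def weak_star_topology_def
proof (intro Hausdorff_space_subtopology Hausdorff_space_initial_topology)
  fix s t assume st: "s \<in> dual_space (carrier S) (WAP S T)" "t \<in> dual_space (carrier S) (WAP S T)"
    "\<And>f. f \<in> (\<lambda>u \<phi>. \<phi> u) ` WAP S T \<Longrightarrow> f s = f t"
  show "s = t"
    by (rule extensionalityI[OF dual_spaceD(1)[OF st(1)] dual_spaceD(1)[OF st(2)]]) (use st(3) in auto)
qed auto

text \<open>The filter consists of the preimages of the neighbourhoods of \<open>s\<close>; it is proper because \<open>S\<close> is dense.\<close>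

lemma wap_points_filter:
  assumes s: "s \<in> wap_points S T"
  shows "\<exists>F. F \<noteq> bot \<and> F \<le> principal (carrier S) \<and> limitin (wap_topology S T) (wap_eval S T) s F"
proof -
  let ?N = "nhdsin (wap_topology S T) s"
  define F where "F = inf (filtercomap (wap_eval S T) ?N) (principal (carrier S))"
  have ev: "eventually P F \<longleftrightarrow> (\<exists>U. openin (wap_topology S T) U \<and> s \<in> U \<and>
      (\<forall>x\<in>carrier S. wap_eval S T x \<in> U \<longrightarrow> P x))" for P
    unfolding F_def eventually_inf_principal eventually_filtercomap eventually_nhdsin
    using s by (auto; metis)
  have "F \<noteq> bot"
  proof
    assume "F = bot"
    then have "eventually (\<lambda>_. False) F" by simp
    then obtain U where U: "openin (wap_topology S T) U" "s \<in> U" "\<forall>x\<in>carrier S. wap_eval S T x \<notin> U"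
      unfolding ev by blast
    then obtain V where V: "openin (weak_star_topology (carrier S) (WAP S T)) V" "U = V \<inter> wap_points S T"
      unfolding wap_topology_def openin_subtopology by blast
    have "\<exists>y. y \<in> wap_eval S T ` carrier S \<and> y \<in> V"
      using s[unfolded wap_points_def in_closure_of] V U(2) by blast
    then show False using U(3) V(2) wap_eval_points by blast
  qed
  moreover have "F \<le> principal (carrier S)" unfolding F_def by simp
  moreover have "limitin (wap_topology S T) (wap_eval S T) s F"
    unfolding limitin_def using s by (auto simp: ev)
  ultimately show ?thesis by blast
qed

lemma limitin_wap_topologyD:
  assumes "limitin (wap_topology S T) (wap_eval S T) s F" and "u \<in> WAP S T"
  shows "(u \<longlongrightarrow> s u) F"
proof -
  have "limitin euclidean ((\<lambda>s. s u) \<circ> wap_eval S T) (s u) F"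
    by (rule continuous_map_limit[OF continuous_map_wap_topology_eval[OF assms(2)] assms(1)])
  moreover have "(\<lambda>s. s u) \<circ> wap_eval S T = u" using assms(2) by (auto simp: wap_eval_def)
  ultimately show ?thesis by simp
qed

text \<open>For fixed \<open>t\<close> the function \<open>x \<mapsto> u (x t)\<close> is weakly almost periodic, so its limit along every filter
  that converges to \<open>s\<close> is its value at \<open>s\<close>.\<close>

lemma wap_act_eq:
  assumes s: "s \<in> wap_points S T" and u: "u \<in> WAP S T"
  shows "wap_act S T u s = (\<lambda>t\<in>carrier S. s (right_translate u t))"
  unfolding wap_act_def
proof (rule restrict_ext, rule the_equality)
  fix t assume t: "t \<in> carrier S"
  have conv: "((\<lambda>x. u (x \<otimes> t)) \<longlongrightarrow> s (right_translate u t)) F"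
    if F: "F \<le> principal (carrier S)" "limitin (wap_topology S T) (wap_eval S T) s F" for F
  proof (rule Lim_transform_eventually)
    show "(right_translate u t \<longlongrightarrow> s (right_translate u t)) F"
      by (rule limitin_wap_topologyD[OF F(2) right_translate_WAP[OF u t]])
    have "eventually (\<lambda>x. x \<in> carrier S) F" using F(1) by (simp add: le_principal)
    then show "eventually (\<lambda>x. right_translate u t x = u (x \<otimes> t)) F"
      by (rule eventually_mono) (simp add: right_translate_def)
  qed
  then show "\<forall>F. F \<noteq> bot \<longrightarrow> F \<le> principal (carrier S) \<longrightarrow>
      limitin (wap_topology S T) (wap_eval S T) s F \<longrightarrow>
      ((\<lambda>x. u (x \<otimes> t)) \<longlongrightarrow> s (right_translate u t)) F" by blast
  fix c assume c: "\<forall>F. F \<noteq> bot \<longrightarrow> F \<le> principal (carrier S) \<longrightarrow>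
      limitin (wap_topology S T) (wap_eval S T) s F \<longrightarrow> ((\<lambda>x. u (x \<otimes> t)) \<longlongrightarrow> c) F"
  obtain F where F: "F \<noteq> bot" "F \<le> principal (carrier S)" "limitin (wap_topology S T) (wap_eval S T) s F"
    using wap_points_filter[OF s] by blast
  have "((\<lambda>x. u (x \<otimes> t)) \<longlongrightarrow> c) F" using c F by blast
  then show "c = s (right_translate u t)" using conv[OF F(2,3)] tendsto_unique[OF F(1)] by blast
qed

lemma wap_act_eval: "\<lbrakk>x \<in> carrier S; u \<in> WAP S T\<rbrakk> \<Longrightarrow> wap_act S T u (wap_eval S T x) = translate S u x"
  unfolding wap_act_eq[OF wap_eval_points] translate_def
proof (rule restrict_ext)
  fix t assume "x \<in> carrier S" "u \<in> WAP S T" "t \<in> carrier S"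
  then have "wap_eval S T x (right_translate u t) = right_translate u t x"
    by (simp add: wap_eval_def right_translate_WAP)
  also have "\<dots> = u (x \<otimes> t)" using \<open>x \<in> carrier S\<close> by (simp add: right_translate_def)
  finally show "wap_eval S T x (right_translate u t) = u (x \<otimes> t)" .
qed

text \<open>The function \<open>u \<cdot> s\<close> is a pointwise limit of translates of \<open>u\<close>, and therefore a
  weak limit of translates.\<close>

lemma wap_act_in_orbit_closure:
  assumes s: "s \<in> wap_points S T" and u: "u \<in> WAP S T"
  shows "wap_act S T u s \<in> orbit_closure u"
proof (rule weakly_compact_pointwise_closed[OF bc_space orbit_closure_compact[OF u]])
  show "wap_act S T u s \<in> extensional (carrier S)" using assms by (simp add: wap_act_eq)
  fix D :: "'a set" and \<delta> :: real assume D: "finite D" "D \<subseteq> carrier S" "\<delta> > 0"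
  have "right_translate u ` D \<subseteq> WAP S T" using right_translate_WAP[OF u] D(2) by blast
  then obtain x where x: "x \<in> carrier S" "\<forall>v\<in>right_translate u ` D. cmod (v x - s v) < \<delta>"
    using wap_points_approx[OF s, of "right_translate u ` D" \<delta>] D by auto
  have "\<forall>t\<in>D. cmod (translate S u x t - wap_act S T u s t) < \<delta>"
    using x D(2) by (auto simp: wap_act_eq[OF s u] translate_def right_translate_def subset_eq)
  then show "\<exists>k\<in>orbit_closure u. \<forall>t\<in>D. cmod (k t - wap_act S T u s t) < \<delta>"
    using translate_in_orbit_closure[OF u x(1)] by blast
qed

lemma wap_act_WAP: "\<lbrakk>s \<in> wap_points S T; u \<in> WAP S T\<rbrakk> \<Longrightarrow> wap_act S T u s \<in> WAP S T"
  by (rule orbit_closure_WAP[OF _ wap_act_in_orbit_closure])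

abbreviation "comp_mult \<equiv> monoid.mult (wap_compactification S T)"

lemma comp_mult_apply: "u \<in> WAP S T \<Longrightarrow> comp_mult s s' u = s' (wap_act S T u s)"
  by (simp add: wap_compactification_def)

text \<open>Since \<open>\<langle>u, s s'\<rangle> = lim\<^sub>y lim\<^sub>x u (x y)\<close>, first \<open>y\<close> and then \<open>x\<close> is chosen.\<close>

lemma comp_mult_closed:
  assumes s: "s \<in> wap_points S T" and s': "s' \<in> wap_points S T"
  shows "comp_mult s s' \<in> wap_points S T"
proof (rule wap_pointsI)
  show "comp_mult s s' \<in> extensional (WAP S T)" by (simp add: wap_compactification_def)
  fix D and \<delta> :: real assume D: "finite D" "D \<subseteq> WAP S T" "\<delta> > 0"
  have "(\<lambda>u. wap_act S T u s) ` D \<subseteq> WAP S T" using wap_act_WAP[OF s] D(2) by blast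
  then obtain y where y: "y \<in> carrier S" "\<forall>w\<in>(\<lambda>u. wap_act S T u s) ` D. cmod (w y - s' w) < \<delta> / 2"
    using wap_points_approx[OF s', of "(\<lambda>u. wap_act S T u s) ` D" "\<delta> / 2"] D by auto
  have "(\<lambda>u. right_translate u y) ` D \<subseteq> WAP S T" using right_translate_WAP y(1) D(2) by blast
  then obtain x where x: "x \<in> carrier S" "\<forall>w\<in>(\<lambda>u. right_translate u y) ` D. cmod (w x - s w) < \<delta> / 2"
    using wap_points_approx[OF s, of "(\<lambda>u. right_translate u y) ` D" "\<delta> / 2"] D by auto
  have "cmod (u (x \<otimes> y) - comp_mult s s' u) < \<delta>" if u: "u \<in> D" for u
  proof -
    have uW: "u \<in> WAP S T" using u D(2) by blast
    have "cmod (u (x \<otimes> y) - s (right_translate u y)) < \<delta> / 2"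
      using x u by (auto simp: right_translate_def)
    moreover have "cmod (s (right_translate u y) - s' (wap_act S T u s)) < \<delta> / 2"
      using y u wap_act_eq[OF s uW] by auto
    ultimately have "dist (u (x \<otimes> y)) (s' (wap_act S T u s)) < \<delta>"
      unfolding dist_norm[symmetric]
      using dist_triangle[of "u (x \<otimes> y)" "s' (wap_act S T u s)" "s (right_translate u y)"] by linarith
    then show ?thesis by (simp add: comp_mult_apply[OF uW] dist_norm)
  qed
  then show "\<exists>x\<in>carrier S. \<forall>u\<in>D. cmod (u x - comp_mult s s' u) < \<delta>"
    using mult_closed[OF x(1) y(1)] by blast
qed

lemma wap_act_bounded_operator:
  assumes s: "s \<in> wap_points S T"
  shows "bounded_operator (carrier S) (WAP S T) (carrier S) (WAP S T) (\<lambda>u. wap_act S T u s)"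
  unfolding bounded_operator_def
proof (intro conjI ballI allI)
  note dual = dual_spaceD[OF wap_points_dual[OF s]]
  show "(\<lambda>u. wap_act S T u s) \<in> WAP S T \<rightarrow> WAP S T" using wap_act_WAP[OF s] by blast
  fix u v assume uv: "u \<in> WAP S T" "v \<in> WAP S T"
  have "right_translate (\<lambda>x\<in>carrier S. u x + v x) t =
      (\<lambda>x\<in>carrier S. right_translate u t x + right_translate v t x)" if "t \<in> carrier S" for t
    unfolding right_translate_def using that by (auto intro!: restrict_ext simp: mult_closed)
  then show "wap_act S T (\<lambda>x\<in>carrier S. u x + v x) s = (\<lambda>y\<in>carrier S. wap_act S T u s y + wap_act S T v s y)"
    unfolding wap_act_eq[OF s uv(1)] wap_act_eq[OF s uv(2)] wap_act_eq[OF s WAP_add[OF uv]]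
    by (auto intro!: restrict_ext simp: dual(2) right_translate_WAP uv)
next
  note dual = dual_spaceD[OF wap_points_dual[OF s]]
  fix c u assume u: "u \<in> WAP S T"
  have "right_translate (\<lambda>x\<in>carrier S. c * u x) t = (\<lambda>x\<in>carrier S. c * right_translate u t x)"
    if "t \<in> carrier S" for t
    unfolding right_translate_def using that by (auto intro!: restrict_ext simp: mult_closed)
  then show "wap_act S T (\<lambda>x\<in>carrier S. c * u x) s = (\<lambda>y\<in>carrier S. c * wap_act S T u s y)"
    unfolding wap_act_eq[OF s u] wap_act_eq[OF s WAP_scale[OF u]]
    by (auto intro!: restrict_ext simp: dual(3) right_translate_WAP u)
next
  have "sup_norm (carrier S) (wap_act S T u s) \<le> 1 * sup_norm (carrier S) u" if u: "u \<in> WAP S T" for u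
    unfolding mult_1
  proof (rule sup_norm_le[OF carrier_nonempty])
    fix t assume t: "t \<in> carrier S"
    have "cmod (wap_act S T u s t) \<le> sup_norm (carrier S) (right_translate u t)"
      using wap_points_bound[OF s right_translate_WAP[OF u t]] t by (simp add: wap_act_eq[OF s u])
    also have "\<dots> \<le> sup_norm (carrier S) u"
      using cmod_le_sup_norm[OF function_spaceD(4)[OF WAP_space u]] t
      by (intro sup_norm_le[OF carrier_nonempty]) (auto simp: right_translate_def mult_closed)
    finally show "cmod (wap_act S T u s t) \<le> sup_norm (carrier S) u" .
  qed
  then show "\<exists>C\<ge>0. \<forall>u\<in>WAP S T. sup_norm (carrier S) (wap_act S T u s) \<le> C * sup_norm (carrier S) u"
    by (intro exI[of _ 1]) auto
qed

end

section \<open>Norm continuity of orbits and group topologies\<close>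

lemma openin_Collect_finite_ball:
  assumes "finite Z" and "\<And>z. z \<in> Z \<Longrightarrow> openin T {x \<in> topspace T. P z x}"
  shows "openin T {x \<in> topspace T. \<forall>z\<in>Z. P z x}"
  using assms
proof (induction Z)
  case (insert a Z)
  have "openin T ({x \<in> topspace T. P a x} \<inter> {x \<in> topspace T. \<forall>z\<in>Z. P z x})"
    by (intro openin_Int insert.prems insert.IH) auto
  moreover have "{x \<in> topspace T. P a x} \<inter> {x \<in> topspace T. \<forall>z\<in>Z. P z x} =
      {x \<in> topspace T. \<forall>z\<in>insert a Z. P z x}" by auto
  ultimately show ?case by simp
qed simp

lemma continuous_map_metric_iff:
  fixes g :: "'a \<Rightarrow> 'b::metric_space"
  shows "continuous_map X euclidean g \<longleftrightarrow>
    (\<forall>a\<in>topspace X. \<forall>\<epsilon>>0. \<exists>U. openin X U \<and> a \<in> U \<and> (\<forall>x\<in>U. dist (g x) (g a) < \<epsilon>))"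
proof
  assume c: "continuous_map X euclidean g"
  show "\<forall>a\<in>topspace X. \<forall>\<epsilon>>0. \<exists>U. openin X U \<and> a \<in> U \<and> (\<forall>x\<in>U. dist (g x) (g a) < \<epsilon>)"
  proof (intro ballI allI impI)
    fix a and \<epsilon> :: real assume "a \<in> topspace X" "\<epsilon> > 0"
    moreover have "openin X {x \<in> topspace X. g x \<in> ball (g a) \<epsilon>}" using c unfolding continuous_map_def by auto
    ultimately show "\<exists>U. openin X U \<and> a \<in> U \<and> (\<forall>x\<in>U. dist (g x) (g a) < \<epsilon>)"
      by (intro exI[of _ "{x \<in> topspace X. g x \<in> ball (g a) \<epsilon>}"]) (auto simp: dist_commute)
  qed
next
  assume r: "\<forall>a\<in>topspace X. \<forall>\<epsilon>>0. \<exists>U. openin X U \<and> a \<in> U \<and> (\<forall>x\<in>U. dist (g x) (g a) < \<epsilon>)"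
  show "continuous_map X euclidean g"
    unfolding continuous_map_def
  proof (intro conjI allI impI)
    fix V :: "'b set" assume "openin euclidean V"
    then have V: "open V" by simp
    show "openin X {x \<in> topspace X. g x \<in> V}"
    proof (subst openin_subopen, intro ballI)
      fix a assume a: "a \<in> {x \<in> topspace X. g x \<in> V}"
      then obtain \<epsilon> where \<epsilon>: "\<epsilon> > 0" "\<And>y. dist y (g a) < \<epsilon> \<Longrightarrow> y \<in> V" using V unfolding open_dist by blast
      obtain U where "openin X U" "a \<in> U" "\<forall>x\<in>U. dist (g x) (g a) < \<epsilon>" using r a \<epsilon>(1) by blast
      then show "\<exists>U. openin X U \<and> a \<in> U \<and> U \<subseteq> {x \<in> topspace X. g x \<in> V}"
        using \<epsilon>(2) openin_subset by (intro exI[of _ U]) blast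
    qed
  qed auto
qed

lemma continuous_map_metricD:
  fixes g :: "'a \<Rightarrow> 'b::metric_space"
  assumes "continuous_map X euclidean g"
  shows "openin X {x \<in> topspace X. dist (g x) c < \<epsilon>}"
proof -
  have "openin X {x \<in> topspace X. g x \<in> ball c \<epsilon>}" using assms unfolding continuous_map_def by auto
  then show ?thesis by (simp add: dist_commute)
qed

context semitopological_semigroup
begin

text \<open>One half of Grothendieck's double limit criterion. The limit of \<open>u (Y n) - u (Y' n)\<close> along a subsequence for which
  it exists at \<open>u = k\<close> extends to a functional by the Hahn-Banach theorem. The functional vanishes on the translates
  of \<open>f\<close> by \<open>x i\<close> and hence on their weak cluster point \<open>k\<close>, while the lower bound passes to \<open>k\<close>.\<close>

lemma WAP_double_limit:
  fixes x Y Y' :: "nat \<Rightarrow> 'a"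
  assumes f: "f \<in> WAP S T"
    and x: "\<And>i. x i \<in> carrier S" and Y: "\<And>n. Y n \<in> carrier S" and Y': "\<And>n. Y' n \<in> carrier S"
    and lim0: "\<And>i. (\<lambda>n. f (x i \<otimes> Y n) - f (x i \<otimes> Y' n)) \<longlonglongrightarrow> 0"
    and big: "\<And>n. \<exists>N. \<forall>i\<ge>N. c \<le> cmod (f (x i \<otimes> Y n) - f (x i \<otimes> Y' n))"
  shows "c \<le> 0"
proof -
  define a where "a i = translate S f (x i)" for i
  have aY: "a i (Y n) - a i (Y' n) = f (x i \<otimes> Y n) - f (x i \<otimes> Y' n)" for i n
    unfolding a_def translate_def using Y Y' by simp
  have aK: "a i \<in> orbit_closure f" for i unfolding a_def by (rule translate_in_orbit_closure[OF f x])
  obtain k where k: "k \<in> orbit_closure f" "\<And>n. k \<in> weak closure_of {a i |i. i \<ge> n}"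
    using compactin_sequence_cluster_point[OF orbit_closure_compact[OF f], of a] aK by blast
  have kbc: "k \<in> bounded_cont T" using k(1) orbit_closure_bounded_cont by blast
  have k_big: "c \<le> cmod (k (Y n) - k (Y' n))" for n
  proof -
    obtain N where N: "\<forall>i\<ge>N. c \<le> cmod (a i (Y n) - a i (Y' n))" using big[of n] unfolding aY by blast
    have "continuous_map weak euclidean (\<lambda>u. u (Y n) - u (Y' n))"
      by (intro continuous_map_diff continuous_map_weak_evaluation bc_space Y Y')
    then have "closedin weak {u \<in> topspace weak. u (Y n) - u (Y' n) \<in> {z. c \<le> cmod z}}"
      by (rule closedin_continuous_map_preimage) (auto intro!: closed_Collect_le continuous_intros)
    moreover have "{a i |i. i \<ge> N} \<subseteq> {u \<in> topspace weak. u (Y n) - u (Y' n) \<in> {z. c \<le> cmod z}}"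
      using N aK orbit_closure_bounded_cont by auto
    ultimately show ?thesis using k(2)[of N] closure_of_minimal by blast
  qed
  have "bounded (range (\<lambda>n. k (Y n) - k (Y' n)))"
  proof (rule boundedI)
    fix z assume "z \<in> range (\<lambda>n. k (Y n) - k (Y' n))"
    then obtain n where n: "z = k (Y n) - k (Y' n)" by blast
    have "cmod (k (Y n)) \<le> sup_norm (carrier S) k" "cmod (k (Y' n)) \<le> sup_norm (carrier S) k"
      by (intro cmod_le_sup_norm function_spaceD(4)[OF bc_space kbc] Y Y')+
    then show "cmod z \<le> sup_norm (carrier S) k + sup_norm (carrier S) k"
      unfolding n by (meson add_mono norm_triangle_ineq4 order_trans)
  qed
  then obtain l r where r: "strict_mono (r :: nat \<Rightarrow> nat)" "((\<lambda>n. k (Y n) - k (Y' n)) \<circ> r) \<longlonglongrightarrow> l"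
    using bounded_imp_convergent_subsequence by blast
  define D where "D u j = u (Y (r j)) - u (Y' (r j))" for u :: "'a \<Rightarrow> complex" and j
  define A where "A = {u \<in> bounded_cont T. convergent (D u)}"
  have k_lim: "D k \<longlonglongrightarrow> l" using r(2) unfolding D_def o_def .
  have a_lim: "D (a i) \<longlonglongrightarrow> 0" for i
    using LIMSEQ_subseq_LIMSEQ[OF lim0[of i] r(1)] unfolding D_def aY o_def .
  have kA: "k \<in> A" unfolding A_def using kbc k_lim convergentI by blast
  have aA: "a i \<in> A" for i
    unfolding A_def using aK orbit_closure_bounded_cont a_lim convergentI by blast
  have Dadd: "D (\<lambda>x\<in>carrier S. u x + v x) = (\<lambda>j. D u j + D v j)" for u v
    unfolding D_def using Y Y' by auto
  have Dscale: "D (\<lambda>x\<in>carrier S. z * u x) = (\<lambda>j. z * D u j)" for z u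
    unfolding D_def using Y Y' by (auto simp: algebra_simps)
  have Aspace: "function_space (carrier S) A"
    unfolding function_space_def
  proof (intro conjI ballI allI)
    show "A \<noteq> {}" using kA by blast
    show "A \<subseteq> extensional (carrier S)" unfolding A_def using function_spaceD(3)[OF bc_space] by blast
    show "bounded (u ` carrier S)" if "u \<in> A" for u
      using that function_spaceD(4)[OF bc_space] unfolding A_def by blast
    show "(\<lambda>x\<in>carrier S. u x + v x) \<in> A" if "u \<in> A" "v \<in> A" for u v
      using that function_spaceD(5)[OF bc_space, of u v] unfolding A_def by (auto simp: Dadd intro: convergent_add)
    show "(\<lambda>x\<in>carrier S. z * u x) \<in> A" if "u \<in> A" for z u
      using that function_spaceD(6)[OF bc_space, of u z] unfolding A_def
      by (auto simp: Dscale intro: convergent_mult convergent_const)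
  qed (rule carrier_nonempty)
  have "\<exists>\<phi>\<in>dual_space (carrier S) (bounded_cont T). \<forall>u\<in>A. \<phi> u = lim (D u)"
  proof (rule functional_extension[OF bc_space Aspace])
    show "A \<subseteq> bounded_cont T" unfolding A_def by blast
    show "lim (D (\<lambda>x\<in>carrier S. u x + v x)) = lim (D u) + lim (D v)" if "u \<in> A" "v \<in> A" for u v
      using that unfolding Dadd A_def by (intro limI tendsto_add) (auto simp: convergent_LIMSEQ_iff)
    show "lim (D (\<lambda>x\<in>carrier S. z * u x)) = z * lim (D u)" if "u \<in> A" for z u
      using that unfolding Dscale A_def by (intro limI tendsto_mult_left) (auto simp: convergent_LIMSEQ_iff)
    fix u assume u: "u \<in> A"
    then have "D u \<longlonglongrightarrow> lim (D u)" unfolding A_def by (simp add: convergent_LIMSEQ_iff)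
    then have "(\<lambda>j. cmod (D u j)) \<longlonglongrightarrow> cmod (lim (D u))" by (rule tendsto_norm)
    moreover have "cmod (D u j) \<le> 2 * sup_norm (carrier S) u" for j
    proof -
      have "cmod (u (Y (r j))) \<le> sup_norm (carrier S) u" "cmod (u (Y' (r j))) \<le> sup_norm (carrier S) u"
        by (intro cmod_le_sup_norm function_spaceD(4)[OF Aspace u] Y Y')+
      then show ?thesis unfolding D_def using norm_triangle_ineq4[of "u (Y (r j))" "u (Y' (r j))"] by linarith
    qed
    ultimately show "cmod (lim (D u)) \<le> 2 * sup_norm (carrier S) u"
      by (intro LIMSEQ_le_const2) auto
  qed
  then obtain \<phi> where \<phi>: "\<phi> \<in> dual_space (carrier S) (bounded_cont T)" "\<And>u. u \<in> A \<Longrightarrow> \<phi> u = lim (D u)" by blast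
  have "closedin weak {u \<in> topspace weak. \<phi> u \<in> {0}}"
    by (rule closedin_continuous_map_preimage[OF continuous_map_weak_functional[OF \<phi>(1)]]) simp
  moreover have "{a i |i. i \<ge> 0} \<subseteq> {u \<in> topspace weak. \<phi> u \<in> {0}}"
  proof
    fix u assume "u \<in> {a i |i. i \<ge> 0}"
    then obtain i where "u = a i" by blast
    then show "u \<in> {u \<in> topspace weak. \<phi> u \<in> {0}}"
      using \<phi>(2)[OF aA[of i]] limI[OF a_lim[of i]] aA[of i] unfolding A_def by simp
  qed
  ultimately have "\<phi> k = 0" using k(2)[of 0] closure_of_minimal by blast
  then have "l = 0" using \<phi>(2)[OF kA] limI[OF k_lim] by simp
  moreover have "c \<le> cmod l"
    by (rule LIMSEQ_le_const[OF tendsto_norm[OF k_lim]]) (use k_big in \<open>auto simp: D_def\<close>)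
  ultimately show ?thesis by simp
qed

text \<open>Choose finitely many \<open>z\<close> such that every \<open>y\<close> is close to one of them as seen from the points of \<open>X\<close>. If
  closeness seen from \<open>X\<close> implied closeness seen from all of \<open>Q\<close>, then the oscillation of the functions \<open>x \<mapsto> f (x y)\<close> on \<open>Q\<close>
  would be controlled by the finitely many \<open>x \<mapsto> f (x z)\<close>, and these oscillate little on a smaller open set. The four
  steps from \<open>x\<close> to \<open>x'\<close> account for the constant \<open>\<epsilon>/4\<close>.\<close>

lemma oscillation_step:
  assumes f: "f \<in> WAP S T" and top: "topspace \<tau> = carrier S"
    and cont: "\<And>t. t \<in> carrier S \<Longrightarrow> continuous_map \<tau> euclidean (\<lambda>x. f (x \<otimes> t))"
    and osc: "\<And>Q. \<lbrakk>openin \<tau> Q; Q \<noteq> {}\<rbrakk> \<Longrightarrow> \<exists>x\<in>Q. \<exists>x'\<in>Q. \<exists>t\<in>carrier S. \<epsilon> < cmod (f (x \<otimes> t) - f (x' \<otimes> t))"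
    and "\<epsilon> > 0" and Q: "openin \<tau> Q" "Q \<noteq> {}" and X: "finite X" "X \<subseteq> carrier S" and "\<delta> > 0"
  shows "\<exists>y\<in>carrier S. \<exists>y'\<in>carrier S. \<exists>z\<in>Q.
    (\<forall>x\<in>X. cmod (f (x \<otimes> y) - f (x \<otimes> y')) < \<delta>) \<and> \<epsilon>/4 < cmod (f (z \<otimes> y) - f (z \<otimes> y'))"
proof (rule ccontr)
  assume "\<not> ?thesis"
  then have small: "cmod (f (z \<otimes> y) - f (z \<otimes> y')) \<le> \<epsilon>/4"
    if "y \<in> carrier S" "y' \<in> carrier S" "z \<in> Q" "\<forall>x\<in>X. cmod (f (x \<otimes> y) - f (x \<otimes> y')) < \<delta>" for y y' z
    using that by (meson not_le)
  have bdd: "bounded ((\<lambda>y. f (x \<otimes> y)) ` carrier S)" if "x \<in> X" for x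
  proof (rule bounded_subset[OF function_spaceD(4)[OF WAP_space f]])
    show "(\<lambda>y. f (x \<otimes> y)) ` carrier S \<subseteq> f ` carrier S"
      using that X(2) by (intro image_subsetI imageI mult_closed) auto
  qed
  have "\<exists>Z. finite Z \<and> Z \<subseteq> carrier S \<and>
      (\<forall>y\<in>carrier S. \<exists>z\<in>Z. \<forall>x\<in>X. cmod (f (x \<otimes> y) - f (x \<otimes> z)) < \<delta>)"
    by (rule bounded_family_finite_net[OF X(1) _ \<open>\<delta> > 0\<close>]) (rule bdd)
  then obtain Z where Z: "finite Z" "Z \<subseteq> carrier S"
    "\<forall>y\<in>carrier S. \<exists>z\<in>Z. \<forall>x\<in>X. cmod (f (x \<otimes> y) - f (x \<otimes> z)) < \<delta>" by (elim exE conjE) (rule that)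
  obtain z0 where z0: "z0 \<in> Q" using Q by blast
  define P where "P = Q \<inter> {x \<in> topspace \<tau>. \<forall>z\<in>Z. dist (f (x \<otimes> z)) (f (z0 \<otimes> z)) < \<epsilon>/4}"
  have "openin \<tau> P" unfolding P_def
    by (intro openin_Int Q openin_Collect_finite_ball Z continuous_map_metricD cont) (use Z in blast)
  moreover have "z0 \<in> P" unfolding P_def using z0 \<open>\<epsilon> > 0\<close> openin_subset[OF Q(1)] by auto
  ultimately obtain x x' t where xt: "x \<in> P" "x' \<in> P" "t \<in> carrier S" "\<epsilon> < cmod (f (x \<otimes> t) - f (x' \<otimes> t))"
    using osc[of P] by (metis empty_iff)
  obtain z where z: "z \<in> Z" "\<forall>x\<in>X. cmod (f (x \<otimes> t) - f (x \<otimes> z)) < \<delta>" using bspec[OF Z(3) xt(3)] by (elim bexE) (rule that)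
  have "z \<in> carrier S" using z(1) Z(2) by blast
  then have "dist (f (x \<otimes> t)) (f (x \<otimes> z)) \<le> \<epsilon>/4" "dist (f (x' \<otimes> t)) (f (x' \<otimes> z)) \<le> \<epsilon>/4"
    using small[OF xt(3) _ _ z(2)] xt(1,2) unfolding P_def dist_norm by auto
  moreover have "dist (f (x \<otimes> z)) (f (z0 \<otimes> z)) < \<epsilon>/4" "dist (f (x' \<otimes> z)) (f (z0 \<otimes> z)) < \<epsilon>/4"
    using xt(1,2) z(1) unfolding P_def by auto
  ultimately have "dist (f (x \<otimes> t)) (f (x' \<otimes> t)) \<le> \<epsilon>"
    using dist_triangle[of "f (x \<otimes> t)" "f (x' \<otimes> t)" "f (x \<otimes> z)"]
      dist_triangle[of "f (x \<otimes> z)" "f (x' \<otimes> t)" "f (z0 \<otimes> z)"]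
      dist_triangle[of "f (z0 \<otimes> z)" "f (x' \<otimes> t)" "f (x' \<otimes> z)"]
      dist_commute[of "f (x' \<otimes> z)" "f (z0 \<otimes> z)"] dist_commute[of "f (x' \<otimes> t)" "f (x' \<otimes> z)"] by linarith
  then show False using xt(4) by (simp add: dist_norm)
qed

text \<open>Otherwise the previous lemma could be iterated along shrinking open sets, and the resulting sequences would
  contradict the double limit criterion: \<open>x i\<close> does not separate \<open>y n\<close> from \<open>y' n\<close> for large \<open>n\<close>, but it does so for large \<open>i\<close>.\<close>

lemma WAP_small_oscillation:
  assumes f: "f \<in> WAP S T" and top: "topspace \<tau> = carrier S"
    and cont: "\<And>t. t \<in> carrier S \<Longrightarrow> continuous_map \<tau> euclidean (\<lambda>x. f (x \<otimes> t))" and "\<epsilon> > 0"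
  shows "\<exists>Q. openin \<tau> Q \<and> Q \<noteq> {} \<and> (\<forall>x\<in>Q. \<forall>x'\<in>Q. \<forall>t\<in>carrier S. cmod (f (x \<otimes> t) - f (x' \<otimes> t)) \<le> \<epsilon>)"
proof (rule ccontr)
  assume neg: "\<not> ?thesis"
  have osc: "\<exists>x\<in>Q. \<exists>x'\<in>Q. \<exists>t\<in>carrier S. \<epsilon> < cmod (f (x \<otimes> t) - f (x' \<otimes> t))"
    if "openin \<tau> Q" "Q \<noteq> {}" for Q
    using neg that by (meson not_le)
  \<comment> \<open>A state consists of an open set, the finite set of the points \<open>x i\<close> chosen so far, the latest of
    these points, and the current pair \<open>y\<close>, \<open>y'\<close>.\<close>
  let ?P = "\<lambda>(n::nat) (Q, X, x, y, y'). openin \<tau> Q \<and> finite X \<and> X \<subseteq> carrier S \<and> x \<in> Q \<and> x \<in> X \<and>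
    y \<in> carrier S \<and> y' \<in> carrier S"
  let ?R = "\<lambda>n (Q, X, x, y, y') (Q1, X1, x1, y1, y1'). Q1 \<subseteq> Q \<and> X \<subseteq> X1 \<and>
    (\<forall>w\<in>X. cmod (f (w \<otimes> y1) - f (w \<otimes> y1')) < inverse (real (Suc n))) \<and>
    (\<forall>w\<in>Q1. \<epsilon>/4 < cmod (f (w \<otimes> y1) - f (w \<otimes> y1')))"
  have "\<exists>s. \<forall>n. ?P n (s n) \<and> ?R n (s n) (s (Suc n))"
  proof (rule dependent_nat_choice)
    obtain a where "a \<in> carrier S" using carrier_nonempty by blast
    then have "?P 0 (topspace \<tau>, {a}, a, a, a)" using top openin_topspace[of \<tau>] by simp
    then show "\<exists>s. ?P 0 s" by blast
    fix s n assume s: "?P n s"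
    obtain Q X x y y' where seq: "s = (Q, X, x, y, y')" by (cases s) auto
    have s: "openin \<tau> Q" "Q \<noteq> {}" "finite X" "X \<subseteq> carrier S" using s unfolding seq by auto
    have "\<exists>y\<in>carrier S. \<exists>y'\<in>carrier S. \<exists>z\<in>Q.
        (\<forall>x\<in>X. cmod (f (x \<otimes> y) - f (x \<otimes> y')) < inverse (real (Suc n))) \<and>
        \<epsilon>/4 < cmod (f (z \<otimes> y) - f (z \<otimes> y'))"
      by (rule oscillation_step[OF f top cont osc \<open>\<epsilon> > 0\<close> s]) simp_all
    then obtain y1 y1' z where
      y1: "y1 \<in> carrier S" "y1' \<in> carrier S" "z \<in> Q"
        "\<forall>x\<in>X. cmod (f (x \<otimes> y1) - f (x \<otimes> y1')) < inverse (real (Suc n))"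
        "\<epsilon>/4 < cmod (f (z \<otimes> y1) - f (z \<otimes> y1'))" by (elim bexE conjE) (rule that)
    define Q1 where "Q1 = Q \<inter> {w \<in> topspace \<tau>. f (w \<otimes> y1) - f (w \<otimes> y1') \<in> {c. \<epsilon>/4 < cmod c}}"
    have "continuous_map \<tau> euclidean (\<lambda>w. f (w \<otimes> y1) - f (w \<otimes> y1'))"
      by (intro continuous_map_diff cont y1)
    then have "openin \<tau> {w \<in> topspace \<tau>. f (w \<otimes> y1) - f (w \<otimes> y1') \<in> {c. \<epsilon>/4 < cmod c}}"
      by (rule openin_continuous_map_preimage) (auto intro!: open_Collect_less continuous_intros)
    then have "openin \<tau> Q1" unfolding Q1_def using s(1) by blast
    moreover have zQ: "z \<in> Q1" "z \<in> carrier S" using y1(3,5) openin_subset[OF s(1)] top unfolding Q1_def by auto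
    ultimately have PP: "?P (Suc n) (Q1, insert z X, z, y1, y1')" using s y1 by simp
    have RR: "?R n s (Q1, insert z X, z, y1, y1')" unfolding seq using y1(4) by (auto simp: Q1_def)
    show "\<exists>s'. ?P (Suc n) s' \<and> ?R n s s'"
      by (rule exI[of _ "(Q1, insert z X, z, y1, y1')"], rule conjI, rule PP, rule RR)
  qed
  then obtain s where s': "\<forall>n. ?P n (s n) \<and> ?R n (s n) (s (Suc n))" by (elim exE) (rule that)
  note s = conjunct1[OF spec[OF s']] conjunct2[OF spec[OF s']]
  define Q where "Q n = fst (s n)" for n
  define X where "X n = fst (snd (s n))" for n
  define x where "x n = fst (snd (snd (s n)))" for n
  define y where "y n = fst (snd (snd (snd (s n))))" for n
  define y' where "y' n = snd (snd (snd (snd (s n))))" for n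
  have s_eq: "s n = (Q n, X n, x n, y n, y' n)" for n
    unfolding Q_def X_def x_def y_def y'_def by simp
  have P: "X n \<subseteq> carrier S" "x n \<in> Q n" "x n \<in> X n" "y n \<in> carrier S" "y' n \<in> carrier S" for n
    using s(1)[of n] unfolding s_eq by auto
  have R: "Q (Suc n) \<subseteq> Q n" "X n \<subseteq> X (Suc n)"
    "\<And>w. w \<in> X n \<Longrightarrow> cmod (f (w \<otimes> y (Suc n)) - f (w \<otimes> y' (Suc n))) < inverse (real (Suc n))"
    "\<And>w. w \<in> Q (Suc n) \<Longrightarrow> \<epsilon>/4 < cmod (f (w \<otimes> y (Suc n)) - f (w \<otimes> y' (Suc n)))" for n
    using s(2)[of n] unfolding s_eq by auto
  have Qmono: "i \<ge> n \<Longrightarrow> Q i \<subseteq> Q n" for i n using lift_Suc_antimono_le[of Q] R(1) by blast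
  have Xmono: "n \<ge> i \<Longrightarrow> X i \<subseteq> X n" for i n using lift_Suc_mono_le[of X] R(2) by blast
  have "\<epsilon>/4 \<le> 0"
  proof (rule WAP_double_limit[OF f, of x "\<lambda>n. y (Suc n)" "\<lambda>n. y' (Suc n)"])
    show "x i \<in> carrier S" for i using P by blast
    fix i
    show "(\<lambda>n. f (x i \<otimes> y (Suc n)) - f (x i \<otimes> y' (Suc n))) \<longlonglongrightarrow> 0"
    proof (rule Lim_null_comparison[OF _ LIMSEQ_inverse_real_of_nat])
      show "\<forall>\<^sub>F n in sequentially. cmod (f (x i \<otimes> y (Suc n)) - f (x i \<otimes> y' (Suc n))) \<le> inverse (real (Suc n))"
        using eventually_ge_at_top[of i]
      proof (eventually_elim)
        case (elim n)
        then have "x i \<in> X n" using P(3) Xmono by blast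
        then show ?case by (rule less_imp_le[OF R(3)])
      qed
    qed
  next
    fix n
    have "\<epsilon>/4 \<le> cmod (f (x i \<otimes> y (Suc n)) - f (x i \<otimes> y' (Suc n)))" if "i \<ge> Suc n" for i
      using R(4)[of "x i" n] P(2) Qmono[OF that] by (meson less_imp_le subsetD)
    then show "\<exists>N. \<forall>i\<ge>N. \<epsilon>/4 \<le> cmod (f (x i \<otimes> y (Suc n)) - f (x i \<otimes> y' (Suc n)))" by blast
  qed (use P in auto)
  then show False using \<open>\<epsilon> > 0\<close> by simp
qed

text \<open>The open set \<open>Q\<close> of small oscillation is moved to the identity: for \<open>s \<in> Q\<close> one compares \<open>f (z s t')\<close> and \<open>f (s t')\<close> with
  \<open>t' = s\<inverse> t\<close>.\<close>

lemma WAP_norm_continuous: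
  assumes "group S" and f: "f \<in> WAP S T" and top: "topspace \<tau> = carrier S"
    and right: "\<And>a. a \<in> carrier S \<Longrightarrow> continuous_map \<tau> \<tau> (\<lambda>x. x \<otimes> a)"
    and cont: "\<And>t. t \<in> carrier S \<Longrightarrow> continuous_map \<tau> euclidean (\<lambda>x. f (x \<otimes> t))" and "\<epsilon> > 0"
  shows "\<exists>N. openin \<tau> N \<and> \<one> \<in> N \<and> (\<forall>z\<in>N. \<forall>t\<in>carrier S. cmod (f (z \<otimes> t) - f t) \<le> \<epsilon>)"
proof -
  interpret group S by fact
  obtain Q where Q: "openin \<tau> Q" "Q \<noteq> {}"
    "\<And>x x' t. \<lbrakk>x \<in> Q; x' \<in> Q; t \<in> carrier S\<rbrakk> \<Longrightarrow> cmod (f (x \<otimes> t) - f (x' \<otimes> t)) \<le> \<epsilon>"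
    using WAP_small_oscillation[OF f top cont \<open>\<epsilon> > 0\<close>] by blast
  obtain s where s: "s \<in> Q" "s \<in> carrier S" using Q(1,2) openin_subset top by blast
  let ?N = "{z \<in> topspace \<tau>. z \<otimes> s \<in> Q}"
  have "openin \<tau> ?N" by (rule openin_continuous_map_preimage[OF right[OF s(2)] Q(1)])
  moreover have "\<one> \<in> ?N" using s top by simp
  moreover have "cmod (f (z \<otimes> t) - f t) \<le> \<epsilon>" if z: "z \<in> ?N" and t: "t \<in> carrier S" for z t
  proof -
    have zC: "z \<in> carrier S" "z \<otimes> s \<in> Q" using z top by auto
    have "(z \<otimes> s) \<otimes> (inv s \<otimes> t) = z \<otimes> t" "s \<otimes> (inv s \<otimes> t) = t"
      using zC s t by (simp_all add: m_assoc inv_solve_left')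
       (metis inv_closed l_one m_assoc r_inv)+
    then show ?thesis using Q(3)[OF zC(2) s(1), of "inv s \<otimes> t"] s t by simp
  qed
  ultimately show ?thesis by blast
qed

text \<open>Joint continuity of multiplication and continuity of inversion both come from norm continuity
  of orbits: the estimate \<open>|f (z t) - f t| \<le> \<epsilon>\<close> is uniform in \<open>t\<close>.\<close>

lemma WAP_initial_topology_topological_group:
  assumes grp: "group S" and A: "A \<subseteq> WAP S T"
    and left: "\<And>f s. \<lbrakk>f \<in> A; s \<in> carrier S\<rbrakk> \<Longrightarrow> translate S f s \<in> A"
    and right: "\<And>f s. \<lbrakk>f \<in> A; s \<in> carrier S\<rbrakk> \<Longrightarrow> right_translate f s \<in> A"
  shows "topological_group S (initial_topology (carrier S) euclidean A)"
    and "\<lbrakk>f \<in> A; \<epsilon> > 0\<rbrakk> \<Longrightarrow> \<exists>N. openin (initial_topology (carrier S) euclidean A) N \<and> \<one> \<in> N \<and>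
      (\<forall>z\<in>N. \<forall>t\<in>carrier S. cmod (f (z \<otimes> t) - f t) \<le> \<epsilon>)"
proof -
  interpret group S by (rule grp)
  let ?\<tau> = "initial_topology (carrier S) euclidean A"
  have member: "continuous_map ?\<tau> euclidean f" if "f \<in> A" for f
    by (rule continuous_map_initial_topology_member) (use that in auto)
  have cont_right: "continuous_map ?\<tau> euclidean (\<lambda>x. f (x \<otimes> t))" if "f \<in> A" "t \<in> carrier S" for f t
    by (rule continuous_map_eq[OF member[OF right[OF that]]]) (simp add: right_translate_def)
  have cont_left: "continuous_map ?\<tau> euclidean (\<lambda>x. f (t \<otimes> x))" if "f \<in> A" "t \<in> carrier S" for f t
    by (rule continuous_map_eq[OF member[OF left[OF that]]]) (simp add: translate_def)
  have right_mult: "continuous_map ?\<tau> ?\<tau> (\<lambda>x. x \<otimes> a)" if "a \<in> carrier S" for a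
    by (rule continuous_map_into_initial_topology) (use that cont_right in auto)
  have left_mult: "continuous_map ?\<tau> ?\<tau> (\<lambda>x. a \<otimes> x)" if "a \<in> carrier S" for a
    by (rule continuous_map_into_initial_topology) (use that cont_left in auto)
  have unif: "\<exists>N. openin ?\<tau> N \<and> \<one> \<in> N \<and> (\<forall>z\<in>N. \<forall>t\<in>carrier S. cmod (f (z \<otimes> t) - f t) \<le> \<epsilon>)"
    if "f \<in> A" "\<epsilon> > 0" for f \<epsilon>
    by (rule WAP_norm_continuous[OF grp]) (use that A right_mult cont_right in auto)
  then show "\<lbrakk>f \<in> A; \<epsilon> > 0\<rbrakk> \<Longrightarrow> \<exists>N. openin ?\<tau> N \<and> \<one> \<in> N \<and>
      (\<forall>z\<in>N. \<forall>t\<in>carrier S. cmod (f (z \<otimes> t) - f t) \<le> \<epsilon>)" by blast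
  have "continuous_map (prod_topology ?\<tau> ?\<tau>) ?\<tau> (\<lambda>(x, y). x \<otimes> y)"
  proof (rule continuous_map_into_initial_topology)
    fix f assume f: "f \<in> A"
    show "continuous_map (prod_topology ?\<tau> ?\<tau>) euclidean (\<lambda>p. f (case p of (x, y) \<Rightarrow> x \<otimes> y))"
      unfolding continuous_map_metric_iff
    proof (intro ballI allI impI)
      fix p and \<epsilon> :: real assume "p \<in> topspace (prod_topology ?\<tau> ?\<tau>)" and \<epsilon>: "\<epsilon> > 0"
      then obtain x0 y0 where p: "p = (x0, y0)" "x0 \<in> carrier S" "y0 \<in> carrier S" by auto
      obtain N where N: "openin ?\<tau> N" "\<one> \<in> N" "\<And>z t. z \<in> N \<Longrightarrow> t \<in> carrier S \<Longrightarrow> cmod (f (z \<otimes> t) - f t) \<le> \<epsilon>/2"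
        using unif[OF f, of "\<epsilon>/2"] \<epsilon> by auto
      let ?U = "{x \<in> topspace ?\<tau>. x \<otimes> inv x0 \<in> N}"
      let ?V = "{y \<in> topspace ?\<tau>. dist (f (x0 \<otimes> y)) (f (x0 \<otimes> y0)) < \<epsilon>/2}"
      have "openin ?\<tau> ?U" by (rule openin_continuous_map_preimage[OF right_mult N(1)]) (use p in simp)
      moreover have "openin ?\<tau> ?V" by (rule continuous_map_metricD[OF cont_left[OF f p(2)]])
      ultimately have "openin (prod_topology ?\<tau> ?\<tau>) (?U \<times> ?V)" by (simp add: openin_prod_Times_iff)
      moreover have "p \<in> ?U \<times> ?V" using p N(2) \<epsilon> by simp
      moreover have "dist (f (case q of (x, y) \<Rightarrow> x \<otimes> y)) (f (case p of (x, y) \<Rightarrow> x \<otimes> y)) < \<epsilon>"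
        if q: "q \<in> ?U \<times> ?V" for q
      proof -
        obtain x y where xy: "q = (x, y)" "x \<in> carrier S" "y \<in> carrier S" "x \<otimes> inv x0 \<in> N"
          "dist (f (x0 \<otimes> y)) (f (x0 \<otimes> y0)) < \<epsilon>/2" using q by auto
        have "(x \<otimes> inv x0) \<otimes> (x0 \<otimes> y) = x \<otimes> (inv x0 \<otimes> x0) \<otimes> y"
          using xy(2,3) p(2) by (simp only: m_assoc m_closed inv_closed)
        then have "(x \<otimes> inv x0) \<otimes> (x0 \<otimes> y) = x \<otimes> y" using xy(2,3) p(2) by simp
        then have "dist (f (x \<otimes> y)) (f (x0 \<otimes> y)) \<le> \<epsilon>/2"
          using N(3)[OF xy(4), of "x0 \<otimes> y"] xy(3) p(2) by (simp add: dist_norm)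
        then have "dist (f (x \<otimes> y)) (f (x0 \<otimes> y0)) < \<epsilon>"
          using xy(5) dist_triangle[of "f (x \<otimes> y)" "f (x0 \<otimes> y0)" "f (x0 \<otimes> y)"] by linarith
        then show ?thesis by (simp add: xy(1) p(1))
      qed
      ultimately show "\<exists>U. openin (prod_topology ?\<tau> ?\<tau>) U \<and> p \<in> U \<and>
          (\<forall>q\<in>U. dist (f (case q of (x, y) \<Rightarrow> x \<otimes> y)) (f (case p of (x, y) \<Rightarrow> x \<otimes> y)) < \<epsilon>)" by blast
    qed
  qed auto
  moreover have "continuous_map ?\<tau> ?\<tau> (\<lambda>x. inv x)"
  proof (rule continuous_map_into_initial_topology)
    fix f assume f: "f \<in> A"
    show "continuous_map ?\<tau> euclidean (\<lambda>x. f (inv x))"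
      unfolding continuous_map_metric_iff
    proof (intro ballI allI impI)
      fix x0 and \<epsilon> :: real assume "x0 \<in> topspace ?\<tau>" and \<epsilon>: "\<epsilon> > 0"
      then have x0: "x0 \<in> carrier S" by simp
      obtain N where N: "openin ?\<tau> N" "\<one> \<in> N" "\<And>z t. z \<in> N \<Longrightarrow> t \<in> carrier S \<Longrightarrow> cmod (f (z \<otimes> t) - f t) \<le> \<epsilon>/2"
        using unif[OF f, of "\<epsilon>/2"] \<epsilon> by auto
      let ?U = "{x \<in> topspace ?\<tau>. inv x0 \<otimes> x \<in> N}"
      have "openin ?\<tau> ?U" by (rule openin_continuous_map_preimage[OF left_mult N(1)]) (use x0 in simp)
      moreover have "x0 \<in> ?U" using x0 N(2) by simp
      moreover have "dist (f (inv x)) (f (inv x0)) < \<epsilon>" if x: "x \<in> ?U" for x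
      proof -
        have xC: "x \<in> carrier S" "inv x0 \<otimes> x \<in> N" using x by auto
        have "inv x0 \<otimes> x \<otimes> inv x = inv x0" using xC x0 by (simp add: m_assoc)
        then show ?thesis
          using N(3)[OF xC(2), of "inv x"] xC(1) \<epsilon> by (simp add: dist_norm norm_minus_commute)
      qed
      ultimately show "\<exists>U. openin ?\<tau> U \<and> x0 \<in> U \<and> (\<forall>x\<in>U. dist (f (inv x)) (f (inv x0)) < \<epsilon>)" by blast
    qed
  qed auto
  ultimately show "topological_group S ?\<tau>" unfolding topological_group_def using grp by simp
qed

end

section \<open>The topology of a central idempotent\<close>

lemma topology_eq_if_continuous_id:
  assumes "topspace X = topspace Y" and "continuous_map X Y (\<lambda>x. x)" and "continuous_map Y X (\<lambda>x. x)"
  shows "X = Y"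
  unfolding topology_eq
proof (intro allI iffI)
  fix U assume U: "openin Y U"
  then have "U = {x \<in> topspace X. x \<in> U}" using openin_subset[OF U] assms(1) by auto
  then show "openin X U" using openin_continuous_map_preimage[OF assms(2) U] by simp
next
  fix U assume U: "openin X U"
  then have "U = {x \<in> topspace Y. x \<in> U}" using openin_subset[OF U] assms(1) by auto
  then show "openin Y U" using openin_continuous_map_preimage[OF assms(3) U] by simp
qed

locale central_idempotent = semitopological_semigroup + group S +
  fixes e :: "('a \<Rightarrow> complex) \<Rightarrow> complex"
  assumes central: "e \<in> central_idempotents (wap_compactification S T)"
begin

lemma e_point: "e \<in> wap_points S T"
  and e_idem: "comp_mult e e = e"
  and e_commute: "s \<in> wap_points S T \<Longrightarrow> comp_mult e s = comp_mult s e"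
  using central by (auto simp: central_idempotents_def wap_compactification_def)

lemma wap_act_one: "\<lbrakk>s \<in> wap_points S T; u \<in> WAP S T\<rbrakk> \<Longrightarrow> wap_act S T u s \<one> = s u"
proof -
  assume s: "s \<in> wap_points S T" and u: "u \<in> WAP S T"
  have "right_translate u \<one> = u"
    by (rule extensionalityI[of _ "carrier S"])
       (use function_spaceD(3)[OF WAP_space u] in \<open>auto simp: right_translate_def\<close>)
  then show ?thesis by (simp add: wap_act_eq[OF s u])
qed

text \<open>As \<open>e\<close> is idempotent, these are the functions \<open>f\<close> with \<open>f \<cdot> e = f\<close>.\<close>

definition fixed_functions :: "('a \<Rightarrow> complex) set" where
  "fixed_functions = (\<lambda>u. wap_act S T u e) ` WAP S T"

lemma act_e_WAP: "u \<in> WAP S T \<Longrightarrow> wap_act S T u e \<in> WAP S T"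
  by (rule wap_act_WAP[OF e_point])

lemma fixed_functions_WAP: "fixed_functions \<subseteq> WAP S T"
  unfolding fixed_functions_def using act_e_WAP by blast

lemma comp_mult_e_eval: "\<lbrakk>u \<in> WAP S T; s \<in> carrier S\<rbrakk> \<Longrightarrow> comp_mult e (wap_eval S T s) u = wap_act S T u e s"
  by (simp add: comp_mult_apply wap_eval_def act_e_WAP)

text \<open>This is where centrality enters: \<open>u \<cdot> e\<close> is defined by right translates of \<open>u\<close>, but may be
  computed from left translates.\<close>

lemma act_e_eq_translate:
  assumes u: "u \<in> WAP S T" and s: "s \<in> carrier S"
  shows "wap_act S T u e s = e (translate S u s)"
proof -
  have "wap_act S T u e s = comp_mult (wap_eval S T s) e u"
    using comp_mult_e_eval[OF u s] e_commute[OF wap_eval_points[OF s]] by simp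
  also have "\<dots> = e (translate S u s)" by (simp add: comp_mult_apply u wap_act_eval s)
  finally show ?thesis .
qed

lemma translate_act_e:
  assumes u: "u \<in> WAP S T" and s: "s \<in> carrier S"
  shows "translate S (wap_act S T u e) s = wap_act S T (translate S u s) e"
proof (rule extensionalityI[of _ "carrier S"])
  show "wap_act S T (translate S u s) e \<in> extensional (carrier S)"
    using wap_act_eq[OF e_point translate_WAP[OF u s]] by simp
  fix t assume t: "t \<in> carrier S"
  have "translate S u (s \<otimes> t) = translate S (translate S u s) t"
    unfolding translate_def using s t by (auto intro!: restrict_ext simp: mult_closed mult_assoc)
  then show "translate S (wap_act S T u e) s t = wap_act S T (translate S u s) e t"
    using t s u translate_WAP[OF u s] by (simp add: act_e_eq_translate translate_def[of S "wap_act S T u e"])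
qed (simp add: translate_def)

lemma right_translate_act_e:
  assumes u: "u \<in> WAP S T" and s: "s \<in> carrier S"
  shows "right_translate (wap_act S T u e) s = wap_act S T (right_translate u s) e"
proof (rule extensionalityI[of _ "carrier S"])
  show "wap_act S T (right_translate u s) e \<in> extensional (carrier S)"
    using wap_act_eq[OF e_point right_translate_WAP[OF u s]] by simp
  fix t assume t: "t \<in> carrier S"
  have "right_translate u (t \<otimes> s) = right_translate (right_translate u s) t"
    unfolding right_translate_def using s t by (auto intro!: restrict_ext simp: mult_closed mult_assoc)
  then show "right_translate (wap_act S T u e) s t = wap_act S T (right_translate u s) e t"
    using t s by (simp add: wap_act_eq[OF e_point u] wap_act_eq[OF e_point right_translate_WAP[OF u s]]
        right_translate_def[of "\<lambda>t\<in>carrier S. e (right_translate u t)"])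
qed (simp add: right_translate_def)

abbreviation "\<tau>e \<equiv> initial_topology (carrier S) euclidean fixed_functions"

text \<open>The value of the product of \<open>e\<close> and the evaluation at \<open>s\<close> on \<open>u\<close> is \<open>(u \<cdot> e) (s)\<close>, so both families of maps
  generate the same topology.\<close>

lemma idempotent_topology_eq: "idempotent_topology S T e = \<tau>e"
proof -
  let ?g = "\<lambda>s. comp_mult e (wap_eval S T s)"
  let ?I = "initial_topology (carrier S) (wap_topology S T) {?g}"
  have g: "?g s \<in> wap_points S T" if "s \<in> carrier S" for s
    by (rule comp_mult_closed[OF e_point wap_eval_points[OF that]])
  have gu: "continuous_map Z euclidean (\<lambda>z. ?g z u) \<longleftrightarrow> continuous_map Z euclidean (wap_act S T u e)"
    if "u \<in> WAP S T" "topspace Z = carrier S" for Z u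
  proof
    assume "continuous_map Z euclidean (\<lambda>z. ?g z u)"
    then show "continuous_map Z euclidean (wap_act S T u e)"
      by (rule continuous_map_eq) (use that comp_mult_e_eval in simp)
  next
    assume "continuous_map Z euclidean (wap_act S T u e)"
    then show "continuous_map Z euclidean (\<lambda>z. ?g z u)"
      by (rule continuous_map_eq) (use that comp_mult_e_eval in simp)
  qed
  have "continuous_map \<tau>e ?I (\<lambda>x. x)"
  proof (rule continuous_map_into_initial_topology)
    fix f assume "f \<in> {?g}"
    then have f: "f = ?g" by simp
    show "continuous_map \<tau>e (wap_topology S T) (\<lambda>x. f x)"
      unfolding f
    proof (rule continuous_map_into_wap_topology)
      fix u assume u: "u \<in> WAP S T"
      have "continuous_map \<tau>e euclidean (wap_act S T u e)"
        by (rule continuous_map_initial_topology_member) (use u in \<open>auto simp: fixed_functions_def\<close>)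
      then show "continuous_map \<tau>e euclidean (\<lambda>z. ?g z u)" by (subst gu[OF u]) auto
    qed (use g in auto)
  qed auto
  moreover have "continuous_map ?I \<tau>e (\<lambda>x. x)"
  proof (rule continuous_map_into_initial_topology)
    fix f assume "f \<in> fixed_functions"
    then obtain u where u: "u \<in> WAP S T" "f = wap_act S T u e" unfolding fixed_functions_def by blast
    have "continuous_map ?I (wap_topology S T) ?g"
      by (rule continuous_map_initial_topology_member) (use g in auto)
    from continuous_map_compose[OF this continuous_map_wap_topology_eval[OF u(1)]]
    have "continuous_map ?I euclidean (\<lambda>z. ?g z u)" by (simp add: o_def)
    then show "continuous_map ?I euclidean (\<lambda>x. f x)" using gu[OF u(1), of ?I] u(2) by simp
  qed auto
  ultimately have "?I = \<tau>e" by (intro topology_eq_if_continuous_id) auto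
  then show ?thesis unfolding idempotent_topology_def .
qed

lemma \<tau>e_topological_group: "topological_group S \<tau>e"
  and \<tau>e_uniform: "\<lbrakk>f \<in> fixed_functions; \<epsilon> > 0\<rbrakk> \<Longrightarrow> \<exists>N. openin \<tau>e N \<and> \<one> \<in> N \<and>
      (\<forall>z\<in>N. \<forall>t\<in>carrier S. cmod (f (z \<otimes> t) - f t) \<le> \<epsilon>)"
proof -
  have left: "translate S f s \<in> fixed_functions" if "f \<in> fixed_functions" "s \<in> carrier S" for f s
    using that translate_act_e translate_WAP unfolding fixed_functions_def by auto
  have right: "right_translate f s \<in> fixed_functions" if "f \<in> fixed_functions" "s \<in> carrier S" for f s
    using that right_translate_act_e right_translate_WAP unfolding fixed_functions_def by auto
  note * = WAP_initial_topology_topological_group[OF is_group fixed_functions_WAP left right]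
  show "topological_group S \<tau>e" by (rule *(1))
  show "\<lbrakk>f \<in> fixed_functions; \<epsilon> > 0\<rbrakk> \<Longrightarrow> \<exists>N. openin \<tau>e N \<and> \<one> \<in> N \<and>
      (\<forall>z\<in>N. \<forall>t\<in>carrier S. cmod (f (z \<otimes> t) - f t) \<le> \<epsilon>)" by (rule *(2))
qed

lemma \<tau>e_coarser: "openin \<tau>e U \<Longrightarrow> openin T U"
proof -
  have "continuous_map T \<tau>e (\<lambda>x. x)"
    by (rule continuous_map_into_initial_topology)
       (use fixed_functions_WAP topspace_eq in \<open>auto simp: WAP_def bounded_cont_def\<close>)
  moreover assume "openin \<tau>e U"
  ultimately have "openin T {x \<in> topspace T. x \<in> U}" by (rule openin_continuous_map_preimage)
  moreover have "U \<subseteq> topspace T" using openin_subset[OF \<open>openin \<tau>e U\<close>] topspace_eq by simp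
  then have "{x \<in> topspace T. x \<in> U} = U" by blast
  ultimately show ?thesis by simp
qed

text \<open>A filter that converges to \<open>e\<close> in the compactification converges to the identity for \<open>\<tau>e\<close>, because
  \<open>e\<close> is idempotent: \<open>(u \<cdot> e) (x) \<longlongrightarrow> e (u \<cdot> e) = e u = (u \<cdot> e) (1)\<close>.\<close>

lemma filter_to_e:
  obtains F where "F \<noteq> bot" "F \<le> principal (carrier S)"
    "\<And>u. u \<in> WAP S T \<Longrightarrow> (u \<longlongrightarrow> e u) F"
    "\<And>U. openin \<tau>e U \<Longrightarrow> \<one> \<in> U \<Longrightarrow> eventually (\<lambda>x. x \<in> U) F"
proof -
  obtain F where F: "F \<noteq> bot" "F \<le> principal (carrier S)" "limitin (wap_topology S T) (wap_eval S T) e F"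
    using wap_points_filter[OF e_point] by blast
  have "eventually (\<lambda>x. x \<in> U) F" if U: "openin \<tau>e U" "\<one> \<in> U" for U
  proof -
    obtain D \<delta> where D: "finite D" "D \<subseteq> fixed_functions" "\<delta> > 0"
      "{x \<in> carrier S. \<forall>f\<in>D. dist (f x) (f \<one>) < \<delta>} \<subseteq> U"
      using openin_initial_topology_metricD[OF U] by blast
    have "eventually (\<lambda>x. dist (f x) (f \<one>) < \<delta>) F" if f: "f \<in> D" for f
    proof -
      obtain u where u: "u \<in> WAP S T" "f = wap_act S T u e" using f D(2) unfolding fixed_functions_def by blast
      have "(f \<longlongrightarrow> e f) F" using limitin_wap_topologyD[OF F(3)] act_e_WAP[OF u(1)] u(2) by simp
      moreover have "e f = f \<one>"
        using fun_cong[OF e_idem, of u] by (simp add: u comp_mult_apply wap_act_one[OF e_point])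
      ultimately show ?thesis using tendstoD D(3) by metis
    qed
    then have "eventually (\<lambda>x. \<forall>f\<in>D. dist (f x) (f \<one>) < \<delta>) F"
      using D(1) by (simp add: eventually_ball_finite)
    moreover have "eventually (\<lambda>x. x \<in> carrier S) F" using F(2) by (simp add: le_principal)
    ultimately show ?thesis by eventually_elim (use D(4) in blast)
  qed
  then show thesis using that F limitin_wap_topologyD[OF F(3)] by blast
qed

end

section \<open>The completion of a topological group\<close>

locale topological_group_structure = group H for H :: "('a, 'm) monoid_scheme" (structure) +
  fixes \<sigma> :: "'a topology"
  assumes topological: "topological_group H \<sigma>"
begin

lemma topspace_eq: "topspace \<sigma> = carrier H"
  and continuous_mult: "continuous_map (prod_topology \<sigma> \<sigma>) \<sigma> (\<lambda>(x, y). x \<otimes> y)"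
  and continuous_inv: "continuous_map \<sigma> \<sigma> (\<lambda>x. inv x)"
  using topological by (auto simp: topological_group_def)

lemma continuous_mult_left: "a \<in> carrier H \<Longrightarrow> continuous_map \<sigma> \<sigma> (\<lambda>x. a \<otimes> x)"
  using continuous_map_compose[OF _ continuous_mult, of \<sigma> "\<lambda>x. (a, x)"]
  by (simp add: o_def continuous_map_pairwise topspace_eq)

lemma continuous_mult_right: "a \<in> carrier H \<Longrightarrow> continuous_map \<sigma> \<sigma> (\<lambda>x. x \<otimes> a)"
  using continuous_map_compose[OF _ continuous_mult, of \<sigma> "\<lambda>x. (x, a)"]
  by (simp add: o_def continuous_map_pairwise topspace_eq)

lemma semitopological: "semitopological_semigroup H \<sigma>"
  by unfold_locales (auto simp: topspace_eq m_assoc continuous_mult_left continuous_mult_right)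

definition nbhd :: "'a set \<Rightarrow> bool" where
  "nbhd V \<longleftrightarrow> openin \<sigma> V \<and> \<one> \<in> V"

lemma nbhd_Int: "nbhd U \<Longrightarrow> nbhd V \<Longrightarrow> nbhd (U \<inter> V)"
  by (auto simp: nbhd_def)

lemma nbhd_carrier: "nbhd V \<Longrightarrow> V \<subseteq> carrier H"
  unfolding nbhd_def using openin_subset topspace_eq by blast

lemma nbhd_preimage:
  assumes "continuous_map \<sigma> \<sigma> f" and "openin \<sigma> V" and "f \<one> \<in> V"
  shows "nbhd {x \<in> carrier H. f x \<in> V}"
  using openin_continuous_map_preimage[OF assms(1,2)] assms(3) by (simp add: nbhd_def topspace_eq)

lemma open_mult:
  assumes U: "openin \<sigma> U" and xy: "x \<in> carrier H" "y \<in> carrier H" "x \<otimes> y \<in> U"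
  shows "\<exists>A B. openin \<sigma> A \<and> openin \<sigma> B \<and> x \<in> A \<and> y \<in> B \<and> (\<forall>a\<in>A. \<forall>b\<in>B. a \<otimes> b \<in> U)"
proof -
  let ?p = "{p \<in> topspace (prod_topology \<sigma> \<sigma>). (case p of (x, y) \<Rightarrow> x \<otimes> y) \<in> U}"
  have op: "openin (prod_topology \<sigma> \<sigma>) ?p" by (rule openin_continuous_map_preimage[OF continuous_mult U])
  have mem: "(x, y) \<in> ?p" using xy by (simp add: topspace_eq)
  obtain A B where AB: "openin \<sigma> A" "openin \<sigma> B" "x \<in> A" "y \<in> B" "A \<times> B \<subseteq> ?p"
    using op[unfolded openin_prod_topology_alt, THEN spec, THEN spec, THEN mp, OF mem]
    by (elim exE conjE) (rule that)
  have "a \<otimes> b \<in> U" if "a \<in> A" "b \<in> B" for a b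
    using subsetD[OF AB(5), of "(a, b)"] that by auto
  then show ?thesis using AB(1-4) by blast
qed

lemma nbhd_mult:
  assumes "nbhd V"
  shows "\<exists>W. nbhd W \<and> (\<forall>x\<in>W. \<forall>y\<in>W. x \<otimes> y \<in> V)"
proof -
  obtain A B where AB: "openin \<sigma> A" "openin \<sigma> B" "\<one> \<in> A" "\<one> \<in> B" "\<forall>a\<in>A. \<forall>b\<in>B. a \<otimes> b \<in> V"
    using open_mult[of V \<one> \<one>] assms by (auto simp: nbhd_def)
  then have "nbhd (A \<inter> B)" "\<forall>x\<in>A \<inter> B. \<forall>y\<in>A \<inter> B. x \<otimes> y \<in> V" by (auto simp: nbhd_def)
  then show ?thesis by blast
qed

lemma nbhd_refine:
  assumes "nbhd V"
  shows "\<exists>W. nbhd W \<and> W \<subseteq> V \<and> (\<forall>x\<in>W. inv x \<in> W) \<and> (\<forall>x\<in>W. \<forall>y\<in>W. x \<otimes> y \<in> V)"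
proof -
  obtain U where U: "nbhd U" "\<forall>x\<in>U. \<forall>y\<in>U. x \<otimes> y \<in> V" using nbhd_mult[OF assms] by blast
  define W where "W = U \<inter> {x \<in> carrier H. inv x \<in> U}"
  have "nbhd W" unfolding W_def
    by (intro nbhd_Int U(1) nbhd_preimage[OF continuous_inv]) (use U(1) in \<open>auto simp: nbhd_def\<close>)
  moreover have "W \<subseteq> V"
  proof
    fix x assume "x \<in> W"
    then have "x \<in> U" "x \<in> carrier H" unfolding W_def by auto
    then have "x \<otimes> \<one> \<in> V" using U unfolding nbhd_def by blast
    then show "x \<in> V" using \<open>x \<in> carrier H\<close> by simp
  qed
  moreover have "\<forall>x\<in>W. inv x \<in> W" unfolding W_def using nbhd_carrier[OF U(1)] by auto
  moreover have "\<forall>x\<in>W. \<forall>y\<in>W. x \<otimes> y \<in> V" using U(2) unfolding W_def by blast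
  ultimately show ?thesis by blast
qed

lemma nbhd_conjugate:
  assumes "nbhd V" and a: "a \<in> carrier H"
  shows "nbhd {x \<in> carrier H. a \<otimes> x \<otimes> inv a \<in> V}"
proof (rule nbhd_preimage)
  show "continuous_map \<sigma> \<sigma> (\<lambda>x. a \<otimes> x \<otimes> inv a)"
    using continuous_map_compose[OF continuous_mult_left[OF a] continuous_mult_right[of "inv a"]] a
    by (simp add: o_def)
qed (use assms in \<open>auto simp: nbhd_def\<close>)

subsection \<open>Entourages\<close>

definition ent :: "'a set \<Rightarrow> ('a \<times> 'a) set" where
  "ent V = {(x, y) \<in> carrier H \<times> carrier H. inv x \<otimes> y \<in> V \<and> y \<otimes> inv x \<in> V}"

lemma entI: "\<lbrakk>x \<in> carrier H; y \<in> carrier H; inv x \<otimes> y \<in> V; y \<otimes> inv x \<in> V\<rbrakk> \<Longrightarrow> (x, y) \<in> ent V"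
  by (simp add: ent_def)

lemma entD: "(x, y) \<in> ent V \<Longrightarrow> x \<in> carrier H \<and> y \<in> carrier H \<and> inv x \<otimes> y \<in> V \<and> y \<otimes> inv x \<in> V"
  by (simp add: ent_def)

lemma ent_mono: "V \<subseteq> W \<Longrightarrow> ent V \<subseteq> ent W"
  by (auto simp: ent_def)

lemma eventually_uniformity:
  "eventually P (two_sided_uniformity H \<sigma>) \<longleftrightarrow> (\<exists>V. nbhd V \<and> (\<forall>p\<in>ent V. P p))"
proof -
  have eq: "two_sided_uniformity H \<sigma> = (INF V \<in> {V. openin \<sigma> V \<and> \<one> \<in> V}. principal (ent V))"
    unfolding two_sided_uniformity_def ent_def ..
  have "eventually P (two_sided_uniformity H \<sigma>) \<longleftrightarrow>
      (\<exists>V\<in>{V. openin \<sigma> V \<and> \<one> \<in> V}. eventually P (principal (ent V)))"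
    unfolding eq
  proof (rule eventually_INF_base)
    show "{V. openin \<sigma> V \<and> \<one> \<in> V} \<noteq> {}" using openin_topspace[of \<sigma>] topspace_eq by auto
    fix A B assume "A \<in> {V. openin \<sigma> V \<and> \<one> \<in> V}" "B \<in> {V. openin \<sigma> V \<and> \<one> \<in> V}"
    then show "\<exists>C\<in>{V. openin \<sigma> V \<and> \<one> \<in> V}. principal (ent C) \<le> inf (principal (ent A)) (principal (ent B))"
      by (intro bexI[of _ "A \<inter> B"]) (auto simp: ent_def)
  qed
  then show ?thesis by (auto simp: nbhd_def eventually_principal)
qed

lemma ent_refine:
  assumes "nbhd V"
  shows "\<exists>W. nbhd W \<and> W \<subseteq> V \<and> (\<forall>x y. (x, y) \<in> ent W \<longrightarrow> (y, x) \<in> ent W) \<and>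
    (\<forall>x y z. (x, y) \<in> ent W \<longrightarrow> (y, z) \<in> ent W \<longrightarrow> (x, z) \<in> ent V)"
proof -
  obtain W where W: "nbhd W" "W \<subseteq> V" "\<forall>x\<in>W. inv x \<in> W" "\<forall>x\<in>W. \<forall>y\<in>W. x \<otimes> y \<in> V"
    using nbhd_refine[OF assms] by blast
  have "(y, x) \<in> ent W" if "(x, y) \<in> ent W" for x y
  proof -
    have xy: "x \<in> carrier H" "y \<in> carrier H" "inv x \<otimes> y \<in> W" "y \<otimes> inv x \<in> W" using entD[OF that] by auto
    have "inv (inv x \<otimes> y) = inv y \<otimes> x" "inv (y \<otimes> inv x) = x \<otimes> inv y"
      using xy(1,2) by (simp_all add: inv_mult_group)
    then show ?thesis using W(3) xy by (intro entI) (metis, metis, metis, metis)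
  qed
  moreover have "(x, z) \<in> ent V" if 1: "(x, y) \<in> ent W" and 2: "(y, z) \<in> ent W" for x y z
  proof -
    note xy = entD[OF 1] and yz = entD[OF 2]
    have "(inv x \<otimes> y) \<otimes> (inv y \<otimes> z) = inv x \<otimes> (y \<otimes> inv y) \<otimes> z"
      "(z \<otimes> inv y) \<otimes> (y \<otimes> inv x) = z \<otimes> (inv y \<otimes> y) \<otimes> inv x"
      using xy yz by (simp_all only: m_assoc m_closed inv_closed)
    then have "(inv x \<otimes> y) \<otimes> (inv y \<otimes> z) = inv x \<otimes> z" "(z \<otimes> inv y) \<otimes> (y \<otimes> inv x) = z \<otimes> inv x"
      using xy yz by simp_all
    then show ?thesis using W(4) xy yz by (intro entI) (metis, metis, metis, metis)
  qed
  ultimately show ?thesis using W(1,2) by blast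
qed

lemma ent_open_section:
  assumes V: "nbhd V" and x: "x \<in> carrier H"
  shows "openin \<sigma> {y. (x, y) \<in> ent V}" "(x, x) \<in> ent V"
proof -
  have "openin \<sigma> V" using V by (simp add: nbhd_def)
  have "{y. (x, y) \<in> ent V} = {y \<in> topspace \<sigma>. inv x \<otimes> y \<in> V} \<inter> {y \<in> topspace \<sigma>. y \<otimes> inv x \<in> V}"
    using x by (auto simp: ent_def topspace_eq)
  moreover have "openin \<sigma> {y \<in> topspace \<sigma>. inv x \<otimes> y \<in> V}" "openin \<sigma> {y \<in> topspace \<sigma>. y \<otimes> inv x \<in> V}"
    by (intro openin_continuous_map_preimage[OF continuous_mult_left \<open>openin \<sigma> V\<close>]
          openin_continuous_map_preimage[OF continuous_mult_right \<open>openin \<sigma> V\<close>], use x in simp)+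
  ultimately show "openin \<sigma> {y. (x, y) \<in> ent V}" by auto
  show "(x, x) \<in> ent V" using V x by (intro entI) (auto simp: nbhd_def)
qed

subsection \<open>Cauchy filters and their minimal Cauchy filters\<close>

abbreviation cauchy :: "'a filter \<Rightarrow> bool" where "cauchy \<equiv> cauchy_filter_on H \<sigma>"

definition near :: "'a set \<Rightarrow> 'a filter \<Rightarrow> 'a filter \<Rightarrow> bool" where
  "near V F F' \<longleftrightarrow> eventually (\<lambda>p. p \<in> ent V) (F \<times>\<^sub>F F')"

lemma cauchyD:
  assumes "cauchy F"
  shows "F \<noteq> bot" "eventually (\<lambda>x. x \<in> carrier H) F" "nbhd V \<Longrightarrow> near V F F"
proof -
  have *: "F \<noteq> bot" "F \<le> principal (carrier H)" "F \<times>\<^sub>F F \<le> two_sided_uniformity H \<sigma>"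
    using assms by (auto simp: cauchy_filter_on_def)
  show "F \<noteq> bot" "eventually (\<lambda>x. x \<in> carrier H) F" using *(1,2) by (simp_all add: le_principal)
  assume "nbhd V"
  then have "eventually (\<lambda>p. p \<in> ent V) (two_sided_uniformity H \<sigma>)" unfolding eventually_uniformity by blast
  then show "near V F F" unfolding near_def by (rule filter_leD[OF *(3)])
qed

lemma cauchyI:
  assumes "F \<noteq> bot" and "eventually (\<lambda>x. x \<in> carrier H) F" and "\<And>V. nbhd V \<Longrightarrow> near V F F"
  shows "cauchy F"
  unfolding cauchy_filter_on_def
proof (intro conjI)
  show "F \<times>\<^sub>F F \<le> two_sided_uniformity H \<sigma>"
  proof (rule filter_leI)
    fix P assume "eventually P (two_sided_uniformity H \<sigma>)"
    then obtain V where V: "nbhd V" "\<forall>p\<in>ent V. P p" unfolding eventually_uniformity by blast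
    have "eventually (\<lambda>p. p \<in> ent V) (F \<times>\<^sub>F F)" using assms(3)[OF V(1)] unfolding near_def .
    then show "eventually P (F \<times>\<^sub>F F)" by (rule eventually_mono) (use V(2) in blast)
  qed
qed (use assms in \<open>auto simp: le_principal\<close>)

lemma nearD:
  "near V F F' \<Longrightarrow> \<exists>P Q. eventually P F \<and> eventually Q F' \<and> (\<forall>x y. P x \<longrightarrow> Q y \<longrightarrow> (x, y) \<in> ent V)"
  unfolding near_def eventually_prod_filter .

lemma cauchy_small_set:
  assumes "cauchy F" and "nbhd V"
  obtains A where "eventually (\<lambda>x. x \<in> A) F" "\<And>x y. x \<in> A \<Longrightarrow> y \<in> A \<Longrightarrow> (x, y) \<in> ent V"
proof -
  obtain P Q where PQ: "eventually P F" "eventually Q F"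
    "\<And>x y. P x \<Longrightarrow> Q y \<Longrightarrow> (x, y) \<in> ent V" using nearD[OF cauchyD(3)[OF assms]] by blast
  have "eventually (\<lambda>x. x \<in> {x. P x \<and> Q x}) F" using PQ(1,2) by (simp add: eventually_conj)
  then show thesis by (rule that) (use PQ(3) in auto)
qed

text \<open>A small set of a Cauchy filter meets the sets of every finer proper filter. Passing through a common point of
  each pair costs two further entourages.\<close>

lemma near_coarser:
  assumes V: "nbhd V"
  shows "\<exists>W. nbhd W \<and> (\<forall>F F' P P'. F \<noteq> bot \<longrightarrow> F' \<noteq> bot \<longrightarrow> F \<le> P \<longrightarrow> F' \<le> P' \<longrightarrow> cauchy P \<longrightarrow> cauchy P' \<longrightarrow>
    near W F F' \<longrightarrow> near V P P')"
proof -
  obtain V1 where V1: "nbhd V1" "V1 \<subseteq> V"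
    "\<And>x y z. (x, y) \<in> ent V1 \<Longrightarrow> (y, z) \<in> ent V1 \<Longrightarrow> (x, z) \<in> ent V" using ent_refine[OF V] by blast
  obtain W where W: "nbhd W" "W \<subseteq> V1"
    "\<And>x y z. (x, y) \<in> ent W \<Longrightarrow> (y, z) \<in> ent W \<Longrightarrow> (x, z) \<in> ent V1" using ent_refine[OF V1(1)] by blast
  have "near V P P'"
    if *: "F \<noteq> bot" "F' \<noteq> bot" "F \<le> P" "F' \<le> P'" "cauchy P" "cauchy P'" "near W F F'" for F F' P P'
  proof -
    obtain A where A: "eventually (\<lambda>x. x \<in> A) P" "\<And>x y. x \<in> A \<Longrightarrow> y \<in> A \<Longrightarrow> (x, y) \<in> ent W"
      using cauchy_small_set[OF *(5) W(1)] by blast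
    obtain B where B: "eventually (\<lambda>x. x \<in> B) P'" "\<And>x y. x \<in> B \<Longrightarrow> y \<in> B \<Longrightarrow> (x, y) \<in> ent W"
      using cauchy_small_set[OF *(6) W(1)] by blast
    obtain p q where pq: "eventually p F" "eventually q F'" "\<And>x y. p x \<Longrightarrow> q y \<Longrightarrow> (x, y) \<in> ent W"
      using nearD[OF *(7)] by blast
    have "eventually (\<lambda>x. x \<in> A \<and> p x) F" using filter_leD[OF *(3) A(1)] pq(1) by (rule eventually_conj)
    then obtain a where a: "a \<in> A" "p a" using eventually_happens'[OF *(1)] by blast
    have "eventually (\<lambda>x. x \<in> B \<and> q x) F'" using filter_leD[OF *(4) B(1)] pq(2) by (rule eventually_conj)
    then obtain b where b: "b \<in> B" "q b" using eventually_happens'[OF *(2)] by blast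
    have "(x, y) \<in> ent V" if "x \<in> A" "y \<in> B" for x y
    proof -
      have "(x, b) \<in> ent V1" by (rule W(3)[OF A(2)[OF \<open>x \<in> A\<close> a(1)] pq(3)[OF a(2) b(2)]])
      moreover have "(b, y) \<in> ent V1" using B(2)[OF b(1) \<open>y \<in> B\<close>] ent_mono[OF W(2)] by blast
      ultimately show ?thesis by (rule V1(3))
    qed
    then show ?thesis unfolding near_def eventually_prod_filter using A(1) B(1) by blast
  qed
  then show ?thesis using W(1) by blast
qed

text \<open>Minimality refers to filters as families of sets, so that a minimal Cauchy filter is maximal for \<open>\<le>\<close>.\<close>

definition minimal_cauchy :: "'a filter \<Rightarrow> 'a filter" where
  "minimal_cauchy F = Sup {F'. cauchy F' \<and> F \<le> F'}"

text \<open>The supremum is again a Cauchy filter: for a small set \<open>A\<close> of \<open>F\<close>, the entourage neighbourhood of \<open>A\<close> is small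
  and belongs to all Cauchy filters that are coarser than \<open>F\<close>.\<close>

lemma minimal_cauchy:
  assumes F: "cauchy F"
  shows "F \<le> minimal_cauchy F" and "cauchy (minimal_cauchy F)"
    and "minimal_cauchy F \<in> completion_points H \<sigma>"
    and "\<And>M. \<lbrakk>M \<in> completion_points H \<sigma>; F \<le> M\<rbrakk> \<Longrightarrow> M = minimal_cauchy F"
proof -
  have up: "F' \<le> minimal_cauchy F" if "cauchy F'" "F \<le> F'" for F'
    unfolding minimal_cauchy_def by (rule Sup_upper) (use that in simp)
  show F_le: "F \<le> minimal_cauchy F" by (rule up[OF F order_refl])
  show cauchy: "cauchy (minimal_cauchy F)"
  proof (rule cauchyI)
    show "minimal_cauchy F \<noteq> bot" using F_le cauchyD(1)[OF F] by (metis bot.extremum_uniqueI)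
    show "eventually (\<lambda>x. x \<in> carrier H) (minimal_cauchy F)"
      unfolding minimal_cauchy_def eventually_Sup using cauchyD(2) by blast
    fix V assume V: "nbhd V"
    obtain V1 where V1: "nbhd V1" "V1 \<subseteq> V"
      "\<And>x y z. (x, y) \<in> ent V1 \<Longrightarrow> (y, z) \<in> ent V1 \<Longrightarrow> (x, z) \<in> ent V" using ent_refine[OF V] by blast
    obtain W where W: "nbhd W" "W \<subseteq> V1" "\<And>x y. (x, y) \<in> ent W \<Longrightarrow> (y, x) \<in> ent W"
      "\<And>x y z. (x, y) \<in> ent W \<Longrightarrow> (y, z) \<in> ent W \<Longrightarrow> (x, z) \<in> ent V1" using ent_refine[OF V1(1)] by blast
    obtain A where A: "eventually (\<lambda>x. x \<in> A) F" "\<And>x y. x \<in> A \<Longrightarrow> y \<in> A \<Longrightarrow> (x, y) \<in> ent W"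
      using cauchy_small_set[OF F W(1)] by blast
    let ?B = "{y. \<exists>a\<in>A. (a, y) \<in> ent W}"
    have "eventually (\<lambda>y. y \<in> ?B) F'" if F': "cauchy F'" "F \<le> F'" for F'
    proof -
      obtain A' where A': "eventually (\<lambda>x. x \<in> A') F'" "\<And>x y. x \<in> A' \<Longrightarrow> y \<in> A' \<Longrightarrow> (x, y) \<in> ent W"
        using cauchy_small_set[OF F'(1) W(1)] by blast
      have "eventually (\<lambda>x. x \<in> A \<and> x \<in> A') F"
        using A(1) filter_leD[OF F'(2) A'(1)] by (rule eventually_conj)
      then obtain a where "a \<in> A" "a \<in> A'" using eventually_happens'[OF cauchyD(1)[OF F]] by blast
      then have "y \<in> ?B" if "y \<in> A'" for y using A'(2) that by blast
      then show ?thesis by (rule eventually_mono[OF A'(1)])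
    qed
    then have B: "eventually (\<lambda>y. y \<in> ?B) (minimal_cauchy F)"
      unfolding minimal_cauchy_def eventually_Sup by blast
    have "(x, y) \<in> ent V" if "x \<in> ?B" "y \<in> ?B" for x y
    proof -
      obtain a b where ab: "a \<in> A" "b \<in> A" "(a, x) \<in> ent W" "(b, y) \<in> ent W" using \<open>x \<in> ?B\<close> \<open>y \<in> ?B\<close> by blast
      have "(x, b) \<in> ent V1" by (rule W(4)[OF W(3)[OF ab(3)] A(2)[OF ab(1,2)]])
      moreover have "(b, y) \<in> ent V1" using ab(4) ent_mono[OF W(2)] by blast
      ultimately show ?thesis by (rule V1(3))
    qed
    then show "near V (minimal_cauchy F) (minimal_cauchy F)"
      unfolding near_def eventually_prod_filter using B by blast
  qed
  have max: "F' = minimal_cauchy F" if "cauchy F'" "minimal_cauchy F \<le> F'" for F'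
    using up[OF that(1) order_trans[OF F_le that(2)]] that(2) by (rule order_antisym)
  show "minimal_cauchy F \<in> completion_points H \<sigma>"
    unfolding completion_points_def using cauchy max by blast
  fix M assume M: "M \<in> completion_points H \<sigma>" "F \<le> M"
  then have *: "cauchy M" "\<And>F'. cauchy F' \<Longrightarrow> M \<le> F' \<Longrightarrow> F' = M" unfolding completion_points_def by auto
  show "M = minimal_cauchy F" by (rule *(2)[OF cauchy up[OF *(1) M(2)], symmetric])
qed

lemma completion_points_cauchy: "M \<in> completion_points H \<sigma> \<Longrightarrow> cauchy M"
  by (simp add: completion_points_def)

text \<open>In a coarser Cauchy filter every set also belongs to the neighbourhood filter and thus contains \<open>x\<close>. Its small sets
  are therefore contained in small neighbourhoods of \<open>x\<close>.\<close>

lemma nhdsin_completion_point: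
  assumes x: "x \<in> carrier H"
  shows "nhdsin \<sigma> x \<in> completion_points H \<sigma>"
proof -
  have xt: "x \<in> topspace \<sigma>" using x topspace_eq by simp
  have ev: "eventually P (nhdsin \<sigma> x) \<longleftrightarrow> (\<exists>U. openin \<sigma> U \<and> x \<in> U \<and> (\<forall>y\<in>U. P y))" for P
    using xt by (simp add: eventually_nhdsin)
  have cauchy: "cauchy (nhdsin \<sigma> x)"
  proof (rule cauchyI)
    show "nhdsin \<sigma> x \<noteq> bot" unfolding trivial_limit_def ev by blast
    show "eventually (\<lambda>x. x \<in> carrier H) (nhdsin \<sigma> x)"
      unfolding ev using x openin_topspace[of \<sigma>] topspace_eq by blast
    fix V assume "nbhd V"
    then obtain W where W: "nbhd W" "\<And>x y. (x, y) \<in> ent W \<Longrightarrow> (y, x) \<in> ent W"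
      "\<And>x y z. (x, y) \<in> ent W \<Longrightarrow> (y, z) \<in> ent W \<Longrightarrow> (x, z) \<in> ent V" using ent_refine by blast
    have "eventually (\<lambda>y. (x, y) \<in> ent W) (nhdsin \<sigma> x)"
      unfolding ev using ent_open_section[OF W(1) x] by blast
    moreover have "(y, z) \<in> ent V" if "(x, y) \<in> ent W" "(x, z) \<in> ent W" for y z
      using W(2,3) that by blast
    ultimately show "near V (nhdsin \<sigma> x) (nhdsin \<sigma> x)"
      unfolding near_def eventually_prod_filter by blast
  qed
  moreover have "F' = nhdsin \<sigma> x" if F': "cauchy F'" "nhdsin \<sigma> x \<le> F'" for F'
  proof (rule order_antisym[OF _ F'(2)], rule filter_leI)
    fix P assume "eventually P (nhdsin \<sigma> x)"
    then obtain U where U: "openin \<sigma> U" "x \<in> U" "\<forall>y\<in>U. P y" unfolding ev by blast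
    let ?V = "{z \<in> carrier H. x \<otimes> z \<in> U}"
    have V: "nbhd ?V" by (rule nbhd_preimage[OF continuous_mult_left[OF x] U(1)]) (use x U in simp)
    obtain A where A: "eventually (\<lambda>y. y \<in> A) F'" "\<And>y z. y \<in> A \<Longrightarrow> z \<in> A \<Longrightarrow> (y, z) \<in> ent ?V"
      using cauchy_small_set[OF F'(1) V] by blast
    have "x \<in> A" using filter_leD[OF F'(2) A(1)] unfolding ev by blast
    have "P y" if "y \<in> A" for y
    proof -
      have y: "y \<in> carrier H" "x \<otimes> (inv x \<otimes> y) \<in> U" using entD[OF A(2)[OF \<open>x \<in> A\<close> that]] by auto
      have "x \<otimes> (inv x \<otimes> y) = (x \<otimes> inv x) \<otimes> y" using x y(1) by (simp only: m_assoc inv_closed)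
      then have "x \<otimes> (inv x \<otimes> y) = y" using x y(1) by simp
      then show ?thesis using y(2) U(3) by simp
    qed
    then show "eventually P F'" using eventually_mono[OF A(1)] by blast
  qed
  ultimately show ?thesis unfolding completion_points_def by blast
qed

subsection \<open>Multiplication of the completion\<close>

definition filter_mult :: "'a filter \<Rightarrow> 'a filter \<Rightarrow> 'a filter" where
  "filter_mult F F' = filtermap (\<lambda>(x, y). x \<otimes> y) (F \<times>\<^sub>F F')"

lemma eventually_filter_mult:
  "eventually P (filter_mult F F') \<longleftrightarrow>
    (\<exists>p q. eventually p F \<and> eventually q F' \<and> (\<forall>x y. p x \<longrightarrow> q y \<longrightarrow> P (x \<otimes> y)))"
  unfolding filter_mult_def eventually_filtermap eventually_prod_filter by auto

lemma filter_mult_mono: "F \<le> F' \<Longrightarrow> E \<le> E' \<Longrightarrow> filter_mult F E \<le> filter_mult F' E'"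
  unfolding filter_mult_def by (intro filtermap_mono prod_filter_mono)

lemma filter_mult_bot: "filter_mult F F' = bot \<longleftrightarrow> F = bot \<or> F' = bot"
  unfolding filter_mult_def filtermap_bot_iff prod_filter_eq_bot ..

text \<open>The quotients \<open>(x n)\<inverse> (x' n')\<close> and \<open>(x' n') (x n)\<inverse>\<close> involve conjugates by the variable elements \<open>n\<close> and \<open>x\<close>. As these
  range over small sets of Cauchy filters, conjugates by fixed elements \<open>n0\<close> and \<open>x0\<close> of the sets may be taken instead. The
  case \<open>M' = M\<close>, \<open>N' = N\<close> will show that products of Cauchy filters are Cauchy.\<close>

lemma near_filter_mult:
  assumes M: "cauchy M" and N: "cauchy N" and W: "nbhd W"
  shows "\<exists>V. nbhd V \<and> (\<forall>M' N'. near V M M' \<longrightarrow> near V N N' \<longrightarrow> near W (filter_mult M N) (filter_mult M' N'))"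
proof -
  obtain U1 where U1: "nbhd U1" "\<forall>x\<in>U1. \<forall>y\<in>U1. x \<otimes> y \<in> W" using nbhd_mult[OF W] by blast
  obtain U where U: "nbhd U" "\<forall>x\<in>U. inv x \<in> U" "\<forall>x\<in>U. \<forall>y\<in>U. x \<otimes> y \<in> U1"
    using nbhd_refine[OF U1(1)] by blast
  obtain A where A: "eventually (\<lambda>x. x \<in> A) M" "\<And>x y. x \<in> A \<Longrightarrow> y \<in> A \<Longrightarrow> (x, y) \<in> ent U"
    using cauchy_small_set[OF M U(1)] by blast
  obtain B where B: "eventually (\<lambda>x. x \<in> B) N" "\<And>x y. x \<in> B \<Longrightarrow> y \<in> B \<Longrightarrow> (x, y) \<in> ent U"
    using cauchy_small_set[OF N U(1)] by blast
  obtain x0 where x0: "x0 \<in> A" using eventually_happens'[OF cauchyD(1)[OF M] A(1)] by blast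
  obtain n0 where n0: "n0 \<in> B" using eventually_happens'[OF cauchyD(1)[OF N] B(1)] by blast
  have C: "x0 \<in> carrier H" "n0 \<in> carrier H" using entD[OF A(2)[OF x0 x0]] entD[OF B(2)[OF n0 n0]] by auto
  define V where "V = U \<inter> ({v \<in> carrier H. inv n0 \<otimes> v \<otimes> inv (inv n0) \<in> U} \<inter> {v \<in> carrier H. x0 \<otimes> v \<otimes> inv x0 \<in> U})"
  have V: "nbhd V" unfolding V_def by (intro nbhd_Int U(1) nbhd_conjugate) (use C in auto)
  have "near W (filter_mult M N) (filter_mult M' N')" if near: "near V M M'" "near V N N'" for M' N'
  proof -
    obtain p p' where p: "eventually p M" "eventually p' M'" "\<And>x x'. p x \<Longrightarrow> p' x' \<Longrightarrow> (x, x') \<in> ent V"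
      using nearD[OF near(1)] by blast
    obtain q q' where q: "eventually q N" "eventually q' N'" "\<And>n n'. q n \<Longrightarrow> q' n' \<Longrightarrow> (n, n') \<in> ent V"
      using nearD[OF near(2)] by blast
    have key: "(x \<otimes> n, x' \<otimes> n') \<in> ent W"
      if *: "p x" "x \<in> A" "q n" "n \<in> B" "p' x'" "q' n'" for x n x' n'
    proof -
      have xx: "x \<in> carrier H" "x' \<in> carrier H" "inv x \<otimes> x' \<in> V" "x' \<otimes> inv x \<in> V" using entD[OF p(3)[OF *(1,5)]] by auto
      have nn: "n \<in> carrier H" "n' \<in> carrier H" "inv n \<otimes> n' \<in> V" "n' \<otimes> inv n \<in> V" using entD[OF q(3)[OF *(3,6)]] by auto
      have c: "inv x \<in> carrier H" "inv x' \<in> carrier H" "inv n \<in> carrier H" "inv n' \<in> carrier H"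
        "inv x0 \<in> carrier H" "inv n0 \<in> carrier H" using xx nn C by auto
      have cancel: "a \<otimes> (inv a \<otimes> b) = b" "inv a \<otimes> (a \<otimes> b) = b" if "a \<in> carrier H" "b \<in> carrier H" for a b
        using that by (simp_all add: m_assoc[symmetric])
      have 1: "inv n \<otimes> n0 \<in> U" using entD[OF B(2)[OF *(4) n0]] by auto
      have 2: "inv n0 \<otimes> (inv x \<otimes> x') \<otimes> n0 \<in> U" using xx(3) C unfolding V_def by auto
      have 3: "inv n0 \<otimes> n \<in> U" using entD[OF B(2)[OF n0 *(4)]] by auto
      have 4: "inv n \<otimes> n' \<in> U" using nn unfolding V_def by auto
      have "((inv n \<otimes> n0) \<otimes> (inv n0 \<otimes> (inv x \<otimes> x') \<otimes> n0)) \<otimes> ((inv n0 \<otimes> n) \<otimes> (inv n \<otimes> n')) \<in> W"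
        using U1(2) U(3) 1 2 3 4 by blast
      moreover have "((inv n \<otimes> n0) \<otimes> (inv n0 \<otimes> (inv x \<otimes> x') \<otimes> n0)) \<otimes> ((inv n0 \<otimes> n) \<otimes> (inv n \<otimes> n'))
          = inv (x \<otimes> n) \<otimes> (x' \<otimes> n')"
        using xx(1,2) nn(1,2) C c by (simp add: m_assoc cancel inv_mult_group)
      ultimately have left: "inv (x \<otimes> n) \<otimes> (x' \<otimes> n') \<in> W" by simp
      have 5: "x' \<otimes> inv x \<in> U" using xx unfolding V_def by auto
      have 6: "x \<otimes> inv x0 \<in> U" using entD[OF A(2)[OF x0 *(2)]] by auto
      have 7: "x0 \<otimes> (n' \<otimes> inv n) \<otimes> inv x0 \<in> U" using nn(4) unfolding V_def by auto
      have 8: "x0 \<otimes> inv x \<in> U" using entD[OF A(2)[OF *(2) x0]] by auto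
      have "((x' \<otimes> inv x) \<otimes> (x \<otimes> inv x0)) \<otimes> ((x0 \<otimes> (n' \<otimes> inv n) \<otimes> inv x0) \<otimes> (x0 \<otimes> inv x)) \<in> W"
        using U1(2) U(3) 5 6 7 8 by blast
      moreover have "((x' \<otimes> inv x) \<otimes> (x \<otimes> inv x0)) \<otimes> ((x0 \<otimes> (n' \<otimes> inv n) \<otimes> inv x0) \<otimes> (x0 \<otimes> inv x))
          = (x' \<otimes> n') \<otimes> inv (x \<otimes> n)"
        using xx(1,2) nn(1,2) C c by (simp add: m_assoc cancel inv_mult_group)
      ultimately have "(x' \<otimes> n') \<otimes> inv (x \<otimes> n) \<in> W" by simp
      then show ?thesis using left xx nn by (intro entI) auto
    qed
    have "eventually (\<lambda>z. \<exists>x n. z = x \<otimes> n \<and> p x \<and> x \<in> A \<and> q n \<and> n \<in> B) (filter_mult M N)"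
      unfolding eventually_filter_mult
      by (intro exI[of _ "\<lambda>x. p x \<and> x \<in> A"] exI[of _ "\<lambda>x. q x \<and> x \<in> B"])
         (use p(1) q(1) A(1) B(1) in \<open>auto simp: eventually_conj_iff\<close>)
    moreover have "eventually (\<lambda>z. \<exists>x n. z = x \<otimes> n \<and> p' x \<and> q' n) (filter_mult M' N')"
      unfolding eventually_filter_mult using p(2) q(2) by blast
    ultimately show ?thesis unfolding near_def eventually_prod_filter
      by (intro exI conjI) (assumption, assumption, use key in blast)
  qed
  then show ?thesis using V by blast
qed

lemma cauchy_filter_mult:
  assumes "cauchy M" and "cauchy N"
  shows "cauchy (filter_mult M N)"
proof (rule cauchyI)
  show "filter_mult M N \<noteq> bot" using cauchyD(1) assms by (simp add: filter_mult_bot)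
  show "eventually (\<lambda>x. x \<in> carrier H) (filter_mult M N)"
    unfolding eventually_filter_mult using cauchyD(2)[OF assms(1)] cauchyD(2)[OF assms(2)] by blast
  show "near V (filter_mult M N) (filter_mult M N)" if "nbhd V" for V
    using near_filter_mult[OF assms that] cauchyD(3)[OF assms(1)] cauchyD(3)[OF assms(2)] by blast
qed

abbreviation "points \<equiv> completion_points H \<sigma>"
abbreviation "cmult \<equiv> monoid.mult (completion_group H \<sigma>)"
abbreviation "ctop \<equiv> completion_topology H \<sigma>"

lemma cmult_eq:
  assumes "M \<in> points" and "N \<in> points"
  shows "cmult M N = minimal_cauchy (filter_mult M N)"
proof -
  note c = cauchy_filter_mult[OF completion_points_cauchy[OF assms(1)] completion_points_cauchy[OF assms(2)]]
  have "cmult M N = (THE K. K \<in> points \<and> filter_mult M N \<le> K)"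
    by (simp add: completion_group_def filter_mult_def)
  also have "\<dots> = minimal_cauchy (filter_mult M N)"
    using minimal_cauchy(1,3,4)[OF c] by (intro the_equality conjI) (assumption+, elim conjE)
  finally show ?thesis .
qed

lemma
  assumes "M \<in> points" and "N \<in> points"
  shows cmult_closed: "cmult M N \<in> points" and filter_mult_le_cmult: "filter_mult M N \<le> cmult M N"
  using minimal_cauchy(1,3)[OF cauchy_filter_mult[OF completion_points_cauchy[OF assms(1)] completion_points_cauchy[OF assms(2)]]]
  by (simp_all add: cmult_eq[OF assms])

lemma cmult_unique:
  assumes "M \<in> points" and "N \<in> points" and "K \<in> points" and "filter_mult M N \<le> K"
  shows "cmult M N = K"
  using minimal_cauchy(4)[OF cauchy_filter_mult[OF completion_points_cauchy[OF assms(1)] completion_points_cauchy[OF assms(2)]]]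
    assms cmult_eq[OF assms(1,2)] by simp

lemma filter_mult_assoc_le:
  assumes "eventually (\<lambda>x. x \<in> carrier H) M1" "eventually (\<lambda>x. x \<in> carrier H) M2" "eventually (\<lambda>x. x \<in> carrier H) M3"
  shows "filter_mult (filter_mult M1 M2) M3 \<le> filter_mult M1 (filter_mult M2 M3)"
proof (rule filter_leI)
  fix P assume "eventually P (filter_mult M1 (filter_mult M2 M3))"
  then obtain p q r s where *: "eventually p M1" "eventually r M2" "eventually s M3"
    "\<forall>x y. p x \<longrightarrow> q y \<longrightarrow> P (x \<otimes> y)" "\<forall>x y. r x \<longrightarrow> s y \<longrightarrow> q (x \<otimes> y)"
    unfolding eventually_filter_mult by blast
  let ?p = "\<lambda>x. p x \<and> x \<in> carrier H" and ?r = "\<lambda>x. r x \<and> x \<in> carrier H" and ?s = "\<lambda>x. s x \<and> x \<in> carrier H"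
  have ev: "eventually ?p M1" "eventually ?r M2" "eventually ?s M3" using * assms by (auto simp: eventually_conj_iff)
  have "eventually (\<lambda>w. \<exists>x y. w = x \<otimes> y \<and> ?p x \<and> ?r y) (filter_mult M1 M2)"
    unfolding eventually_filter_mult using ev(1,2) by blast
  moreover have "P (w \<otimes> z)" if w: "\<exists>x y. w = x \<otimes> y \<and> ?p x \<and> ?r y" and z: "?s z" for w z
  proof -
    obtain x y where xy: "w = x \<otimes> y" "?p x" "?r y" using w by blast
    have "P (x \<otimes> (y \<otimes> z))" using *(4,5) xy z by blast
    then show ?thesis using xy z by (simp add: m_assoc)
  qed
  ultimately show "eventually P (filter_mult (filter_mult M1 M2) M3)"
    unfolding eventually_filter_mult[of P] using ev(3) by blast
qed

text \<open>Both products are the minimal Cauchy filter that is coarser than the filter of triple products.\<close>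

lemma cmult_assoc:
  assumes M: "M1 \<in> points" "M2 \<in> points" "M3 \<in> points"
  shows "cmult (cmult M1 M2) M3 = cmult M1 (cmult M2 M3)"
proof -
  note c = completion_points_cauchy[OF M(1)] completion_points_cauchy[OF M(2)] completion_points_cauchy[OF M(3)]
  let ?F = "filter_mult (filter_mult M1 M2) M3"
  have F: "cauchy ?F" by (intro cauchy_filter_mult c)
  have "?F \<le> filter_mult (cmult M1 M2) M3"
    by (intro filter_mult_mono filter_mult_le_cmult M order_refl)
  also have "\<dots> \<le> cmult (cmult M1 M2) M3" by (intro filter_mult_le_cmult cmult_closed M)
  finally have 1: "?F \<le> cmult (cmult M1 M2) M3" .
  have "?F \<le> filter_mult M1 (filter_mult M2 M3)" by (intro filter_mult_assoc_le cauchyD(2) c)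
  also have "\<dots> \<le> filter_mult M1 (cmult M2 M3)"
    by (intro filter_mult_mono filter_mult_le_cmult M order_refl)
  also have "\<dots> \<le> cmult M1 (cmult M2 M3)" by (intro filter_mult_le_cmult cmult_closed M)
  finally have 2: "?F \<le> cmult M1 (cmult M2 M3)" .
  show ?thesis
    using minimal_cauchy(4)[OF F _ 1] minimal_cauchy(4)[OF F _ 2] cmult_closed M by metis
qed

lemma nhdsin_hom:
  assumes x: "x \<in> carrier H" and y: "y \<in> carrier H"
  shows "cmult (nhdsin \<sigma> x) (nhdsin \<sigma> y) = nhdsin \<sigma> (x \<otimes> y)"
proof (rule cmult_unique)
  show "filter_mult (nhdsin \<sigma> x) (nhdsin \<sigma> y) \<le> nhdsin \<sigma> (x \<otimes> y)"
  proof (rule filter_leI)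
    fix P assume "eventually P (nhdsin \<sigma> (x \<otimes> y))"
    then obtain U where U: "openin \<sigma> U" "x \<otimes> y \<in> U" "\<forall>z\<in>U. P z"
      using x y by (auto simp: eventually_nhdsin topspace_eq)
    obtain A B where AB: "openin \<sigma> A" "openin \<sigma> B" "x \<in> A" "y \<in> B" "\<forall>a\<in>A. \<forall>b\<in>B. a \<otimes> b \<in> U"
      using open_mult[OF U(1) x y U(2)] by blast
    then have "P (a \<otimes> b)" if "a \<in> A" "b \<in> B" for a b using that U(3) by blast
    moreover have "eventually (\<lambda>a. a \<in> A) (nhdsin \<sigma> x)" "eventually (\<lambda>b. b \<in> B) (nhdsin \<sigma> y)"
      using AB unfolding eventually_nhdsin by blast+
    ultimately show "eventually P (filter_mult (nhdsin \<sigma> x) (nhdsin \<sigma> y))"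
      unfolding eventually_filter_mult by blast
  qed
qed (use x y nhdsin_completion_point in auto)

subsection \<open>The topology of the completion\<close>

lemma topspace_ctop: "topspace ctop = points"
proof
  show "topspace ctop \<subseteq> points"
    unfolding topspace_def openin_completion_topology by blast
  have "openin ctop points"
    unfolding openin_completion_topology by (auto intro!: exI[of _ "\<lambda>_. True"])
  then show "points \<subseteq> topspace ctop" by (rule openin_subset)
qed

lemma openin_ctop:
  "openin ctop V \<longleftrightarrow> V \<subseteq> points \<and> (\<forall>M\<in>V. \<exists>W. nbhd W \<and> (\<forall>M'\<in>points. near W M M' \<longrightarrow> M' \<in> V))"
  unfolding openin_completion_topology near_def
proof (intro conj_cong refl ball_cong iffI)
  fix M assume "\<exists>E. eventually E (two_sided_uniformity H \<sigma>) \<and>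
    (\<forall>F'\<in>points. eventually E (M \<times>\<^sub>F F') \<longrightarrow> F' \<in> V)"
  then obtain E W where E: "\<forall>F'\<in>points. eventually E (M \<times>\<^sub>F F') \<longrightarrow> F' \<in> V" "nbhd W" "\<forall>p\<in>ent W. E p"
    unfolding eventually_uniformity by blast
  have "M' \<in> V" if "M' \<in> points" "eventually (\<lambda>p. p \<in> ent W) (M \<times>\<^sub>F M')" for M'
    using E(1) that(1) eventually_mono[OF that(2)] E(3) by blast
  then show "\<exists>W. nbhd W \<and> (\<forall>M'\<in>points. eventually (\<lambda>p. p \<in> ent W) (M \<times>\<^sub>F M') \<longrightarrow> M' \<in> V)"
    using E(2) by blast
next
  fix M assume "\<exists>W. nbhd W \<and> (\<forall>M'\<in>points. eventually (\<lambda>p. p \<in> ent W) (M \<times>\<^sub>F M') \<longrightarrow> M' \<in> V)"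
  then obtain W where W: "nbhd W" "\<forall>M'\<in>points. eventually (\<lambda>p. p \<in> ent W) (M \<times>\<^sub>F M') \<longrightarrow> M' \<in> V" by blast
  then show "\<exists>E. eventually E (two_sided_uniformity H \<sigma>) \<and>
    (\<forall>F'\<in>points. eventually E (M \<times>\<^sub>F F') \<longrightarrow> F' \<in> V)"
    by (intro exI[of _ "\<lambda>p. p \<in> ent W"]) (auto simp: eventually_uniformity)
qed

lemma near_cmult:
  assumes M: "M \<in> points" and N: "N \<in> points" and W: "nbhd W"
  shows "\<exists>V. nbhd V \<and> (\<forall>M'\<in>points. \<forall>N'\<in>points. near V M M' \<longrightarrow> near V N N' \<longrightarrow> near W (cmult M N) (cmult M' N'))"
proof -
  note c = completion_points_cauchy
  obtain U where U: "nbhd U" "\<forall>F F' P P'. F \<noteq> bot \<longrightarrow> F' \<noteq> bot \<longrightarrow> F \<le> P \<longrightarrow> F' \<le> P' \<longrightarrow> cauchy P \<longrightarrow> cauchy P' \<longrightarrow>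
    near U F F' \<longrightarrow> near W P P'" using near_coarser[OF W] by blast
  obtain V where V: "nbhd V" "\<forall>M' N'. near V M M' \<longrightarrow> near V N N' \<longrightarrow> near U (filter_mult M N) (filter_mult M' N')"
    using near_filter_mult[OF c[OF M] c[OF N] U(1)] by blast
  have "near W (cmult M N) (cmult M' N')" if "M' \<in> points" "N' \<in> points" "near V M M'" "near V N N'" for M' N'
    using U(2)[rule_format, of "filter_mult M N" "filter_mult M' N'" "cmult M N" "cmult M' N'"]
      V(2) that M N cauchyD(1)[OF c] c[OF cmult_closed] filter_mult_le_cmult
    by (simp add: filter_mult_bot)
  then show ?thesis using V(1) by blast
qed

lemma completion_semitopological: "semitopological_semigroup (completion_group H \<sigma>) ctop"
proof -
  have carrier: "carrier (completion_group H \<sigma>) = points" by (simp add: completion_group_def)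
  have near_refl: "near V M M" if "M \<in> points" "nbhd V" for M V
    using cauchyD(3) completion_points_cauchy that by blast
  have cont: "continuous_map ctop ctop f"
    if f: "f \<in> points \<rightarrow> points" and near: "\<And>M W. \<lbrakk>M \<in> points; nbhd W\<rbrakk> \<Longrightarrow>
      \<exists>V. nbhd V \<and> (\<forall>M'\<in>points. near V M M' \<longrightarrow> near W (f M) (f M'))" for f
    unfolding continuous_map_def topspace_ctop
  proof (intro conjI allI impI f)
    fix V assume V: "openin ctop V"
    show "openin ctop {M \<in> points. f M \<in> V}"
      unfolding openin_ctop
    proof (intro conjI ballI)
      fix M assume "M \<in> {M \<in> points. f M \<in> V}"
      then have M: "M \<in> points" "f M \<in> V" by auto
      obtain W where W: "nbhd W" "\<forall>M'\<in>points. near W (f M) M' \<longrightarrow> M' \<in> V"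
        using V M(2) unfolding openin_ctop by blast
      obtain U where U: "nbhd U" "\<forall>M'\<in>points. near U M M' \<longrightarrow> near W (f M) (f M')"
        using near[OF M(1) W(1)] by blast
      have "f M' \<in> V" if "M' \<in> points" "near U M M'" for M' using W(2) U(2) that f by blast
      then show "\<exists>W. nbhd W \<and> (\<forall>M'\<in>points. near W M M' \<longrightarrow> M' \<in> {M \<in> points. f M \<in> V})"
        using U(1) by blast
    qed auto
  qed
  show ?thesis
  proof (unfold_locales, unfold carrier topspace_ctop)
    show "points \<noteq> {}" using nhdsin_completion_point[OF one_closed] by blast
    fix a assume a: "a \<in> points"
    show "continuous_map ctop ctop (\<lambda>x. cmult a x)"
    proof (rule cont)
      fix M W assume M: "M \<in> points" and W: "nbhd W"
      obtain V where V: "nbhd V" "\<forall>M'\<in>points. \<forall>N'\<in>points. near V a M' \<longrightarrow> near V M N' \<longrightarrow>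
        near W (cmult a M) (cmult M' N')" using near_cmult[OF a M W] by blast
      then show "\<exists>V. nbhd V \<and> (\<forall>M'\<in>points. near V M M' \<longrightarrow> near W (cmult a M) (cmult a M'))"
        using a near_refl[OF a V(1)] by blast
    qed (use a cmult_closed in auto)
    show "continuous_map ctop ctop (\<lambda>x. cmult x a)"
    proof (rule cont)
      fix M W assume M: "M \<in> points" and W: "nbhd W"
      obtain V where V: "nbhd V" "\<forall>M'\<in>points. \<forall>N'\<in>points. near V M M' \<longrightarrow> near V a N' \<longrightarrow>
        near W (cmult M a) (cmult M' N')" using near_cmult[OF M a W] by blast
      then show "\<exists>V. nbhd V \<and> (\<forall>M'\<in>points. near V M M' \<longrightarrow> near W (cmult M a) (cmult M' a))"
        using a near_refl[OF a V(1)] by blast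
    qed (use a cmult_closed in auto)
  qed (auto simp: cmult_closed cmult_assoc)
qed

lemma nhdsin_dense:
  assumes M: "M \<in> points" and V: "openin ctop V" "M \<in> V"
  shows "eventually (\<lambda>x. nhdsin \<sigma> x \<in> V) M"
proof -
  obtain W where W: "nbhd W" "\<forall>M'\<in>points. near W M M' \<longrightarrow> M' \<in> V" using V unfolding openin_ctop by blast
  obtain U where U: "nbhd U" "\<And>x y z. (x, y) \<in> ent U \<Longrightarrow> (y, z) \<in> ent U \<Longrightarrow> (x, z) \<in> ent W"
    using ent_refine[OF W(1)] by blast
  obtain A where A: "eventually (\<lambda>x. x \<in> A) M" "\<And>x y. x \<in> A \<Longrightarrow> y \<in> A \<Longrightarrow> (x, y) \<in> ent U"
    using cauchy_small_set[OF completion_points_cauchy[OF M] U(1)] by blast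
  have "nhdsin \<sigma> y \<in> V" if y: "y \<in> A" for y
  proof -
    have yC: "y \<in> carrier H" using entD[OF A(2)[OF y y]] by simp
    have "eventually (\<lambda>z. (y, z) \<in> ent U) (nhdsin \<sigma> y)"
      unfolding eventually_nhdsin using ent_open_section[OF U(1) yC] by blast
    moreover have "(x, z) \<in> ent W" if "x \<in> A" "(y, z) \<in> ent U" for x z
      by (rule U(2)[OF A(2)[OF that(1) y] that(2)])
    ultimately have "near W M (nhdsin \<sigma> y)"
      unfolding near_def eventually_prod_filter using A(1) by blast
    then show ?thesis using W(2) nhdsin_completion_point[OF yC] by blast
  qed
  then show ?thesis by (rule eventually_mono[OF A(1)])
qed

lemma continuous_nhdsin: "continuous_map \<sigma> ctop (nhdsin \<sigma>)"
  unfolding continuous_map_def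
proof (intro conjI allI impI)
  show "nhdsin \<sigma> \<in> topspace \<sigma> \<rightarrow> topspace ctop"
    unfolding topspace_ctop topspace_eq using nhdsin_completion_point by blast
  fix V assume V: "openin ctop V"
  show "openin \<sigma> {x \<in> topspace \<sigma>. nhdsin \<sigma> x \<in> V}"
  proof (subst openin_subopen, intro ballI)
    fix x assume "x \<in> {x \<in> topspace \<sigma>. nhdsin \<sigma> x \<in> V}"
    then have x: "x \<in> topspace \<sigma>" "x \<in> carrier H" "nhdsin \<sigma> x \<in> V" by (auto simp: topspace_eq)
    have "eventually (\<lambda>y. nhdsin \<sigma> y \<in> V) (nhdsin \<sigma> x)"
      by (rule nhdsin_dense[OF nhdsin_completion_point[OF x(2)] V x(3)])
    then obtain U where U: "openin \<sigma> U" "x \<in> U" "\<forall>y\<in>U. nhdsin \<sigma> y \<in> V"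
      using x(1) unfolding eventually_nhdsin by blast
    then show "\<exists>U. openin \<sigma> U \<and> x \<in> U \<and> U \<subseteq> {x \<in> topspace \<sigma>. nhdsin \<sigma> x \<in> V}"
      using openin_subset[OF U(1)] by blast
  qed
qed

subsection \<open>Extension of uniformly continuous functions\<close>

definition uniformly_cont :: "('a \<Rightarrow> complex) \<Rightarrow> bool" where
  "uniformly_cont f \<longleftrightarrow> (\<forall>\<epsilon>>0. \<exists>V. nbhd V \<and> (\<forall>x y. (x, y) \<in> ent V \<longrightarrow> cmod (f x - f y) \<le> \<epsilon>))"

definition extend :: "('a \<Rightarrow> complex) \<Rightarrow> 'a filter \<Rightarrow> complex" where
  "extend f = (\<lambda>M\<in>points. Lim M f)"

lemma tendsto_extend:
  assumes f: "uniformly_cont f" and M: "M \<in> points"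
  shows "(f \<longlongrightarrow> extend f M) M"
proof -
  note c = completion_points_cauchy[OF M]
  have "cauchy_filter (filtermap f M)"
    unfolding cauchy_filter_def
  proof (rule filter_leI)
    fix P :: "complex \<times> complex \<Rightarrow> bool" assume "eventually P uniformity"
    then obtain \<epsilon> where \<epsilon>: "\<epsilon> > 0" "\<And>x y. dist x y < \<epsilon> \<Longrightarrow> P (x, y)"
      unfolding eventually_uniformity_metric by blast
    obtain V where V: "nbhd V" "\<And>x y. (x, y) \<in> ent V \<Longrightarrow> cmod (f x - f y) \<le> \<epsilon>/2"
      using f \<epsilon>(1) unfolding uniformly_cont_def by (meson half_gt_zero)
    obtain A where A: "eventually (\<lambda>x. x \<in> A) M" "\<And>x y. x \<in> A \<Longrightarrow> y \<in> A \<Longrightarrow> (x, y) \<in> ent V"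
      using cauchy_small_set[OF c V(1)] by blast
    have P: "P (f x, f y)" if "x \<in> A" "y \<in> A" for x y
      using V(2)[OF A(2)[OF that]] \<epsilon> by (intro \<epsilon>(2)) (simp add: dist_norm)
    have "eventually (\<lambda>z. \<exists>x\<in>A. z = f x) (filtermap f M)"
      unfolding eventually_filtermap using A(1) by (rule eventually_mono) blast
    then show "eventually P (filtermap f M \<times>\<^sub>F filtermap f M)"
      unfolding eventually_prod_filter using P by blast
  qed
  then obtain l where "filtermap f M \<le> nhds l"
    using cauchy_filter_complete_converges[of "filtermap f M" UNIV] complete_UNIV cauchyD(1)[OF c]
    by (auto simp: filtermap_bot_iff)
  then have l: "(f \<longlongrightarrow> l) M" by (simp add: filterlim_def)
  then have "Lim M f = l" by (rule tendsto_Lim[OF cauchyD(1)[OF c]])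
  then show ?thesis using l M by (simp add: extend_def)
qed

lemma extend_nhdsin:
  assumes f: "uniformly_cont f" and x: "x \<in> carrier H"
  shows "extend f (nhdsin \<sigma> x) = f x"
proof -
  note p = nhdsin_completion_point[OF x]
  have "(f \<longlongrightarrow> f x) (nhdsin \<sigma> x)"
  proof (rule tendstoI)
    fix \<epsilon> :: real assume "\<epsilon> > 0"
    then obtain V where V: "nbhd V" "\<And>x y. (x, y) \<in> ent V \<Longrightarrow> cmod (f x - f y) \<le> \<epsilon>/2"
      using f unfolding uniformly_cont_def by (meson half_gt_zero)
    have "dist (f y) (f x) < \<epsilon>" if "(x, y) \<in> ent V" for y
      using V(2)[OF that] \<open>\<epsilon> > 0\<close> by (simp add: dist_norm norm_minus_commute)
    then show "eventually (\<lambda>y. dist (f y) (f x) < \<epsilon>) (nhdsin \<sigma> x)"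
      unfolding eventually_nhdsin using ent_open_section[OF V(1) x] by blast
  qed
  then show ?thesis
    using tendsto_unique[OF cauchyD(1)[OF completion_points_cauchy[OF p]] tendsto_extend[OF f p]] by blast
qed

lemma extend_bound:
  assumes f: "uniformly_cont f" and M: "M \<in> points" and "\<And>x. x \<in> carrier H \<Longrightarrow> cmod (f x) \<le> b"
  shows "cmod (extend f M) \<le> b"
proof (rule tendsto_upperbound[OF tendsto_norm[OF tendsto_extend[OF f M]]])
  show "eventually (\<lambda>x. cmod (f x) \<le> b) M"
    by (rule eventually_mono[OF cauchyD(2)[OF completion_points_cauchy[OF M]]]) (rule assms(3))
qed (rule cauchyD(1)[OF completion_points_cauchy[OF M]])

lemma extend_bounded_cont:
  assumes f: "uniformly_cont f" and b: "bounded (f ` carrier H)"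
  shows "extend f \<in> bounded_cont ctop"
proof -
  obtain c where c: "\<And>x. x \<in> carrier H \<Longrightarrow> cmod (f x) \<le> c" using b unfolding bounded_iff by blast
  have "bounded (extend f ` points)"
    using extend_bound[OF f _ c] by (auto simp: bounded_iff)
  moreover have "continuous_map ctop euclidean (extend f)"
    unfolding continuous_map_def topspace_ctop
  proof (intro conjI allI impI)
    fix Z :: "complex set" assume "openin euclidean Z"
    then have Z: "open Z" by simp
    show "openin ctop {M \<in> points. extend f M \<in> Z}"
      unfolding openin_ctop
    proof (intro conjI ballI)
      fix M assume "M \<in> {M \<in> points. extend f M \<in> Z}"
      then have M: "M \<in> points" "extend f M \<in> Z" by auto
      then obtain \<epsilon> where \<epsilon>: "\<epsilon> > 0" "\<And>z. dist z (extend f M) < \<epsilon> \<Longrightarrow> z \<in> Z"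
        using Z unfolding open_dist by blast
      then obtain V where V: "nbhd V" "\<And>x y. (x, y) \<in> ent V \<Longrightarrow> cmod (f x - f y) \<le> \<epsilon>/2"
        using f unfolding uniformly_cont_def by (meson half_gt_zero)
      have close: "dist (extend f M') (extend f M) < \<epsilon>" if M': "M' \<in> points" "near V M M'" for M'
      proof -
        let ?F = "M \<times>\<^sub>F M'"
        have "((\<lambda>p. f (fst p)) \<longlongrightarrow> extend f M) ?F" "((\<lambda>p. f (snd p)) \<longlongrightarrow> extend f M') ?F"
          by (rule filterlim_compose[OF tendsto_extend[OF f M(1)] filterlim_fst],
              rule filterlim_compose[OF tendsto_extend[OF f M'(1)] filterlim_snd])
        then have "((\<lambda>p. cmod (f (fst p) - f (snd p))) \<longlongrightarrow> cmod (extend f M - extend f M')) ?F"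
          by (intro tendsto_norm tendsto_diff)
        moreover have "eventually (\<lambda>p. cmod (f (fst p) - f (snd p)) \<le> \<epsilon>/2) ?F"
          using M'(2) unfolding near_def by (rule eventually_mono) (use V(2) in auto)
        moreover have "?F \<noteq> bot"
          using cauchyD(1) completion_points_cauchy M(1) M'(1) by (simp add: prod_filter_eq_bot)
        ultimately have "cmod (extend f M - extend f M') \<le> \<epsilon>/2" using tendsto_upperbound by blast
        then show ?thesis using \<open>\<epsilon> > 0\<close> by (simp add: dist_norm norm_minus_commute)
      qed
      show "\<exists>W. nbhd W \<and> (\<forall>M'\<in>points. near W M M' \<longrightarrow> M' \<in> {M \<in> points. extend f M \<in> Z})"
        using V(1) close \<epsilon>(2) by blast
    qed auto
  qed auto
  ultimately show ?thesis by (simp add: bounded_cont_def topspace_ctop extend_def)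
qed

end

section \<open>The Hausdorff quotient and its completion\<close>

context topological_group_structure
begin

abbreviation "N \<equiv> closure_one H \<sigma>"
abbreviation "quo \<equiv> H Mod closure_one H \<sigma>"
abbreviation "qtop \<equiv> hausdorff_quotient_topology H \<sigma>"
abbreviation "coset x \<equiv> closure_one H \<sigma> #> x"

lemma closure_one_iff: "n \<in> N \<longleftrightarrow> n \<in> carrier H \<and> (\<forall>U. openin \<sigma> U \<longrightarrow> n \<in> U \<longrightarrow> \<one> \<in> U)"
  unfolding closure_one_def in_closure_of topspace_eq by blast

text \<open>The closure of the identity is the indiscrete part of the topology: open sets are unions of its
  cosets. So the quotient map identifies the open sets of the group and those of the quotient.\<close>

lemma open_saturated:
  assumes U: "openin \<sigma> U" and x: "x \<in> U" and n: "n \<in> N"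
  shows "n \<otimes> x \<in> U"
proof -
  have xC: "x \<in> carrier H" using x openin_subset[OF U] topspace_eq by blast
  have nC: "n \<in> carrier H" using n closure_one_iff by blast
  let ?W = "{z \<in> topspace \<sigma>. inv z \<otimes> (n \<otimes> x) \<in> U}"
  have "continuous_map \<sigma> \<sigma> (\<lambda>z. inv z \<otimes> (n \<otimes> x))"
    using continuous_map_compose[OF continuous_inv continuous_mult_right[of "n \<otimes> x"]] nC xC by (simp add: o_def)
  then have "openin \<sigma> ?W" using U by (rule openin_continuous_map_preimage)
  moreover have "n \<in> ?W" using nC xC x by (simp add: topspace_eq m_assoc[symmetric])
  ultimately have "\<one> \<in> ?W" using n closure_one_iff by blast
  then show ?thesis using nC xC by simp
qed

lemma closure_one_normal: "N \<lhd> H"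
  unfolding normal_inv_iff
proof (intro conjI ballI)
  show "subgroup N H"
  proof (rule subgroupI)
    show "N \<subseteq> carrier H" using closure_one_iff by blast
    show "N \<noteq> {}" using closure_one_iff by (metis empty_iff one_closed)
    fix a assume a: "a \<in> N"
    then have aC: "a \<in> carrier H" using closure_one_iff by blast
    show "inv a \<in> N"
      unfolding closure_one_iff
    proof (intro conjI allI impI)
      fix U assume "openin \<sigma> U" "inv a \<in> U"
      then have "a \<otimes> inv a \<in> U" using open_saturated a by blast
      then show "\<one> \<in> U" using aC by simp
    qed (use aC in simp)
    fix b assume b: "b \<in> N"
    then have bC: "b \<in> carrier H" using closure_one_iff by blast
    show "a \<otimes> b \<in> N"
      unfolding closure_one_iff
    proof (intro conjI allI impI)
      fix U assume U: "openin \<sigma> U" "a \<otimes> b \<in> U"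
      let ?W = "{z \<in> topspace \<sigma>. z \<otimes> b \<in> U}"
      have "openin \<sigma> ?W" by (rule openin_continuous_map_preimage[OF continuous_mult_right[OF bC] U(1)])
      moreover have "a \<in> ?W" using aC U by (simp add: topspace_eq)
      ultimately have "\<one> \<in> ?W" using a closure_one_iff by blast
      then show "\<one> \<in> U" using U(1) b bC closure_one_iff by simp
    qed (use aC bC in simp)
  qed
next
  fix x n assume x: "x \<in> carrier H" and n: "n \<in> N"
  then have nC: "n \<in> carrier H" using closure_one_iff by blast
  show "x \<otimes> n \<otimes> inv x \<in> N"
    unfolding closure_one_iff
  proof (intro conjI allI impI)
    fix U assume U: "openin \<sigma> U" "x \<otimes> n \<otimes> inv x \<in> U"
    let ?W = "{z \<in> topspace \<sigma>. x \<otimes> z \<otimes> inv x \<in> U}"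
    have "continuous_map \<sigma> \<sigma> (\<lambda>z. x \<otimes> z \<otimes> inv x)"
      using continuous_map_compose[OF continuous_mult_left[OF x] continuous_mult_right[of "inv x"]] x
      by (simp add: o_def)
    then have "openin \<sigma> ?W" using U(1) by (rule openin_continuous_map_preimage)
    moreover have "n \<in> ?W" using nC U by (simp add: topspace_eq)
    ultimately have "\<one> \<in> ?W" using n closure_one_iff by blast
    then show "\<one> \<in> U" using x by simp
  qed (use x nC in simp)
qed

lemma coset_mem_iff: "\<lbrakk>x \<in> carrier H; y \<in> coset x\<rbrakk> \<Longrightarrow> \<exists>n\<in>N. y = n \<otimes> x"
  by (auto simp: r_coset_def)

lemma coset_self: "x \<in> carrier H \<Longrightarrow> x \<in> coset x"
  using closure_one_normal by (simp add: normal_imp_subgroup rcos_self)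

lemma coset_open:
  assumes U: "openin \<sigma> U" and x: "x \<in> carrier H" "coset x \<in> coset ` U"
  shows "x \<in> U"
proof -
  obtain y where y: "y \<in> U" "coset x = coset y" using x(2) by blast
  have yC: "y \<in> carrier H" using y(1) openin_subset[OF U] topspace_eq by blast
  have "x \<in> coset y" using coset_self[OF x(1)] y(2) by simp
  then obtain n where "n \<in> N" "x = n \<otimes> y" using coset_mem_iff[OF yC] by blast
  then show ?thesis using open_saturated[OF U y(1)] by simp
qed

lemma carrier_quo: "carrier quo = coset ` carrier H"
  by (auto simp: carrier_FactGroup)

lemma openin_qtop: "openin qtop V \<longleftrightarrow> V \<subseteq> coset ` carrier H \<and> openin \<sigma> {x \<in> carrier H. coset x \<in> V}"
  unfolding hausdorff_quotient_topology_def openin_quotient_topology topspace_eq ..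

lemma openin_qtop_image:
  assumes U: "openin \<sigma> U"
  shows "openin qtop (coset ` U)"
proof -
  have UC: "U \<subseteq> carrier H" using openin_subset[OF U] topspace_eq by simp
  have "{x \<in> carrier H. coset x \<in> coset ` U} = U" using coset_open[OF U] UC by blast
  then show ?thesis unfolding openin_qtop using U UC by auto
qed

lemma topspace_qtop: "topspace qtop = coset ` carrier H"
proof
  show "topspace qtop \<subseteq> coset ` carrier H" unfolding topspace_def openin_qtop by blast
  show "coset ` carrier H \<subseteq> topspace qtop"
    using openin_subset[OF openin_qtop_image[OF openin_topspace]] topspace_eq by simp
qed

lemma coset_mult: "\<lbrakk>x \<in> carrier H; y \<in> carrier H\<rbrakk> \<Longrightarrow> coset x \<otimes>\<^bsub>quo\<^esub> coset y = coset (x \<otimes> y)"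
  using normal.r_coset_hom_Mod[OF closure_one_normal] by (simp add: hom_def)

lemma coset_one: "coset \<one> = \<one>\<^bsub>quo\<^esub>"
proof -
  have "N \<subseteq> carrier H" using closure_one_iff by blast
  then show ?thesis by (simp add: coset_mult_one)
qed

lemma group_quo: "group quo"
  by (rule normal.factorgroup_is_group[OF closure_one_normal])

lemma coset_inv: "x \<in> carrier H \<Longrightarrow> inv\<^bsub>quo\<^esub> (coset x) = coset (inv x)"
proof -
  assume x: "x \<in> carrier H"
  have "coset (inv x) \<otimes>\<^bsub>quo\<^esub> coset x = \<one>\<^bsub>quo\<^esub>"
    using x by (simp only: coset_mult inv_closed l_inv coset_one)
  then show ?thesis
    using group.inv_equality[OF group_quo, of "coset (inv x)" "coset x"] x carrier_quo by simp
qed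

lemma topological_group_quo: "topological_group_structure quo qtop"
proof -
  have "continuous_map (prod_topology qtop qtop) qtop (\<lambda>(x, y). x \<otimes>\<^bsub>quo\<^esub> y)"
    unfolding continuous_map_def
  proof (intro conjI allI impI)
    show "(\<lambda>(x, y). x \<otimes>\<^bsub>quo\<^esub> y) \<in> topspace (prod_topology qtop qtop) \<rightarrow> topspace qtop"
    proof
      fix p assume "p \<in> topspace (prod_topology qtop qtop)"
      then obtain x y where "p = (coset x, coset y)" "x \<in> carrier H" "y \<in> carrier H"
        by (auto simp: topspace_qtop)
      then show "(case p of (x, y) \<Rightarrow> x \<otimes>\<^bsub>quo\<^esub> y) \<in> topspace qtop"
        unfolding topspace_qtop using coset_mult by auto
    qed
    fix V assume V: "openin qtop V"
    show "openin (prod_topology qtop qtop) {p \<in> topspace (prod_topology qtop qtop). (case p of (x, y) \<Rightarrow> x \<otimes>\<^bsub>quo\<^esub> y) \<in> V}"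
    proof (subst openin_subopen, intro ballI)
      fix p assume p: "p \<in> {p \<in> topspace (prod_topology qtop qtop). (case p of (x, y) \<Rightarrow> x \<otimes>\<^bsub>quo\<^esub> y) \<in> V}"
      then obtain x y where xy: "p = (coset x, coset y)" "x \<in> carrier H" "y \<in> carrier H"
        by (auto simp: topspace_qtop)
      have "coset (x \<otimes> y) \<in> V" using p coset_mult[OF xy(2,3)] xy(1) by simp
      then obtain A B where AB: "openin \<sigma> A" "openin \<sigma> B" "x \<in> A" "y \<in> B"
        "\<forall>a\<in>A. \<forall>b\<in>B. a \<otimes> b \<in> {x \<in> carrier H. coset x \<in> V}"
        using open_mult[of "{x \<in> carrier H. coset x \<in> V}" x y] V xy(2,3) unfolding openin_qtop by auto
      have AC: "A \<subseteq> carrier H" "B \<subseteq> carrier H" using openin_subset AB(1,2) topspace_eq by auto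
      have "openin (prod_topology qtop qtop) (coset ` A \<times> coset ` B)"
        using openin_qtop_image AB(1,2) by (simp add: openin_prod_Times_iff)
      moreover have "p \<in> coset ` A \<times> coset ` B" using AB(3,4) xy(1) by simp
      moreover have "coset ` A \<times> coset ` B \<subseteq>
          {p \<in> topspace (prod_topology qtop qtop). (case p of (x, y) \<Rightarrow> x \<otimes>\<^bsub>quo\<^esub> y) \<in> V}"
      proof (rule subsetI)
        fix z assume "z \<in> coset ` A \<times> coset ` B"
        then obtain a b where ab: "z = (coset a, coset b)" "a \<in> A" "b \<in> B" by auto
        have "a \<in> carrier H" "b \<in> carrier H" using ab AC by auto
        then show "z \<in> {p \<in> topspace (prod_topology qtop qtop). (case p of (x, y) \<Rightarrow> x \<otimes>\<^bsub>quo\<^esub> y) \<in> V}"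
          using AB(5) ab coset_mult[of a b] by (simp add: topspace_qtop)
      qed
      ultimately show "\<exists>Z. openin (prod_topology qtop qtop) Z \<and> p \<in> Z \<and>
          Z \<subseteq> {p \<in> topspace (prod_topology qtop qtop). (case p of (x, y) \<Rightarrow> x \<otimes>\<^bsub>quo\<^esub> y) \<in> V}" by blast
    qed
  qed
  moreover have "continuous_map qtop qtop (\<lambda>x. inv\<^bsub>quo\<^esub> x)"
    unfolding continuous_map_def
  proof (intro conjI allI impI)
    show "(\<lambda>x. inv\<^bsub>quo\<^esub> x) \<in> topspace qtop \<rightarrow> topspace qtop"
      unfolding topspace_qtop using coset_inv by auto
    fix V assume V: "openin qtop V"
    have "openin \<sigma> {x \<in> topspace \<sigma>. inv x \<in> {x \<in> carrier H. coset x \<in> V}}"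
      by (rule openin_continuous_map_preimage[OF continuous_inv]) (use V in \<open>simp add: openin_qtop\<close>)
    moreover have "{x \<in> topspace \<sigma>. inv x \<in> {x \<in> carrier H. coset x \<in> V}} =
        {x \<in> carrier H. coset x \<in> {c \<in> topspace qtop. inv\<^bsub>quo\<^esub> c \<in> V}}"
      by (auto simp: topspace_eq topspace_qtop coset_inv)
    ultimately show "openin qtop {c \<in> topspace qtop. inv\<^bsub>quo\<^esub> c \<in> V}"
      unfolding openin_qtop topspace_qtop by auto
  qed
  ultimately have "topological_group quo qtop"
    unfolding topological_group_def topspace_qtop carrier_quo using group_quo by blast
  then show ?thesis
    by (intro topological_group_structure.intro group_quo topological_group_structure_axioms.intro)
qed

interpretation Q: topological_group_structure quo qtop by (rule topological_group_quo)

abbreviation "compl \<equiv> group_completion H \<sigma>"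
abbreviation "compl_top \<equiv> group_completion_topology H \<sigma>"
abbreviation "\<eta> \<equiv> completion_map H \<sigma>"

lemma carrier_compl: "carrier compl = Q.points"
  by (simp add: group_completion_def completion_group_def)

lemma compl_semitopological: "semitopological_semigroup compl compl_top"
  unfolding group_completion_def group_completion_topology_def by (rule Q.completion_semitopological)

lemma \<eta>_closed: "x \<in> carrier H \<Longrightarrow> \<eta> x \<in> carrier compl"
  unfolding carrier_compl completion_map_def by (rule Q.nhdsin_completion_point) (simp add: carrier_quo)

lemma \<eta>_mult: "\<lbrakk>x \<in> carrier H; y \<in> carrier H\<rbrakk> \<Longrightarrow> \<eta> x \<otimes>\<^bsub>compl\<^esub> \<eta> y = \<eta> (x \<otimes> y)"
  unfolding completion_map_def group_completion_def
  by (simp only: Q.nhdsin_hom carrier_quo imageI coset_mult)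

lemma \<eta>_one: "\<eta> \<one> = \<one>\<^bsub>compl\<^esub>"
  unfolding completion_map_def group_completion_def coset_one by (simp add: completion_group_def)

lemma continuous_\<eta>: "continuous_map \<sigma> compl_top \<eta>"
proof -
  have "continuous_map \<sigma> qtop coset"
    unfolding continuous_map_def topspace_qtop topspace_eq by (auto simp: openin_qtop)
  from continuous_map_compose[OF this Q.continuous_nhdsin] show ?thesis
    unfolding group_completion_topology_def completion_map_def o_def .
qed

lemma \<eta>_dense:
  assumes "openin compl_top V" and "M \<in> V"
  shows "\<exists>x\<in>carrier H. \<eta> x \<in> V"
proof -
  have M: "M \<in> Q.points"
    using assms openin_subset Q.topspace_ctop unfolding group_completion_topology_def by blast
  note c = Q.completion_points_cauchy[OF M]
  have "eventually (\<lambda>c. nhdsin qtop c \<in> V \<and> c \<in> carrier quo) M"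
    using Q.nhdsin_dense[OF M] assms Q.cauchyD(2)[OF c]
    unfolding group_completion_topology_def by (simp add: eventually_conj_iff)
  then obtain c where "nhdsin qtop c \<in> V" "c \<in> carrier quo"
    using eventually_happens'[OF Q.cauchyD(1)[OF c]] by blast
  then show ?thesis unfolding carrier_quo completion_map_def by blast
qed

lemma compl_functions_eq:
  assumes v: "v \<in> bounded_cont compl_top" and w: "w \<in> bounded_cont compl_top"
    and eq: "\<And>x. x \<in> carrier H \<Longrightarrow> v (\<eta> x) = w (\<eta> x)"
  shows "v = w"
proof (rule extensionalityI[of _ "topspace compl_top"])
  fix M assume M: "M \<in> topspace compl_top"
  show "v M = w M"
  proof (rule ccontr)
    assume neq: "v M \<noteq> w M"
    have "continuous_map compl_top euclidean (\<lambda>M. v M - w M)"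
      using v w by (intro continuous_map_diff) (auto simp: bounded_cont_def)
    then have "openin compl_top {M \<in> topspace compl_top. v M - w M \<in> - {0}}"
      by (rule openin_continuous_map_preimage) (simp add: open_Compl)
    from \<eta>_dense[OF this, of M] obtain x where "x \<in> carrier H" "v (\<eta> x) - w (\<eta> x) \<noteq> 0"
      using M neq by auto
    then show False using eq by simp
  qed
qed (use v w in \<open>auto simp: bounded_cont_def\<close>)

definition left_uniform :: "('a \<Rightarrow> complex) \<Rightarrow> bool" where
  "left_uniform f \<longleftrightarrow> (\<forall>\<epsilon>>0. \<exists>V. openin \<sigma> V \<and> \<one> \<in> V \<and> (\<forall>z\<in>V. \<forall>t\<in>carrier H. cmod (f (z \<otimes> t) - f t) \<le> \<epsilon>))"

text \<open>A left uniform function is constant on the cosets, so any element of a coset represents it.\<close>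

definition lift :: "('a \<Rightarrow> complex) \<Rightarrow> ('a set filter \<Rightarrow> complex)" where
  "lift f = Q.extend (\<lambda>c. f (SOME x. x \<in> c))"

lemma left_uniform_coset:
  assumes f: "left_uniform f" and x: "x \<in> carrier H"
  shows "f (SOME y. y \<in> coset x) = f x"
proof -
  have "(SOME y. y \<in> coset x) \<in> coset x" using coset_self[OF x] by (rule someI)
  then obtain n where n: "n \<in> N" "(SOME y. y \<in> coset x) = n \<otimes> x" using coset_mem_iff[OF x] by blast
  have "cmod (f (n \<otimes> x) - f x) \<le> 0"
  proof (rule field_le_epsilon)
    fix \<epsilon> :: real assume "\<epsilon> > 0"
    then obtain V where V: "openin \<sigma> V" "\<one> \<in> V" "\<forall>z\<in>V. \<forall>t\<in>carrier H. cmod (f (z \<otimes> t) - f t) \<le> \<epsilon>"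
      using f unfolding left_uniform_def by blast
    have "n \<otimes> \<one> \<in> V" by (rule open_saturated[OF V(1,2) n(1)])
    then have "n \<in> V" using n(1) closure_one_iff by simp
    then show "cmod (f (n \<otimes> x) - f x) \<le> 0 + \<epsilon>" using V(3) x by simp
  qed
  then show ?thesis using n(2) by simp
qed

lemma left_uniform_quotient:
  assumes f: "left_uniform f"
  shows "Q.uniformly_cont (\<lambda>c. f (SOME x. x \<in> c))"
  unfolding Q.uniformly_cont_def
proof (intro allI impI)
  fix \<epsilon> :: real assume "\<epsilon> > 0"
  then obtain V where V: "openin \<sigma> V" "\<one> \<in> V" "\<forall>z\<in>V. \<forall>t\<in>carrier H. cmod (f (z \<otimes> t) - f t) \<le> \<epsilon>"
    using f unfolding left_uniform_def by blast
  have "Q.nbhd (coset ` V)"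
    unfolding Q.nbhd_def using openin_qtop_image[OF V(1)] V(2) coset_one by (metis image_eqI)
  moreover have "cmod (f (SOME x. x \<in> c) - f (SOME x. x \<in> d)) \<le> \<epsilon>" if cd: "(c, d) \<in> Q.ent (coset ` V)" for c d
  proof -
    obtain x y where xy: "x \<in> carrier H" "y \<in> carrier H" "c = coset x" "d = coset y"
      using Q.entD[OF cd] unfolding carrier_quo by blast
    have "coset y \<otimes>\<^bsub>quo\<^esub> inv\<^bsub>quo\<^esub> (coset x) \<in> coset ` V" using Q.entD[OF cd] xy by blast
    then have "coset (y \<otimes> inv x) \<in> coset ` V" using xy by (simp only: coset_inv coset_mult inv_closed)
    then have "y \<otimes> inv x \<in> V" using coset_open[OF V(1)] xy by simp
    then have "cmod (f ((y \<otimes> inv x) \<otimes> x) - f x) \<le> \<epsilon>" using V(3) xy by blast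
    then have "cmod (f y - f x) \<le> \<epsilon>" using xy by (simp add: m_assoc)
    then show ?thesis unfolding xy(3,4) left_uniform_coset[OF f xy(1)] left_uniform_coset[OF f xy(2)]
      by (simp add: norm_minus_commute)
  qed
  ultimately show "\<exists>V. Q.nbhd V \<and> (\<forall>c d. (c, d) \<in> Q.ent V \<longrightarrow> cmod (f (SOME x. x \<in> c) - f (SOME x. x \<in> d)) \<le> \<epsilon>)"
    by blast
qed

lemma lift_\<eta>: "\<lbrakk>left_uniform f; x \<in> carrier H\<rbrakk> \<Longrightarrow> lift f (\<eta> x) = f x"
  unfolding lift_def completion_map_def
  by (subst Q.extend_nhdsin) (auto simp: left_uniform_quotient left_uniform_coset carrier_quo)

lemma lift_bound:
  assumes f: "left_uniform f" and M: "M \<in> carrier compl" and b: "\<And>x. x \<in> carrier H \<Longrightarrow> cmod (f x) \<le> b"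
  shows "cmod (lift f M) \<le> b"
  unfolding lift_def
proof (rule Q.extend_bound[OF left_uniform_quotient[OF f]])
  show "M \<in> Q.points" using M carrier_compl by simp
  fix c assume "c \<in> carrier quo"
  then obtain x where "x \<in> carrier H" "c = coset x" unfolding carrier_quo by blast
  then show "cmod (f (SOME x. x \<in> c)) \<le> b" using left_uniform_coset[OF f] b by simp
qed

lemma lift_bounded_cont:
  assumes f: "left_uniform f" and b: "bounded (f ` carrier H)"
  shows "lift f \<in> bounded_cont compl_top"
  unfolding lift_def group_completion_topology_def
proof (rule Q.extend_bounded_cont[OF left_uniform_quotient[OF f]])
  have "(\<lambda>c. f (SOME x. x \<in> c)) ` carrier quo \<subseteq> f ` carrier H"
    unfolding carrier_quo using left_uniform_coset[OF f] by auto
  then show "bounded ((\<lambda>c. f (SOME x. x \<in> c)) ` carrier quo)" using b bounded_subset by blast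
qed

text \<open>Linearity holds on the dense image of the group and extends by continuity.\<close>

lemma lift_bounded_operator:
  assumes A: "function_space (carrier H) A" and unif: "\<And>f. f \<in> A \<Longrightarrow> left_uniform f"
  shows "bounded_operator (carrier H) A (carrier compl) (bounded_cont compl_top) lift"
proof -
  interpret C: semitopological_semigroup compl compl_top by (rule compl_semitopological)
  note Ab = function_spaceD[OF A]
  have bc: "lift f \<in> bounded_cont compl_top" if "f \<in> A" for f
    by (rule lift_bounded_cont[OF unif[OF that] Ab(4)[OF that]])
  have bound: "sup_norm (carrier compl) (lift f) \<le> 1 * sup_norm (carrier H) f" if f: "f \<in> A" for f
    using lift_bound[OF unif[OF f] _ cmod_le_sup_norm[OF Ab(4)[OF f]]] C.carrier_nonempty
    by (intro sup_norm_le) auto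
  have add: "lift (\<lambda>x\<in>carrier H. f x + g x) = (\<lambda>y\<in>carrier compl. lift f y + lift g y)" if fg: "f \<in> A" "g \<in> A" for f g
  proof (rule compl_functions_eq)
    show "lift (\<lambda>x\<in>carrier H. f x + g x) \<in> bounded_cont compl_top" by (rule bc[OF Ab(5)[OF fg]])
    show "(\<lambda>y\<in>carrier compl. lift f y + lift g y) \<in> bounded_cont compl_top"
      by (rule function_spaceD(5)[OF C.bc_space bc[OF fg(1)] bc[OF fg(2)]])
    show "lift (\<lambda>x\<in>carrier H. f x + g x) (\<eta> x) = (\<lambda>y\<in>carrier compl. lift f y + lift g y) (\<eta> x)"
      if "x \<in> carrier H" for x
      using that lift_\<eta>[OF unif[OF Ab(5)[OF fg]]] lift_\<eta>[OF unif[OF fg(1)]] lift_\<eta>[OF unif[OF fg(2)]] \<eta>_closed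
      by simp
  qed
  have scale: "lift (\<lambda>x\<in>carrier H. c * f x) = (\<lambda>y\<in>carrier compl. c * lift f y)" if f: "f \<in> A" for f c
  proof (rule compl_functions_eq)
    show "lift (\<lambda>x\<in>carrier H. c * f x) \<in> bounded_cont compl_top" by (rule bc[OF Ab(6)[OF f]])
    show "(\<lambda>y\<in>carrier compl. c * lift f y) \<in> bounded_cont compl_top"
      by (rule function_spaceD(6)[OF C.bc_space bc[OF f]])
    show "lift (\<lambda>x\<in>carrier H. c * f x) (\<eta> x) = (\<lambda>y\<in>carrier compl. c * lift f y) (\<eta> x)"
      if "x \<in> carrier H" for x
      using that lift_\<eta>[OF unif[OF Ab(6)[OF f]]] lift_\<eta>[OF unif[OF f]] \<eta>_closed by simp
  qed
  show ?thesis unfolding bounded_operator_def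
    using bc add scale bound by (intro conjI exI[of _ 1]) auto
qed

end

section \<open>The idempotent of the topology of a central idempotent\<close>

context central_idempotent
begin

lemma \<tau>e_structure: "topological_group_structure S \<tau>e"
  by (intro topological_group_structure.intro is_group topological_group_structure_axioms.intro
      \<tau>e_topological_group)

interpretation E: topological_group_structure S \<tau>e by (rule \<tau>e_structure)
interpretation C: semitopological_semigroup E.compl E.compl_top by (rule E.compl_semitopological)

definition pullback :: "('a set filter \<Rightarrow> complex) \<Rightarrow> ('a \<Rightarrow> complex)" where
  "pullback v = (\<lambda>x\<in>carrier S. v (E.\<eta> x))"

lemma pullback_continuous:
  assumes "v \<in> bounded_cont E.compl_top"
  shows "continuous_map \<tau>e euclidean (pullback v)"
proof -
  have "continuous_map \<tau>e euclidean (v \<circ> E.\<eta>)"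
    using continuous_map_compose[OF E.continuous_\<eta>, of euclidean v] assms by (simp add: bounded_cont_def)
  then show ?thesis by (rule continuous_map_eq) (simp add: pullback_def)
qed

lemma pullback_bounded_cont:
  assumes v: "v \<in> bounded_cont E.compl_top"
  shows "pullback v \<in> bounded_cont T"
proof -
  have "continuous_map T \<tau>e (\<lambda>x. x)"
    unfolding continuous_map_def
  proof (intro conjI allI impI)
    fix U assume U: "openin \<tau>e U"
    then have "{x \<in> topspace T. x \<in> U} = U" using openin_subset[OF U] topspace_eq by auto
    then show "openin T {x \<in> topspace T. x \<in> U}" using \<tau>e_coarser[OF U] by simp
  qed (use topspace_eq in auto)
  from continuous_map_compose[OF this pullback_continuous[OF v]]
  have "continuous_map T euclidean (pullback v)" by (simp add: o_def)
  moreover have "pullback v ` carrier S \<subseteq> v ` carrier E.compl"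
  proof (rule image_subsetI)
    fix x assume x: "x \<in> carrier S"
    show "pullback v x \<in> v ` carrier E.compl" using E.\<eta>_closed[OF x] x by (simp add: pullback_def)
  qed
  then have "bounded (pullback v ` carrier S)"
    using function_spaceD(4)[OF C.bc_space v] bounded_subset by blast
  ultimately show ?thesis by (simp add: bounded_cont_def topspace_eq pullback_def)
qed

lemma pullback_bounded_operator:
  "bounded_operator (carrier E.compl) (bounded_cont E.compl_top) (carrier S) (bounded_cont T) pullback"
proof -
  have "sup_norm (carrier S) (pullback v) \<le> 1 * sup_norm (carrier E.compl) v" if "v \<in> bounded_cont E.compl_top" for v
    using cmod_le_sup_norm[OF function_spaceD(4)[OF C.bc_space that]] E.\<eta>_closed carrier_nonempty
    by (intro sup_norm_le) (auto simp: pullback_def)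
  then show ?thesis unfolding bounded_operator_def
    by (intro conjI exI[of _ 1])
       (use pullback_bounded_cont E.\<eta>_closed in \<open>auto simp: pullback_def intro!: restrict_ext\<close>)
qed

lemma pullback_WAP:
  assumes v: "v \<in> WAP E.compl E.compl_top"
  shows "pullback v \<in> WAP S T"
proof (rule WAP_if_orbit_in_compact)
  show "compactin weak (pullback ` C.orbit_closure v)"
    by (rule bounded_operator_weakly_compact_image[OF C.bc_space C.bc_space order_refl bc_space
          pullback_bounded_operator C.orbit_closure_compact[OF v] C.orbit_closure_bounded_cont])
  fix s assume s: "s \<in> carrier S"
  have "translate S (pullback v) s = pullback (translate E.compl v (E.\<eta> s))"
    unfolding translate_def pullback_def using s E.\<eta>_closed
    by (auto intro!: restrict_ext simp: mult_closed E.\<eta>_mult)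
  then show "translate S (pullback v) s \<in> pullback ` C.orbit_closure v"
    using C.translate_in_orbit_closure[OF v E.\<eta>_closed[OF s]] by blast
qed (rule pullback_bounded_cont[OF C.WAP_bounded_cont[OF v]])

text \<open>The homomorphism between the compactifications is the transpose of the pullback.\<close>

definition comp_hom :: "(('a \<Rightarrow> complex) \<Rightarrow> complex) \<Rightarrow> (('a set filter \<Rightarrow> complex) \<Rightarrow> complex)" where
  "comp_hom = (\<lambda>s\<in>wap_points S T. \<lambda>v\<in>WAP E.compl E.compl_top. s (pullback v))"

lemma comp_hom_apply:
  "\<lbrakk>s \<in> wap_points S T; v \<in> WAP E.compl E.compl_top\<rbrakk> \<Longrightarrow> comp_hom s v = s (pullback v)"
  by (simp add: comp_hom_def)

lemma comp_hom_points:
  assumes s: "s \<in> wap_points S T"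
  shows "comp_hom s \<in> wap_points E.compl E.compl_top"
proof (rule C.wap_pointsI)
  show "comp_hom s \<in> extensional (WAP E.compl E.compl_top)" using s by (simp add: comp_hom_def)
  fix D and \<delta> :: real assume D: "finite D" "D \<subseteq> WAP E.compl E.compl_top" "\<delta> > 0"
  have "pullback ` D \<subseteq> WAP S T" using D(2) pullback_WAP by blast
  then obtain x where x: "x \<in> carrier S" "\<forall>w\<in>pullback ` D. cmod (w x - s w) < \<delta>"
    using wap_points_approx[OF s, of "pullback ` D" \<delta>] D by auto
  have "cmod (v (E.\<eta> x) - comp_hom s v) < \<delta>" if v: "v \<in> D" for v
  proof -
    have "cmod (pullback v x - s (pullback v)) < \<delta>" using x(2) v by blast
    moreover have "v \<in> WAP E.compl E.compl_top" using v D(2) by blast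
    ultimately show ?thesis using x(1) s by (simp add: comp_hom_apply) (simp add: pullback_def)
  qed
  then show "\<exists>x\<in>carrier E.compl. \<forall>v\<in>D. cmod (v x - comp_hom s v) < \<delta>"
    using E.\<eta>_closed[OF x(1)] by blast
qed

lemma comp_hom_eval:
  assumes s: "s \<in> carrier S"
  shows "comp_hom (wap_eval S T s) = wap_eval E.compl E.compl_top (E.\<eta> s)"
proof (rule extensionalityI[of _ "WAP E.compl E.compl_top"])
  fix v assume v: "v \<in> WAP E.compl E.compl_top"
  have "comp_hom (wap_eval S T s) v = wap_eval S T s (pullback v)"
    by (rule comp_hom_apply[OF wap_eval_points[OF s] v])
  also have "\<dots> = pullback v s" using pullback_WAP[OF v] by (simp add: wap_eval_def)
  also have "\<dots> = wap_eval E.compl E.compl_top (E.\<eta> s) v" using s v by (simp add: pullback_def wap_eval_def)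
  finally show "comp_hom (wap_eval S T s) v = wap_eval E.compl E.compl_top (E.\<eta> s) v" .
qed (use wap_eval_points[OF s] in \<open>simp_all add: comp_hom_def wap_eval_def[of E.compl]\<close>)

lemma comp_hom_continuous:
  "continuous_map (wap_topology S T) (wap_topology E.compl E.compl_top) comp_hom"
proof (rule C.continuous_map_into_wap_topology)
  fix v assume v: "v \<in> WAP E.compl E.compl_top"
  show "continuous_map (wap_topology S T) euclidean (\<lambda>s. comp_hom s v)"
    by (rule continuous_map_eq[OF continuous_map_wap_topology_eval[OF pullback_WAP[OF v]]])
       (simp add: comp_hom_apply v)
qed (use comp_hom_points in auto)

lemma pullback_wap_act:
  assumes s: "s \<in> wap_points S T" and v: "v \<in> WAP E.compl E.compl_top"
  shows "pullback (wap_act E.compl E.compl_top v (comp_hom s)) = wap_act S T (pullback v) s"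
proof (rule extensionalityI[of _ "carrier S"])
  fix x assume x: "x \<in> carrier S"
  have R: "pullback (C.right_translate v (E.\<eta> x)) = right_translate (pullback v) x"
    unfolding pullback_def C.right_translate_def right_translate_def
    using x E.\<eta>_closed by (auto intro!: restrict_ext simp: mult_closed E.\<eta>_mult)
  have "pullback (wap_act E.compl E.compl_top v (comp_hom s)) x = comp_hom s (C.right_translate v (E.\<eta> x))"
    using x E.\<eta>_closed[OF x] by (simp add: C.wap_act_eq[OF comp_hom_points[OF s] v] pullback_def)
  also have "\<dots> = s (pullback (C.right_translate v (E.\<eta> x)))"
    by (rule comp_hom_apply[OF s C.right_translate_WAP[OF v E.\<eta>_closed[OF x]]])
  also have "\<dots> = wap_act S T (pullback v) s x"
    using x by (simp add: wap_act_eq[OF s pullback_WAP[OF v]] R)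
  finally show "pullback (wap_act E.compl E.compl_top v (comp_hom s)) x = wap_act S T (pullback v) s x" .
next
  show "wap_act S T (pullback v) s \<in> extensional (carrier S)"
    by (simp add: wap_act_eq[OF s pullback_WAP[OF v]])
qed (simp add: pullback_def)

lemma comp_hom_mult:
  assumes s: "s \<in> wap_points S T" and s': "s' \<in> wap_points S T"
  shows "comp_hom (comp_mult s s') = C.comp_mult (comp_hom s) (comp_hom s')"
proof (rule extensionalityI[of _ "WAP E.compl E.compl_top"])
  fix v assume v: "v \<in> WAP E.compl E.compl_top"
  have "comp_hom (comp_mult s s') v = s' (wap_act S T (pullback v) s)"
    using comp_hom_apply[OF comp_mult_closed[OF s s'] v] comp_mult_apply[OF pullback_WAP[OF v]] by simp
  also have "\<dots> = comp_hom s' (wap_act E.compl E.compl_top v (comp_hom s))"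
    using comp_hom_apply[OF s' C.wap_act_WAP[OF comp_hom_points[OF s] v]] pullback_wap_act[OF s v] by simp
  also have "\<dots> = C.comp_mult (comp_hom s) (comp_hom s') v" by (simp add: C.comp_mult_apply[OF v])
  finally show "comp_hom (comp_mult s s') v = C.comp_mult (comp_hom s) (comp_hom s') v" .
next
  show "comp_hom (comp_mult s s') \<in> extensional (WAP E.compl E.compl_top)"
    using comp_mult_closed[OF s s'] by (simp add: comp_hom_def)
  show "C.comp_mult (comp_hom s) (comp_hom s') \<in> extensional (WAP E.compl E.compl_top)"
    by (simp add: wap_compactification_def)
qed

text \<open>Uniqueness holds because \<open>S\<close> is dense in its compactification and the target is Hausdorff.\<close>

lemma completion_map_ext_eq: "completion_map_ext S T \<tau>e = comp_hom"
  unfolding completion_map_ext_def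
proof (rule the_equality)
  show "comp_hom \<in> extensional (wap_points S T) \<and>
      comp_hom \<in> hom (wap_compactification S T) (wap_compactification E.compl E.compl_top) \<and>
      continuous_map (wap_topology S T) (wap_topology E.compl E.compl_top) comp_hom \<and>
      (\<forall>s\<in>carrier S. comp_hom (wap_eval S T s) = wap_eval E.compl E.compl_top (E.\<eta> s))"
  proof (intro conjI ballI)
    show "comp_hom \<in> hom (wap_compactification S T) (wap_compactification E.compl E.compl_top)"
    proof (rule homI)
      fix s assume "s \<in> carrier (wap_compactification S T)"
      then have "s \<in> wap_points S T" by (simp add: wap_compactification_def)
      then show "comp_hom s \<in> carrier (wap_compactification E.compl E.compl_top)"
        using comp_hom_points by (simp add: wap_compactification_def)
    next
      fix s s' assume "s \<in> carrier (wap_compactification S T)" "s' \<in> carrier (wap_compactification S T)"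
      then have "s \<in> wap_points S T" "s' \<in> wap_points S T" by (simp_all add: wap_compactification_def)
      then show "comp_hom (comp_mult s s') = C.comp_mult (comp_hom s) (comp_hom s')" by (rule comp_hom_mult)
    qed
  qed (simp_all add: comp_hom_continuous comp_hom_eval, simp add: comp_hom_def)
  fix h assume h: "h \<in> extensional (wap_points S T) \<and>
      h \<in> hom (wap_compactification S T) (wap_compactification E.compl E.compl_top) \<and>
      continuous_map (wap_topology S T) (wap_topology E.compl E.compl_top) h \<and>
      (\<forall>s\<in>carrier S. h (wap_eval S T s) = wap_eval E.compl E.compl_top (E.\<eta> s))"
  show "h = comp_hom"
  proof (rule extensionalityI[of _ "wap_points S T"])
    fix s assume s: "s \<in> wap_points S T"
    obtain F where F: "F \<noteq> bot" "F \<le> principal (carrier S)" "limitin (wap_topology S T) (wap_eval S T) s F"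
      using wap_points_filter[OF s] by blast
    have lim: "limitin (wap_topology E.compl E.compl_top) (h \<circ> wap_eval S T) (h s) F"
      by (rule continuous_map_limit[OF _ F(3)]) (use h in blast)
    have lim': "limitin (wap_topology E.compl E.compl_top) (comp_hom \<circ> wap_eval S T) (comp_hom s) F"
      by (rule continuous_map_limit[OF comp_hom_continuous F(3)])
    have "eventually (\<lambda>x. x \<in> carrier S) F" using F(2) by (simp add: le_principal)
    then have "eventually (\<lambda>x. (h \<circ> wap_eval S T) x = (comp_hom \<circ> wap_eval S T) x) F"
      by (rule eventually_mono) (use h comp_hom_eval in simp)
    then have "limitin (wap_topology E.compl E.compl_top) (comp_hom \<circ> wap_eval S T) (h s) F"
      using lim by (rule limitin_transform_eventually)
    then show "h s = comp_hom s" by (rule limitin_Hausdorff_unique[OF _ lim' F(1) C.Hausdorff_wap_topology])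
  qed (use h in \<open>simp_all add: comp_hom_def\<close>)
qed

abbreviation "identity_fibre \<equiv> {s \<in> wap_points S T.
  completion_map_ext S T \<tau>e s = \<one>\<^bsub>wap_compactification E.compl E.compl_top\<^esub>}"

lemma identity_fibre_iff:
  "s \<in> identity_fibre \<longleftrightarrow> s \<in> wap_points S T \<and> (\<forall>v\<in>WAP E.compl E.compl_top. s (pullback v) = pullback v \<one>)"
proof -
  have one: "\<one>\<^bsub>wap_compactification E.compl E.compl_top\<^esub> = wap_eval E.compl E.compl_top (E.\<eta> \<one>)"
    by (simp add: wap_compactification_def E.\<eta>_one)
  have "comp_hom s = wap_eval E.compl E.compl_top (E.\<eta> \<one>) \<longleftrightarrow>
      (\<forall>v\<in>WAP E.compl E.compl_top. s (pullback v) = pullback v \<one>)" if s: "s \<in> wap_points S T"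
  proof
    assume eq: "comp_hom s = wap_eval E.compl E.compl_top (E.\<eta> \<one>)"
    show "\<forall>v\<in>WAP E.compl E.compl_top. s (pullback v) = pullback v \<one>"
    proof
      fix v assume v: "v \<in> WAP E.compl E.compl_top"
      show "s (pullback v) = pullback v \<one>"
        using comp_hom_apply[OF s v] v by (simp add: eq wap_eval_def pullback_def)
    qed
  next
    assume r: "\<forall>v\<in>WAP E.compl E.compl_top. s (pullback v) = pullback v \<one>"
    show "comp_hom s = wap_eval E.compl E.compl_top (E.\<eta> \<one>)"
    proof (rule extensionalityI[of _ "WAP E.compl E.compl_top"])
      fix v assume v: "v \<in> WAP E.compl E.compl_top"
      have "comp_hom s v = pullback v \<one>" using comp_hom_apply[OF s v] r v by simp
      then show "comp_hom s v = wap_eval E.compl E.compl_top (E.\<eta> \<one>) v"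
        using v by (simp add: wap_eval_def pullback_def)
    qed (use s in \<open>simp_all add: comp_hom_def wap_eval_def\<close>)
  qed
  then show ?thesis unfolding completion_map_ext_eq one by blast
qed

text \<open>A filter that converges to \<open>e\<close> converges to the identity for \<open>\<tau>e\<close>, and \<open>v \<circ> \<eta>\<close> is continuous for this topology.\<close>

lemma e_in_identity_fibre: "e \<in> identity_fibre"
  unfolding identity_fibre_iff
proof (intro conjI ballI e_point)
  fix v assume v: "v \<in> WAP E.compl E.compl_top"
  obtain F where F: "F \<noteq> bot" "\<And>u. u \<in> WAP S T \<Longrightarrow> (u \<longlongrightarrow> e u) F"
    "\<And>U. openin \<tau>e U \<Longrightarrow> \<one> \<in> U \<Longrightarrow> eventually (\<lambda>x. x \<in> U) F"
    using filter_to_e by metis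
  have "(pullback v \<longlongrightarrow> pullback v \<one>) F"
  proof (rule tendstoI)
    fix \<epsilon> :: real assume \<epsilon>: "\<epsilon> > 0"
    have "eventually (\<lambda>x. x \<in> {x \<in> topspace \<tau>e. dist (pullback v x) (pullback v \<one>) < \<epsilon>}) F"
      by (rule F(3)[OF continuous_map_metricD[OF pullback_continuous[OF C.WAP_bounded_cont[OF v]]]]) (use \<epsilon> in simp)
    then show "eventually (\<lambda>x. dist (pullback v x) (pullback v \<one>) < \<epsilon>) F" by (rule eventually_mono) simp
  qed
  then show "e (pullback v) = pullback v \<one>" using tendsto_unique[OF F(1) F(2)[OF pullback_WAP[OF v]]] by blast
qed

lemma fixed_functions_left_uniform: "f \<in> fixed_functions \<Longrightarrow> E.left_uniform f"
  unfolding E.left_uniform_def using \<tau>e_uniform by blast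

lemma fixed_functions_space: "function_space (carrier S) fixed_functions"
proof -
  note op = wap_act_bounded_operator[OF e_point]
  show ?thesis
    unfolding function_space_def
  proof (intro conjI ballI allI)
    show "carrier S \<noteq> {}" by (rule carrier_nonempty)
    show "fixed_functions \<noteq> {}" unfolding fixed_functions_def using function_spaceD(2)[OF WAP_space] by simp
    show "fixed_functions \<subseteq> extensional (carrier S)"
      using fixed_functions_WAP function_spaceD(3)[OF WAP_space] by blast
    show "bounded (f ` carrier S)" if "f \<in> fixed_functions" for f
      using that fixed_functions_WAP function_spaceD(4)[OF WAP_space] by blast
  next
    fix f g assume "f \<in> fixed_functions" "g \<in> fixed_functions"
    then obtain u w where uw: "u \<in> WAP S T" "w \<in> WAP S T" "f = wap_act S T u e" "g = wap_act S T w e"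
      unfolding fixed_functions_def by blast
    then have "(\<lambda>x\<in>carrier S. f x + g x) = wap_act S T (\<lambda>x\<in>carrier S. u x + w x) e"
      using op unfolding bounded_operator_def by simp
    then show "(\<lambda>x\<in>carrier S. f x + g x) \<in> fixed_functions"
      unfolding fixed_functions_def using WAP_add[OF uw(1,2)] by blast
  next
    fix c f assume "f \<in> fixed_functions"
    then obtain u where u: "u \<in> WAP S T" "f = wap_act S T u e" unfolding fixed_functions_def by blast
    then have "(\<lambda>x\<in>carrier S. c * f x) = wap_act S T (\<lambda>x\<in>carrier S. c * u x) e"
      using op unfolding bounded_operator_def by simp
    then show "(\<lambda>x\<in>carrier S. c * f x) \<in> fixed_functions"
      unfolding fixed_functions_def using WAP_scale[OF u(1)] by blast
  qed
qed

text \<open>The functions \<open>u \<cdot> e\<close> extend to weakly almost periodic functions on the completion. The orbit of the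
  extension lies in the image of the orbit closure of \<open>u\<close> under two bounded operators. The image is weakly
  compact and hence pointwise closed, so that it suffices to consider translates by elements of \<open>S\<close>.\<close>

lemma lift_WAP:
  assumes u: "u \<in> WAP S T"
  shows "E.lift (wap_act S T u e) \<in> WAP E.compl E.compl_top"
proof -
  define f where "f = wap_act S T u e"
  define v where "v = E.lift f"
  have f: "f \<in> fixed_functions" unfolding f_def fixed_functions_def using u by blast
  note op = wap_act_bounded_operator[OF e_point] and lift_op = E.lift_bounded_operator[OF fixed_functions_space fixed_functions_left_uniform]
  have op': "bounded_operator (carrier S) (WAP S T) (carrier S) (bounded_cont T) (\<lambda>u. wap_act S T u e)"
    using op WAP_bounded_cont unfolding bounded_operator_def by blast
  define K where "K = (\<lambda>u. wap_act S T u e) ` orbit_closure u"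
  have ocW: "orbit_closure u \<subseteq> WAP S T" using orbit_closure_WAP[OF u] by blast
  have K: "compactin weak K" unfolding K_def
    by (rule bounded_operator_weakly_compact_image[OF bc_space WAP_space _ bc_space op' orbit_closure_compact[OF u] ocW])
       (use WAP_bounded_cont in blast)
  have Kfix: "K \<subseteq> fixed_functions" unfolding K_def fixed_functions_def using ocW by blast
  have compact: "compactin C.weak (E.lift ` K)"
    by (rule bounded_operator_weakly_compact_image[OF bc_space fixed_functions_space _ C.bc_space lift_op K Kfix])
       (use fixed_functions_WAP WAP_bounded_cont in blast)
  have v_bc: "v \<in> bounded_cont E.compl_top"
    using lift_op f unfolding v_def bounded_operator_def by blast
  have "v \<in> WAP E.compl E.compl_top"
  proof (rule C.WAP_if_orbit_in_compact[OF v_bc compact])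
    fix P assume P: "P \<in> carrier E.compl"
    show "translate E.compl v P \<in> E.lift ` K"
    proof (rule weakly_compact_pointwise_closed[OF C.bc_space compact])
      show "translate E.compl v P \<in> extensional (carrier E.compl)" by (simp add: translate_def)
      fix D and \<delta> :: real assume D: "finite D" "D \<subseteq> carrier E.compl" "\<delta> > 0"
      let ?V = "{M \<in> topspace E.compl_top. \<forall>Q\<in>D. dist (C.right_translate v Q M) (C.right_translate v Q P) < \<delta>}"
      have "openin E.compl_top ?V"
      proof (intro openin_Collect_finite_ball D(1) continuous_map_metricD)
        fix Q assume "Q \<in> D"
        then show "continuous_map E.compl_top euclidean (C.right_translate v Q)"
          using C.right_translate_bounded_cont[OF v_bc] D(2) by (auto simp: bounded_cont_def)
      qed
      moreover have "P \<in> ?V" using P D(3) by (simp add: C.topspace_eq)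
      ultimately obtain x where x: "x \<in> carrier S" "E.\<eta> x \<in> ?V" using E.\<eta>_dense by blast
      note \<eta>x = E.\<eta>_closed[OF x(1)]
      have "translate S f x = wap_act S T (translate S u x) e"
        unfolding f_def by (rule translate_act_e[OF u x(1)])
      then have k: "translate S f x \<in> K" unfolding K_def using translate_in_orbit_closure[OF u x(1)] by blast
      then have kfix: "translate S f x \<in> fixed_functions" using Kfix by blast
      have "E.lift (translate S f x) = translate E.compl v (E.\<eta> x)"
      proof (rule E.compl_functions_eq)
        show "E.lift (translate S f x) \<in> bounded_cont E.compl_top"
          using lift_op kfix unfolding bounded_operator_def by blast
        show "translate E.compl v (E.\<eta> x) \<in> bounded_cont E.compl_top"
          by (rule C.translate_bounded_cont[OF v_bc \<eta>x])
        fix y assume y: "y \<in> carrier S"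
        have "E.lift (translate S f x) (E.\<eta> y) = f (x \<otimes> y)"
          using E.lift_\<eta>[OF fixed_functions_left_uniform[OF kfix] y] y by (simp add: translate_def)
        also have "\<dots> = v (E.\<eta> (x \<otimes> y))"
          unfolding v_def by (rule E.lift_\<eta>[OF fixed_functions_left_uniform[OF f] mult_closed[OF x(1) y], symmetric])
        also have "\<dots> = translate E.compl v (E.\<eta> x) (E.\<eta> y)"
          using E.\<eta>_mult[OF x(1) y] E.\<eta>_closed[OF y] by (simp add: translate_def)
        finally show "E.lift (translate S f x) (E.\<eta> y) = translate E.compl v (E.\<eta> x) (E.\<eta> y)" .
      qed
      then have "\<forall>Q\<in>D. cmod (E.lift (translate S f x) Q - translate E.compl v P Q) < \<delta>"
        using x(2) P \<eta>x D(2) by (auto simp: translate_def C.right_translate_def dist_norm subset_eq)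
      then show "\<exists>k\<in>E.lift ` K. \<forall>Q\<in>D. cmod (k Q - translate E.compl v P Q) < \<delta>" using k by blast
    qed
  qed
  then show ?thesis unfolding v_def f_def .
qed

text \<open>The element \<open>s\<close> takes the value \<open>v (\<eta> 1)\<close> at every pullback \<open>v \<circ> \<eta>\<close>, and \<open>u \<cdot> e\<close> is such a pullback.\<close>

lemma identity_fibre_absorbed:
  assumes s: "s \<in> identity_fibre"
  shows "comp_mult e s = e"
proof (rule extensionalityI[of _ "WAP S T"])
  fix u assume u: "u \<in> WAP S T"
  define f where "f = wap_act S T u e"
  have f: "f \<in> fixed_functions" unfolding f_def fixed_functions_def using u by blast
  have fW: "f \<in> WAP S T" using f fixed_functions_WAP by blast
  have pull: "pullback (E.lift f) = f"
  proof (rule extensionalityI[of _ "carrier S"])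
    show "f \<in> extensional (carrier S)" by (rule function_spaceD(3)[OF WAP_space fW])
    fix x assume x: "x \<in> carrier S"
    then show "pullback (E.lift f) x = f x"
      using E.lift_\<eta>[OF fixed_functions_left_uniform[OF f] x] by (simp add: pullback_def)
  qed (simp add: pullback_def)
  have "s (pullback (E.lift f)) = pullback (E.lift f) \<one>"
    using s lift_WAP[OF u] unfolding identity_fibre_iff f_def by blast
  then have "s f = f \<one>" using pull by simp
  then show "comp_mult e s u = e u"
    using u wap_act_one[OF e_point u] by (simp add: comp_mult_apply f_def)
qed (use wap_points_extensional[OF e_point] in \<open>simp_all add: wap_compactification_def\<close>)

text \<open>So \<open>e\<close> is a zero element of the fibre, and the only minimal idempotent in it.\<close>

theorem topology_idempotent_eq: "topology_idempotent S T \<tau>e = e"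
  unfolding topology_idempotent_def
proof (rule the_equality)
  show "minimal_idempotent_in (wap_compactification S T) identity_fibre e"
    unfolding minimal_idempotent_in_def using e_in_identity_fibre e_idem identity_fibre_absorbed by auto
  fix f assume f: "minimal_idempotent_in (wap_compactification S T) identity_fibre f"
  then have fk: "f \<in> identity_fibre" unfolding minimal_idempotent_in_def by blast
  then have "f \<in> wap_points S T" by blast
  then have "comp_mult e f = e" "comp_mult f e = e" using identity_fibre_absorbed[OF fk] e_commute by auto
  then show "f = e" using f e_in_identity_fibre e_idem unfolding minimal_idempotent_in_def by blast
qed

end

text \<open>A filter that converges to \<open>e\<close> contains \<open>U\<close>, and the functions \<open>u\<^sub>k\<close> tend to \<open>e (u\<^sub>k) = 0\<close> along it.\<close>

theorem lemma3p3:
  fixes G :: "('a, 'm) monoid_scheme" and \<tau>G \<tau> :: "'a topology"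
    and u :: "nat \<Rightarrow> 'a \<Rightarrow> complex" and n :: nat and \<epsilon> :: real and U :: "'a set"
  assumes "weakly_almost_periodic_group G \<tau>G"
    and "\<tau> \<in> central_topologies G \<tau>G"
    and "\<And>k. k \<in> {1..n} \<Longrightarrow> u k \<in> topology_ideal G \<tau>G \<tau>"
    and "\<epsilon> > 0"
    and "U \<subseteq> carrier G"
    and "\<exists>V. openin \<tau> V \<and> \<one>\<^bsub>G\<^esub> \<in> V \<and> V \<subseteq> U"
  shows "\<exists>t\<in>U. \<forall>k\<in>{1..n}. cmod (u k t) < \<epsilon>"
proof -
  have top: "topological_group G \<tau>G" using assms(1) by (simp add: weakly_almost_periodic_group_def)
  then interpret group G by (simp add: topological_group_def)
  interpret H: topological_group_structure G \<tau>G by unfold_locales (rule top)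
  interpret semitopological_semigroup G \<tau>G by (rule H.semitopological)
  obtain e where e: "e \<in> central_idempotents (wap_compactification G \<tau>G)" "\<tau> = idempotent_topology G \<tau>G e"
    using assms(2) unfolding central_topologies_def by blast
  interpret I: central_idempotent G \<tau>G e by unfold_locales (rule e(1))
  have \<tau>: "\<tau> = I.\<tau>e" using e(2) I.idempotent_topology_eq by simp
  have u: "u k \<in> WAP G \<tau>G" "e (u k) = 0" if "k \<in> {1..n}" for k
  proof -
    have uk: "u k \<in> WAP G \<tau>G" "wap_act G \<tau>G (u k) e = (\<lambda>t\<in>carrier G. 0)"
      using assms(3)[OF that] unfolding topology_ideal_def \<tau> I.topology_idempotent_eq by auto
    then show "u k \<in> WAP G \<tau>G" "e (u k) = 0" using I.wap_act_one[OF I.e_point uk(1)] by auto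
  qed
  obtain V where V: "openin I.\<tau>e V" "\<one>\<^bsub>G\<^esub> \<in> V" "V \<subseteq> U" using assms(6) \<tau> by blast
  obtain F where F: "F \<noteq> bot" "\<And>w. w \<in> WAP G \<tau>G \<Longrightarrow> (w \<longlongrightarrow> e w) F"
    "\<And>U. openin I.\<tau>e U \<Longrightarrow> \<one>\<^bsub>G\<^esub> \<in> U \<Longrightarrow> eventually (\<lambda>x. x \<in> U) F"
    using I.filter_to_e by metis
  have "eventually (\<lambda>x. cmod (u k x) < \<epsilon>) F" if k: "k \<in> {1..n}" for k
    using tendstoD[OF F(2)[OF u(1)[OF k]] \<open>\<epsilon> > 0\<close>] u(2)[OF k] by simp
  then have "eventually (\<lambda>x. \<forall>k\<in>{1..n}. cmod (u k x) < \<epsilon>) F" by (simp add: eventually_ball_finite)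
  with F(3)[OF V(1,2)] have "eventually (\<lambda>x. x \<in> V \<and> (\<forall>k\<in>{1..n}. cmod (u k x) < \<epsilon>)) F"
    by (rule eventually_conj)
  then obtain t where "t \<in> V" "\<forall>k\<in>{1..n}. cmod (u k t) < \<epsilon>" using eventually_happens'[OF F(1)] by blast
  then show ?thesis using V(3) by blast
qed

end
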